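(* Let $\Omega\subseteq[0,1]^d$ be a closed Peano–Jordan measurable set with positive measure, let $a_i\in C^1(\Omega)$ and let $b_i,c$ be continuous functions on $\Omega$ ($i=1,\dots,d$), all real-valued. Let $\mathbf n+\mathbf 1=n\boldsymbol\nu$ with $\boldsymbol\nu=(\nu_1,\dots,\nu_d)$ a fixed vector of (positive) rational constants, and let $A_{\mathbf n}^{\Omega^\circ}$ be the matrix of the Shortley–Weller finite difference discretization of $$-\sum_{i=1}^d\frac{\partial}{\partial x_i}\Big(a_i\frac{\partial u}{\partial x_i}\Big)+\sum_{i=1}^db_i\frac{\partial u}{\partial x_i}+cu=f\ \text{ in }\Omega^\circ,\qquad u=0\ \text{ on }\partial\Omega,$$ as defined explicitly in the context. Then $$\{n^{-2}A_{\mathbf n}^{\Omega^\circ}\}_n\sim_\lambda\kappa(x,\theta)=\sum_{i=1}^d\nu_i^2a_i(x)(2-2\cos\theta_i),\qquad (x,\theta)\in\Omega^\circ\times[-\pi,\pi]^d.$$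
   Context: Multi-index conventions. $\mathbf n=(n_1,\dots,n_d)\in\mathbb N^d$ depends on $n$, with $\mathbf n+\mathbf 1=n\boldsymbol\nu$ ($n$ ranging over the positive integers for which $n\boldsymbol\nu$ is an integer vector); operations on multi-indices are componentwise; $\mathbf 1=(1,\dots,1)$; $\mathbf e_i$ are the canonical basis vectors. $\mu$ is Lebesgue measure; a set is Peano–Jordan measurable iff its boundary has measure zero. $\Omega^\circ$ is the interior of $\Omega$ in $\mathbb R^d$. Shortley–Weller matrix. Let $h_i=1/(n_i+1)$ and $x_{\mathbf j}=(j_1h_1,\dots,j_dh_d)$ for real vectors $\mathbf j$ (so $x_{\mathbf j}+sh_i\mathbf e_i=x_{\mathbf j+s\mathbf e_i}$). $\Xi_n=\{x_{\mathbf j}:\mathbf 0\le\mathbf j\le\mathbf n+\mathbf 1,\ \mathbf j\in\mathbb Z^d\}$ and $\Xi_n'=\Xi_n\cap\Omega^\circ$. For $x_{\mathbf j}\in\Xi_n'$ set $s_i^\pm=s_i^\pm(\mathbf j)=\sup\{t\in[0,1]: x_{\mathbf j}\pm rh_i\mathbf e_i\in\Omega^\circ\ \forall\,0\le r\le t\}\in(0,1]$. The rows and columns of $A_{\mathbf n}^{\Omega^\circ}$ are indexed by those $\mathbf j$ with $x_{\mathbf j}\in\Xi'_n$, in lexicographic order, and $$(A_{\mathbf n}^{\Omega^\circ})_{\mathbf j,\mathbf i}=\begin{cases}\displaystyle\sum_{i=1}^d\Big[\frac{a_i(x_{\mathbf j+s_i^+\mathbf e_i/2})}{\frac12s_i^+(s_i^++s_i^-)h_i^2}+\frac{a_i(x_{\mathbf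 j-s_i^-\mathbf e_i/2})}{\frac12s_i^-(s_i^++s_i^-)h_i^2}\Big]+c(x_{\mathbf j}),&\mathbf i=\mathbf j,\\[2mm] \displaystyle\frac{-a_i(x_{\mathbf j\pm\mathbf e_i/2})}{\frac12(s_i^++s_i^-)h_i^2}\pm\frac{b_i(x_{\mathbf j})}{(s_i^++s_i^-)h_i},&\mathbf i=\mathbf j\pm\mathbf e_i,\ s_i^\pm=1,\\ 0,&\text{otherwise.}\end{cases}$$ Spectral symbol. For a sequence $\{A_n\}_n$ of square matrices of size $d_n\to\infty$ and a measurable $f:D\to\mathbb C$ with $D\subset\mathbb R^q$ measurable, $0<\mu(D)<\infty$, $\{A_n\}_n\sim_\lambda f$ means $\lim_n\frac1{d_n}\sum_{i=1}^{d_n}F(\lambda_i(A_n))=\frac1{\mu(D)}\int_DF(f)$ for all continuous compactly supported $F:\mathbb C\to\mathbb C$, where $\lambda_i(A_n)$ are the eigenvalues. *)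

theory Defs
  imports
    "HOL-Analysis.Analysis"
    "HOL-Library.Fun_Lexorder"
    "HOL-Computational_Algebra.Fundamental_Theorem_Algebra"
    "Jordan_Normal_Form.Char_Poly"
begin

no_notation vec_index (infixl "$" 100)

subsection \<open>Regularity of the domain and of the coefficients\<close>

definition peano_jordan_measurable :: "'a::euclidean_space set \<Rightarrow> bool" where
  "peano_jordan_measurable S \<longleftrightarrow> frontier S \<in> null_sets lebesgue"

text \<open>Continuous differentiability on a closed set: differentiable in the interior, with a
  gradient that extends continuously to the whole set.\<close>

definition C1_on :: "'a::euclidean_space set \<Rightarrow> ('a \<Rightarrow> real) \<Rightarrow> bool" where
  "C1_on S f \<longleftrightarrow>
     continuous_on S f \<and> (\<exists>g. continuous_on S g \<and> (\<forall>x\<in>interior S. GDERIV f x :> g x))"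

subsection \<open>The Shortley--Weller matrix\<close>

text \<open>The space dimension is \<open>CARD('d)\<close>; the linear order on \<open>'d\<close> is only used to order the
  multi-indices lexicographically. The grid size is a vector \<open>n :: nat ^ 'd\<close>, whereas the positions
  \<open>j :: real ^ 'd\<close> are real vectors, because the coefficients are also evaluated between grid
  points.\<close>

definition sw_step :: "nat ^ 'd \<Rightarrow> 'd \<Rightarrow> real" where
  "sw_step n i = 1 / (real (n $ i) + 1)"

definition sw_point :: "nat ^ 'd \<Rightarrow> real ^ 'd \<Rightarrow> real ^ 'd" where
  "sw_point n j = (\<chi> i. j $ i * sw_step n i)"

definition sw_indices :: "(real ^ 'd) set \<Rightarrow> nat ^ 'd \<Rightarrow> (real ^ 'd) set" where
  "sw_indices \<Omega> n =
     {j. (\<forall>i. j $ i \<in> \<int> \<and> 0 \<le> j $ i \<and> j $ i \<le> real (n $ i) + 1) \<and> sw_point n j \<in> interior \<Omega>}"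

text \<open>The sign \<open>\<sigma> \<in> {1, -1}\<close> selects between \<open>s\<^sub>i\<^sup>+\<close> and \<open>s\<^sub>i\<^sup>-\<close>.\<close>

definition sw_s :: "(real ^ 'd) set \<Rightarrow> nat ^ 'd \<Rightarrow> real \<Rightarrow> 'd \<Rightarrow> real ^ 'd \<Rightarrow> real" where
  "sw_s \<Omega> n \<sigma> i j =
     Sup {t \<in> {0..1}. \<forall>r\<in>{0..t}. sw_point n j + (\<sigma> * r * sw_step n i) *\<^sub>R axis i 1 \<in> interior \<Omega>}"

text \<open>In the off-diagonal case at most one of the summands is nonzero, as \<open>k = j \<plusminus> e\<^sub>i\<close> determines
  both \<open>i\<close> and the sign.\<close>

definition sw_entry ::
  "(real ^ 'd) set \<Rightarrow> ('d \<Rightarrow> real ^ 'd \<Rightarrow> real) \<Rightarrow> ('d \<Rightarrow> real ^ 'd \<Rightarrow> real) \<Rightarrow> (real ^ 'd \<Rightarrow> real) \<Rightarrow>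
   nat ^ 'd \<Rightarrow> real ^ 'd \<Rightarrow> real ^ 'd \<Rightarrow> real" where
  "sw_entry \<Omega> a b c n j k =
     (let h = sw_step n; x = sw_point n;
          sp = (\<lambda>i. sw_s \<Omega> n 1 i j); sm = (\<lambda>i. sw_s \<Omega> n (-1) i j)
      in if k = j then
           (\<Sum>i\<in>UNIV. a i (x (j + (sp i / 2) *\<^sub>R axis i 1)) / (1 / 2 * sp i * (sp i + sm i) * (h i)\<^sup>2)
                   + a i (x (j - (sm i / 2) *\<^sub>R axis i 1)) / (1 / 2 * sm i * (sp i + sm i) * (h i)\<^sup>2))
           + c (x j)
         else
           (\<Sum>i\<in>UNIV.
             (if k = j + axis i 1 \<and> sp i = 1
              then - a i (x (j + (1 / 2) *\<^sub>R axis i 1)) / (1 / 2 * (sp i + sm i) * (h i)\<^sup>2)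
                   + b i (x j) / ((sp i + sm i) * h i)
              else 0)
           + (if k = j - axis i 1 \<and> sm i = 1
              then - a i (x (j - (1 / 2) *\<^sub>R axis i 1)) / (1 / 2 * (sp i + sm i) * (h i)\<^sup>2)
                   - b i (x j) / ((sp i + sm i) * h i)
              else 0)))"

abbreviation lex_less :: "real ^ 'd::{finite,linorder} \<Rightarrow> real ^ 'd::{finite,linorder} \<Rightarrow> bool" where
  "lex_less j k \<equiv> less_fun (\<lambda>i. j $ i) (\<lambda>i. k $ i)"

definition lex_list :: "(real ^ 'd::{finite,linorder}) set \<Rightarrow> (real ^ 'd::{finite,linorder}) list" where
  "lex_list S = (THE xs. sorted_wrt lex_less xs \<and> set xs = S)"

lemma linorder_lex_less:
  "class.linorder (\<lambda>j k. lex_less j k \<or> j = k) (lex_less :: real ^ 'd::{finite,linorder} \<Rightarrow> _)"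
proof
  fix j k l :: "real ^ 'd::{finite,linorder}"
  show "lex_less j k \<longleftrightarrow> (lex_less j k \<or> j = k) \<and> \<not> (lex_less k j \<or> k = j)"
    using less_fun_asym less_fun_irrefl by blast
  show "lex_less j l \<or> j = l" if "lex_less j k \<or> j = k" "lex_less k l \<or> k = l"
    using that less_fun_trans by blast
  show "j = k" if "lex_less j k \<or> j = k" "lex_less k j \<or> k = j"
    using that less_fun_asym by blast
  show "(lex_less j k \<or> j = k) \<or> (lex_less k j \<or> k = j)"
    using less_fun_trichotomy[of "\<lambda>i. j $ i" "\<lambda>i. k $ i"] by (auto simp: Finite_Cartesian_Product.vec_eq_iff fun_eq_iff)
qed simp

lemma lex_list_unique:
  fixes S :: "(real ^ 'd::{finite,linorder}) set"
  assumes "finite S"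
  shows "\<exists>!xs. sorted_wrt lex_less xs \<and> set xs = S"
proof -
  interpret lex: linorder "\<lambda>j k :: real ^ 'd::{finite,linorder}. lex_less j k \<or> j = k" lex_less
    by (rule linorder_lex_less)
  show ?thesis
    using lex.ex1_sorted_list_for_set_if_finite[OF assms] .
qed

lemma finite_sw_indices: "finite (sw_indices \<Omega> n)"
proof -
  have "j \<in> vec_lambda ` (PiE UNIV (\<lambda>i. {z \<in> \<int>. 0 \<le> z \<and> z \<le> real (n $ i) + 1}))"
    if "j \<in> sw_indices \<Omega> n" for j
    using that by (intro image_eqI[where x = "vec_nth j"]) (auto simp: sw_indices_def)
  moreover have "finite (PiE UNIV (\<lambda>i. {z \<in> \<int>. 0 \<le> z \<and> z \<le> real (n $ i) + 1}))"
    by (intro finite_PiE finite finite_int_segment)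
  ultimately show ?thesis
    by (meson finite_imageI finite_subset subsetI)
qed

definition shortley_weller_mat ::
  "(real ^ 'd::{finite,linorder}) set \<Rightarrow> ('d::{finite,linorder} \<Rightarrow> real ^ 'd::{finite,linorder} \<Rightarrow> real) \<Rightarrow> ('d::{finite,linorder} \<Rightarrow> real ^ 'd::{finite,linorder} \<Rightarrow> real) \<Rightarrow>
   (real ^ 'd::{finite,linorder} \<Rightarrow> real) \<Rightarrow> nat ^ 'd::{finite,linorder} \<Rightarrow> real mat" where
  "shortley_weller_mat \<Omega> a b c n =
     (let js = lex_list (sw_indices \<Omega> n)
      in mat (length js) (length js) (\<lambda>(p, q). sw_entry \<Omega> a b c n (js ! p) (js ! q)))"

subsection \<open>Spectral symbols\<close>

definition eigenvalues_mset :: "complex mat \<Rightarrow> complex multiset" where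
  "eigenvalues_mset A = proots (char_poly A)"

text \<open>The sequence is indexed by an infinite set \<open>I\<close> of natural numbers, and limits are taken for
  \<open>n \<rightarrow> \<infinity>\<close> within \<open>I\<close>.\<close>

definition spectral_symbol ::
  "nat set \<Rightarrow> (nat \<Rightarrow> complex mat) \<Rightarrow> 'q::euclidean_space set \<Rightarrow> ('q \<Rightarrow> complex) \<Rightarrow> bool" where
  "spectral_symbol I A D f \<longleftrightarrow>
     infinite I \<and>
     (\<forall>n\<in>I. square_mat (A n)) \<and>
     filterlim (\<lambda>n. dim_row (A n)) at_top (inf sequentially (principal I)) \<and>
     D \<in> sets lebesgue \<and> 0 < emeasure lebesgue D \<and> emeasure lebesgue D < \<infinity> \<and>
     f \<in> borel_measurable (lebesgue_on D) \<and>
     (\<forall>F :: complex \<Rightarrow> complex.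
        continuous_on UNIV F \<and> compact (closure {z. F z \<noteq> 0}) \<longrightarrow>
        ((\<lambda>n. 1 / of_nat (dim_row (A n)) * (\<Sum>z\<in>#eigenvalues_mset (A n). F z)) \<longlongrightarrow>
           1 / complex_of_real (measure lebesgue D) * (LINT x:D|lebesgue. F (f x)))
          (inf sequentially (principal I)))"

end

theory Submission
  imports Defs "Jordan_Normal_Form.Schur_Decomposition" "HOL-Library.Real_Mod"
begin

text \<open>A unitary Schur form \<open>A U = U T\<close> is tested against wave packets: plane waves of frequency
  \<open>\<theta> \<in> (\<pi> / Q) \<int>\<^sup>d\<close>, cut off to a cube of \<open>2 Q\<close> grid points per direction based at a grid point \<open>m\<close>.
  By discrete Parseval they form a tight frame, and a packet whose cube lies well inside \<open>\<Omega>\<close> is an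
  approximate eigenvector of the adjoint of \<open>A\<close> for the value \<open>\<kappa>(x\<^sub>m, \<theta>)\<close>, the relative squared error being
  \<open>O(1 / Q) + o(1)\<close>. Hence the squared distances between the eigenvalues and the values of the symbol,
  weighted by the squared overlaps of packets and Schur vectors, are small on average; the strictly
  triangular part of \<open>T\<close> is controlled by the Frobenius norm of \<open>A - A\<^sup>*\<close>. The rows near the boundary
  are few because the boundary is a null set; their unbounded entries sit on the diagonal, where they
  cancel in \<open>A - A\<^sup>*\<close>. Letting first \<open>n\<close> and then \<open>Q\<close> tend to infinity turns the sums over \<open>m\<close> and
  \<open>\<theta>\<close> into integrals.\<close>

no_notation vec_index (infixl "$" 100)
no_notation scalar_prod (infix "\<bullet>" 70)

subsection \<open>Unitary Schur form\<close>

text \<open>The obstacle is that the scaled matrices are neither symmetric nor bounded in norm: a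
  short arm \<open>s\<close> near the boundary makes a diagonal entry arbitrarily large, so no
  operator norm estimate is at hand and every error is measured by averaged squares. The adjoint
  appears because \<open>A\<close> is moved off the Schur vector onto the packet; only rows inside
  the cube of the packet then enter the residual, and there the scheme is the standard stencil. The
  squared overlaps act as a plan that moves mass between eigenvalues and symbol values: Parseval
  fixes the mass of each packet, Bessel caps the mass at each eigenvalue at 1, and the missing mass
  is the number of base points lost near the boundary. The Frobenius norm of \<open>A - A^*\<close>
  is small on average because two regular neighbours evaluate \<open>a i\<close> at their common
  midpoint, which leaves only the first-order terms, of size \<open>1/n\<close>. Side length
  \<open>2 Q\<close> and frequency step \<open>pi / Q\<close> are matched: the plane waves are all
  characters of the cyclic group of order \<open>2 Q\<close> in each direction, and their
  frequencies are the nodes of a Riemann sum over the torus.\<close>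

definition cdot :: "nat \<Rightarrow> (nat \<Rightarrow> complex) \<Rightarrow> (nat \<Rightarrow> complex) \<Rightarrow> complex" where
  "cdot n x y = (\<Sum>j<n. cnj (x j) * y j)"

lemma cdot_self: "cdot n x x = of_real (\<Sum>j<n. (cmod (x j))\<^sup>2)"
  unfolding cdot_def by (simp add: complex_norm_square mult.commute del: of_real_power)

lemma cdot_sum_right: "cdot n x (\<lambda>j. \<Sum>l\<in>L. f l * y l j) = (\<Sum>l\<in>L. f l * cdot n x (y l))"
proof -
  have "cdot n x (\<lambda>j. \<Sum>l\<in>L. f l * y l j) = (\<Sum>j<n. \<Sum>l\<in>L. f l * (cnj (x j) * y l j))"
    unfolding cdot_def by (simp add: sum_distrib_left mult_ac)
  also have "\<dots> = (\<Sum>l\<in>L. f l * cdot n x (y l))"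
    unfolding cdot_def by (subst sum.swap) (simp add: sum_distrib_left)
  finally show ?thesis .
qed

lemma cdot_commute: "cdot n x y = cnj (cdot n y x)"
  unfolding cdot_def by (simp add: mult.commute)

lemma cdot_cong: "(\<And>j. j < n \<Longrightarrow> x j = x' j) \<Longrightarrow> (\<And>j. j < n \<Longrightarrow> y j = y' j) \<Longrightarrow> cdot n x y = cdot n x' y'"
  unfolding cdot_def by (intro sum.cong) auto

text \<open>Both coefficient arrays are lower triangular, so \<open>u\<close> and \<open>p\<close>
  span the same flag. Both directions are recorded because rewriting a triangular matrix in the new
  basis uses one array on each side.\<close>

lemma gram_schmidt_flag:
  fixes p :: "nat \<Rightarrow> nat \<Rightarrow> complex"
  assumes indep: "\<forall>c. (\<forall>j<n. (\<Sum>l<n. c l * p l j) = 0) \<longrightarrow> (\<forall>l<n. c l = 0)"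
  shows "\<exists>u c d. (\<forall>k<n. \<forall>l<n. cdot n (u k) (u l) = (if k = l then 1 else 0)) \<and>
     (\<forall>k<n. \<forall>j<n. u k j = (\<Sum>l\<le>k. c k l * p l j)) \<and>
     (\<forall>k<n. \<forall>j<n. p k j = (\<Sum>l\<le>k. d k l * u l j))"
proof -
  have "\<exists>u c d. (\<forall>k<m. \<forall>l<m. cdot n (u k) (u l) = (if k = l then 1 else 0)) \<and>
     (\<forall>k<m. \<forall>j<n. u k j = (\<Sum>l\<le>k. c k l * p l j)) \<and>
     (\<forall>k<m. \<forall>j<n. p k j = (\<Sum>l\<le>k. d k l * u l j))" if "m \<le> n" for m
    using that
  proof (induction m)
    case 0
    then show ?case by simp
  next
    case (Suc m)
    obtain u :: "nat \<Rightarrow> nat \<Rightarrow> complex" and c d :: "nat \<Rightarrow> nat \<Rightarrow> complex" where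
      orth': "\<forall>k<m. \<forall>l<m. cdot n (u k) (u l) = (if k = l then 1 else 0)"
      and uc': "\<forall>k<m. \<forall>j<n. u k j = (\<Sum>l\<le>k. c k l * p l j)"
      and pd': "\<forall>k<m. \<forall>j<n. p k j = (\<Sum>l\<le>k. d k l * u l j)"
      using Suc.IH[OF Suc_leD[OF Suc.prems]] by (elim exE conjE) (rule that; assumption)
    note orth = orth'[rule_format] and uc = uc'[rule_format] and pd = pd'[rule_format]
    define e where "e l = cdot n (u l) (p m)" for l
    define w where "w j = p m j + (\<Sum>l<m. (- e l) * u l j)" for j
    \<comment> \<open>Coefficients of \<open>w\<close> in the basis \<open>p\<close>. The leading
      one is 1, which contradicts independence if \<open>w\<close> vanishes.\<close>
    define b where "b l = (if l = m then 1 else - (\<Sum>k | k < m \<and> l \<le> k. e k * c k l))" for l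
    have w_exp: "w j = (\<Sum>l\<le>m. b l * p l j)" if "j < n" for j
    proof -
      have "(\<Sum>l<m. e l * u l j) = (\<Sum>k<m. \<Sum>l\<le>k. e k * c k l * p l j)"
        using that by (intro sum.cong) (auto simp: uc sum_distrib_left mult_ac)
      also have "\<dots> = (\<Sum>k<m. \<Sum>l | l < m \<and> l \<le> k. e k * c k l * p l j)"
        by (intro sum.cong) (auto intro!: sum.cong)
      also have "\<dots> = (\<Sum>l<m. \<Sum>k | k < m \<and> l \<le> k. e k * c k l * p l j)"
        using sum.swap_restrict[of "{..<m}" "{..<m}" "\<lambda>k l. e k * c k l * p l j" "\<lambda>k l. l \<le> k"] by simp
      also have "\<dots> = (\<Sum>l<m. - b l * p l j)"
        by (intro sum.cong) (auto simp: b_def sum_distrib_right)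
      finally show ?thesis
        unfolding w_def by (simp add: lessThan_Suc_atMost[symmetric] b_def sum_negf)
    qed
    have "\<exists>j<n. w j \<noteq> 0"
    proof (rule ccontr)
      assume "\<not> ?thesis"
      then have z: "w j = 0" if "j < n" for j using that by auto
      have "\<forall>l<n. (if l \<le> m then b l else 0) = 0"
      proof (rule mp[OF spec[OF indep, of "\<lambda>l. if l \<le> m then b l else 0"]], intro allI impI)
        fix j assume "j < n"
        have "(\<Sum>l<n. (if l \<le> m then b l else 0) * p l j) = (\<Sum>l\<le>m. b l * p l j)"
          using Suc.prems by (intro sum.mono_neutral_cong_right) auto
        then show "(\<Sum>l<n. (if l \<le> m then b l else 0) * p l j) = 0"
          using z[OF \<open>j < n\<close>] w_exp[OF \<open>j < n\<close>] by simp
      qed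
      then have "(if m \<le> m then b m else 0) = 0" using Suc.prems by (meson Suc_le_lessD)
      then show False by (simp add: b_def)
    qed
    then obtain j0 where j0: "j0 < n" "w j0 \<noteq> 0" by auto
    define s where "s = sqrt (\<Sum>j<n. (cmod (w j))\<^sup>2)"
    have "0 < (\<Sum>j<n. (cmod (w j))\<^sup>2)"
      using j0 by (intro sum_pos2[of _ j0]) auto
    then have s: "s > 0" "complex_of_real s * complex_of_real s = cdot n w w"
      by (simp_all add: s_def cdot_self flip: of_real_mult)
    have w_orth: "cdot n (u k) w = 0" if "k < m" for k
    proof -
      have "cdot n (u k) w = cdot n (u k) (p m) + cdot n (u k) (\<lambda>j. \<Sum>l<m. (- e l) * u l j)"
        unfolding cdot_def w_def by (simp add: algebra_simps sum.distrib)
      also have "cdot n (u k) (\<lambda>j. \<Sum>l<m. (- e l) * u l j) = (\<Sum>l<m. (- e l) * (if k = l then 1 else 0))"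
        unfolding cdot_sum_right using that by (intro sum.cong) (auto simp: orth)
      also have "\<dots> = - e k" using that by (subst sum.remove[of _ k]) auto
      finally show ?thesis by (simp add: e_def)
    qed
    define v where "v j = w j / of_real s" for j
    have vu: "cdot n (u k) v = 0" if "k < m" for k
      using w_orth[OF that] unfolding cdot_def v_def
      by (simp flip: sum_divide_distrib)
    have uv: "cdot n v (u k) = 0" if "k < m" for k
      by (subst cdot_commute) (simp add: vu[OF that])
    have vv: "cdot n v v = 1"
    proof -
      have "cdot n v v = cdot n w w / (of_real s * of_real s)"
        unfolding cdot_def v_def by (simp add: sum_divide_distrib)
      then show ?thesis using s by auto
    qed
    define u' where "u' = u(m := v)"
    define c' where "c' = c(m := \<lambda>l. b l / of_real s)"
    define d' where "d' = d(m := \<lambda>l. if l = m then of_real s else e l)"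
    have "\<forall>k<Suc m. \<forall>l<Suc m. cdot n (u' k) (u' l) = (if k = l then 1 else 0)"
      by (auto simp: u'_def less_Suc_eq orth uv vu vv)
    moreover have "\<forall>k<Suc m. \<forall>j<n. u' k j = (\<Sum>l\<le>k. c' k l * p l j)"
      by (auto simp: u'_def c'_def less_Suc_eq uc v_def w_exp sum_divide_distrib)
    moreover have "\<forall>k<Suc m. \<forall>j<n. p k j = (\<Sum>l\<le>k. d' k l * u' l j)"
    proof (intro allI impI)
      fix k j assume k: "k < Suc m" and j: "j < n"
      show "p k j = (\<Sum>l\<le>k. d' k l * u' l j)"
      proof (cases "k = m")
        case True
        have "(\<Sum>l\<le>m. d' m l * u' l j) = of_real s * v j + (\<Sum>l<m. e l * u l j)"
          by (simp add: lessThan_Suc_atMost[symmetric] d'_def u'_def)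
        also have "of_real s * v j = w j" using s by (simp add: v_def)
        finally show ?thesis using True by (simp add: w_def sum_negf)
      next
        case False
        then have "k < m" using k by simp
        have "(\<Sum>l\<le>k. d' k l * u' l j) = (\<Sum>l\<le>k. d k l * u l j)"
          using \<open>k < m\<close> by (intro sum.cong) (auto simp: d'_def u'_def)
        then show ?thesis using pd[OF \<open>k < m\<close> j] by simp
      qed
    qed
    ultimately show ?case by (intro exI conjI)
  qed
  then show ?thesis by simp
qed

text \<open>The change of basis in the library's Schur decomposition is merely invertible. Orthonormalising
  its columns in order keeps the flag they span, hence triangularity and the diagonal.\<close>

lemma schur_unitary:
  fixes A :: "complex mat"
  assumes A: "A \<in> carrier_mat n n" and cp: "char_poly A = (\<Prod>e\<leftarrow>es. [:- e, 1:])"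
  shows "\<exists>u T. (\<forall>k<n. \<forall>l<n. cdot n (u k) (u l) = (if k = l then 1 else 0)) \<and>
     (\<forall>i<n. \<forall>j<n. (\<Sum>k<n. A $$ (j,k) * u i k) = (\<Sum>k\<le>i. T k i * u k j)) \<and>
     (\<forall>i<n. T i i = es ! i)"
proof -
  obtain B P Q where "schur_decomposition A es = (B, P, Q)"
    by (cases "schur_decomposition A es") auto
  from schur_decomposition[OF A cp this]
  have sim: "similar_mat_wit A B P Q" and ut: "upper_triangular B" and diag: "diag_mat B = es" by auto
  from similar_mat_witD2[OF A sim]
  have QP: "Q * P = 1\<^sub>m n" and APQ: "A = P * B * Q"
    and B: "B \<in> carrier_mat n n" and P: "P \<in> carrier_mat n n" and Q: "Q \<in> carrier_mat n n" by auto
  have AP: "A * P = P * B"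
    using A B P Q QP by (simp add: APQ assoc_mult_mat[of _ n n _ n _ n])
  define p where "p l j = P $$ (j, l)" for l j
  have Ap: "(\<Sum>k<n. A $$ (j,k) * p l k) = (\<Sum>q\<le>l. B $$ (q,l) * p q j)" if "l < n" "j < n" for l j
  proof -
    have "(\<Sum>k<n. A $$ (j,k) * p l k) = (A * P) $$ (j,l)"
      using A P that by (simp add: scalar_prod_def p_def lessThan_atLeast0)
    also have "\<dots> = (\<Sum>q<n. B $$ (q,l) * p q j)"
      using B P that by (simp add: AP scalar_prod_def p_def lessThan_atLeast0 mult.commute)
    also have "\<dots> = (\<Sum>q\<le>l. B $$ (q,l) * p q j)"
      using that ut B by (intro sum.mono_neutral_right) (auto simp: upper_triangular_def)
    finally show ?thesis .
  qed
  have indep: "c l = 0" if z: "\<And>j. j < n \<Longrightarrow> (\<Sum>l<n. c l * p l j) = 0" and l: "l < n" for c l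
  proof -
    have "c l = (\<Sum>q<n. (if l = q then 1 else 0) * c q)" using l by (subst sum.remove[of _ l]) auto
    also have "\<dots> = (\<Sum>q<n. (Q * P) $$ (l,q) * c q)"
      using l by (intro sum.cong) (auto simp: QP)
    also have "\<dots> = (\<Sum>q<n. (\<Sum>j<n. Q $$ (l,j) * P $$ (j,q)) * c q)"
      using l P Q by (intro sum.cong) (auto simp: scalar_prod_def lessThan_atLeast0)
    also have "\<dots> = (\<Sum>j<n. Q $$ (l,j) * (\<Sum>q<n. c q * p q j))"
      unfolding sum_distrib_left sum_distrib_right p_def by (subst sum.swap) (simp add: mult_ac)
    also have "\<dots> = 0" using z by simp
    finally show ?thesis .
  qed
  then have "\<forall>c. (\<forall>j<n. (\<Sum>l<n. c l * p l j) = 0) \<longrightarrow> (\<forall>l<n. c l = 0)" by blast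
  from gram_schmidt_flag[OF this]
  obtain u c d where
      orth': "\<forall>k<n. \<forall>l<n. cdot n (u k) (u l) = (if k = l then 1 else 0)"
      and uc': "\<forall>k<n. \<forall>j<n. u k j = (\<Sum>l\<le>k. c k l * p l j)"
      and pd': "\<forall>k<n. \<forall>j<n. p k j = (\<Sum>l\<le>k. d k l * u l j)"
    by (elim exE conjE) (rule that; assumption)
  note orth = orth'[rule_format] and uc = uc'[rule_format] and pd = pd'[rule_format]
  \<comment> \<open>The diagonals of the two triangular arrays are inverse to each other; this is
    why \<open>T\<close> inherits the diagonal of \<open>B\<close>.\<close>
  have cd: "c i i * d i i = 1" if i: "i < n" for i
  proof -
    have up: "cdot n (u i) (p l) = (if l = i then d i i else 0)" if "l \<le> i" for l
    proof -
      have "cdot n (u i) (p l) = cdot n (u i) (\<lambda>j. \<Sum>q\<le>l. d l q * u q j)"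
        using that i by (intro cdot_cong) (auto simp: pd)
      also have "\<dots> = (\<Sum>q\<le>l. d l q * (if i = q then 1 else 0))"
        unfolding cdot_sum_right using that i by (intro sum.cong) (auto simp: orth)
      also have "\<dots> = (if l = i then d i i else 0)"
        using that by (auto simp: if_distrib sum.delta cong: if_cong)
      finally show ?thesis .
    qed
    have "1 = cdot n (u i) (\<lambda>j. \<Sum>l\<le>i. c i l * p l j)"
      using i orth[of i i] cdot_cong[of n "u i" "u i" "u i" "\<lambda>j. \<Sum>l\<le>i. c i l * p l j"] uc by simp
    also have "\<dots> = (\<Sum>l\<le>i. c i l * (if l = i then d i i else 0))"
      unfolding cdot_sum_right using i by (intro sum.cong) (auto simp: up)
    also have "\<dots> = c i i * d i i" by (simp add: if_distrib sum.delta cong: if_cong)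
    finally show ?thesis by simp
  qed
  \<comment> \<open>\<open>T\<close> is the product of the triangular arrays \<open>d\<close>,
    \<open>B\<close> and \<open>c\<close>. The index sets spell out the chain
    \<open>k \<le> q \<le> l \<le> i\<close>, so that every exchange of sums below stays
    triangular.\<close>
  define T where "T k i = (\<Sum>l | l \<le> i. \<Sum>q | q \<le> l \<and> k \<le> q. c i l * B $$ (q,l) * d q k)" for k i
  have "(\<Sum>k<n. A $$ (j,k) * u i k) = (\<Sum>k\<le>i. T k i * u k j)" if i: "i < n" and j: "j < n" for i j
  proof -
    have "(\<Sum>k<n. A $$ (j,k) * u i k) = (\<Sum>k<n. \<Sum>l\<le>i. c i l * (A $$ (j,k) * p l k))"
      using i by (intro sum.cong) (auto simp: uc sum_distrib_left mult_ac)
    also have "\<dots> = (\<Sum>l\<le>i. c i l * (\<Sum>k<n. A $$ (j,k) * p l k))"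
      by (subst sum.swap) (simp add: sum_distrib_left)
    also have "\<dots> = (\<Sum>l\<le>i. c i l * (\<Sum>q\<le>l. B $$ (q,l) * p q j))"
      using i j by (intro sum.cong) (auto simp: Ap)
    also have "\<dots> = (\<Sum>l\<le>i. \<Sum>q\<le>l. \<Sum>k\<le>q. c i l * B $$ (q,l) * d q k * u k j)"
      using i j by (intro sum.cong) (auto simp: pd sum_distrib_left mult_ac intro!: sum.cong)
    also have "\<dots> = (\<Sum>l\<le>i. \<Sum>q\<le>l. \<Sum>k | k \<le> i \<and> k \<le> q. c i l * B $$ (q,l) * d q k * u k j)"
      by (intro sum.cong[OF refl]) (auto intro: sum.cong)
    also have "\<dots> = (\<Sum>l\<le>i. \<Sum>k\<le>i. \<Sum>q | q \<le> l \<and> k \<le> q. c i l * B $$ (q,l) * d q k * u k j)"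
    proof (rule sum.cong[OF refl])
      fix l
      show "(\<Sum>q\<le>l. \<Sum>k | k \<le> i \<and> k \<le> q. c i l * B $$ (q,l) * d q k * u k j) =
        (\<Sum>k\<le>i. \<Sum>q | q \<le> l \<and> k \<le> q. c i l * B $$ (q,l) * d q k * u k j)"
        using sum.swap_restrict[of "{..l}" "{..i}" "\<lambda>q k. c i l * B $$ (q,l) * d q k * u k j" "\<lambda>q k. k \<le> q"] by simp
    qed
    also have "\<dots> = (\<Sum>k\<le>i. T k i * u k j)"
      unfolding T_def sum_distrib_right by (subst sum.swap) (simp add: atMost_def)
    finally show ?thesis .
  qed
  moreover have "T i i = es ! i" if i: "i < n" for i
  proof -
    \<comment> \<open>For \<open>k = i\<close> the chain forces \<open>q = l = i\<close>, and a
      single term survives.\<close>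
    have "T i i = (\<Sum>l | l \<le> i. if l = i then c i i * B $$ (i,i) * d i i else 0)"
      unfolding T_def
    proof (intro sum.cong refl)
      fix l assume "l \<in> {l. l \<le> i}"
      then have "{q. q \<le> l \<and> i \<le> q} = (if l = i then {i} else {})" by auto
      then show "(\<Sum>q | q \<le> l \<and> i \<le> q. c i l * B $$ (q,l) * d q i) = (if l = i then c i i * B $$ (i,i) * d i i else 0)"
        by simp
    qed
    also have "\<dots> = B $$ (i,i)" using cd[OF i] by (simp add: sum.delta mult_ac)
    also have "\<dots> = es ! i" using diag i B by (auto simp: diag_mat_def)
    finally show ?thesis .
  qed
  ultimately show ?thesis using orth' by (intro exI[of _ u] exI[of _ T] conjI) simp_all
qed

text \<open>Orthonormality says that the square matrix of the \<open>u i\<close> has a left inverse;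
  a one-sided inverse of a square matrix is two-sided.\<close>

lemma orthonormal_complete:
  assumes orth: "\<forall>k<n. \<forall>l<n. cdot n (u k) (u l) = (if k = l then 1 else 0)"
    and "j < n" "j' < n"
  shows "(\<Sum>i<n. u i j * cnj (u i j')) = (if j = j' then 1 else 0)"
proof -
  define U where "U = mat n n (\<lambda>(j, i). u i j)"
  define V where "V = mat n n (\<lambda>(i, j). cnj (u i j))"
  have "V * U = 1\<^sub>m n"
    using orth by (intro eq_matI) (auto simp: U_def V_def scalar_prod_def cdot_def lessThan_atLeast0)
  then have "U * V = 1\<^sub>m n"
    using mat_mult_left_right_inverse[of V n U] by (auto simp: U_def V_def)
  from arg_cong[OF this, of "\<lambda>M. M $$ (j, j')"] show ?thesis
    using assms by (simp add: U_def V_def scalar_prod_def lessThan_atLeast0)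
qed

lemma parseval:
  assumes orth: "\<forall>k<n. \<forall>l<n. cdot n (u k) (u l) = (if k = l then 1 else 0)"
  shows "(\<Sum>i<n. (cmod (cdot n (u i) x))\<^sup>2) = (\<Sum>j<n. (cmod (x j))\<^sup>2)"
proof -
  have "complex_of_real (\<Sum>i<n. (cmod (cdot n (u i) x))\<^sup>2) = (\<Sum>i<n. cdot n (u i) x * cnj (cdot n (u i) x))"
    by (simp add: complex_norm_square del: of_real_power)
  also have "\<dots> = (\<Sum>i<n. \<Sum>j'<n. \<Sum>j<n. x j' * cnj (x j) * (u i j * cnj (u i j')))"
    unfolding cdot_def by (simp add: sum_product mult_ac)
  also have "\<dots> = (\<Sum>j'<n. \<Sum>i<n. \<Sum>j<n. x j' * cnj (x j) * (u i j * cnj (u i j')))"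
    by (rule sum.swap)
  also have "\<dots> = (\<Sum>j'<n. \<Sum>j<n. x j' * cnj (x j) * (\<Sum>i<n. u i j * cnj (u i j')))"
    unfolding sum_distrib_left by (intro sum.cong refl sum.swap)
  also have "\<dots> = (\<Sum>j'<n. \<Sum>j<n. if j = j' then x j' * cnj (x j) else 0)"
    using orthonormal_complete[OF orth] by (intro sum.cong) auto
  also have "\<dots> = complex_of_real (\<Sum>j<n. (cmod (x j))\<^sup>2)"
    by (simp add: complex_norm_square del: of_real_power)
  finally show ?thesis by (simp only: of_real_eq_iff)
qed

lemma norm_sq_orthonormal_sum:
  assumes orth: "\<forall>k<n. \<forall>l<n. cdot n (u k) (u l) = (if k = l then 1 else 0)" and "L \<subseteq> {..<n}"
  shows "(\<Sum>j<n. (cmod (\<Sum>k\<in>L. t k * u k j))\<^sup>2) = (\<Sum>k\<in>L. (cmod (t k))\<^sup>2)"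
proof -
  have "cdot n (u i) (\<lambda>j. \<Sum>k\<in>L. t k * u k j) = (if i \<in> L then t i else 0)" if "i < n" for i
  proof -
    have "cdot n (u i) (\<lambda>j. \<Sum>k\<in>L. t k * u k j) = (\<Sum>k\<in>L. if i = k then t k else 0)"
      unfolding cdot_sum_right using assms that by (intro sum.cong) auto
    then show ?thesis using finite_subset[OF assms(2)] by simp
  qed
  then have "(\<Sum>i<n. (cmod (cdot n (u i) (\<lambda>j. \<Sum>k\<in>L. t k * u k j)))\<^sup>2) = (\<Sum>i<n. if i \<in> L then (cmod (t i))\<^sup>2 else 0)"
    by (intro sum.cong) auto
  also have "\<dots> = (\<Sum>k\<in>L. (cmod (t k))\<^sup>2)"
    using assms(2) by (simp add: sum.If_cases Int_absorb1)
  finally show ?thesis unfolding parseval[OF orth] .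
qed

text \<open>Unitary invariance of the Frobenius norm, applied to \<open>T - T\<^sup>* = U\<^sup>* (A - A\<^sup>*) U\<close>.\<close>

lemma schur_strict_part:
  assumes orth: "\<forall>k<n. \<forall>l<n. cdot n (u k) (u l) = (if k = l then 1 else 0)"
    and AuT: "\<forall>i<n. \<forall>j<n. (\<Sum>k<n. A j k * u i k) = (\<Sum>k\<le>i. T k i * u k j)"
  shows "(\<Sum>i<n. \<Sum>k<i. (cmod (T k i))\<^sup>2) \<le> (\<Sum>j<n. \<Sum>k<n. (cmod (A j k - cnj (A k j)))\<^sup>2)"
proof -
  define Au where "Au i j = (\<Sum>k<n. A j k * u i k)" for i j
  define Hu where "Hu i j = (\<Sum>k<n. (A j k - cnj (A k j)) * u i k)" for i j
  have uAu: "cdot n (u k) (Au i) = (if k \<le> i then T k i else 0)" if "k < n" "i < n" for k i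
  proof -
    have "cdot n (u k) (Au i) = cdot n (u k) (\<lambda>j. \<Sum>l\<le>i. T l i * u l j)"
      using AuT that by (intro cdot_cong) (auto simp: Au_def)
    also have "\<dots> = (\<Sum>l\<le>i. if k = l then T l i else 0)"
      unfolding cdot_sum_right using orth that by (intro sum.cong) auto
    finally show ?thesis by simp
  qed
  have uHu: "cdot n (u k) (Hu i) = cdot n (u k) (Au i) - cnj (cdot n (u i) (Au k))" for k i
  proof -
    have "cnj (cdot n (u i) (Au k)) = (\<Sum>j<n. \<Sum>l<n. cnj (u k l) * (cnj (A j l) * u i j))"
      unfolding cdot_def Au_def by (simp add: sum_distrib_left mult_ac)
    also have "\<dots> = (\<Sum>l<n. cnj (u k l) * (\<Sum>j<n. cnj (A j l) * u i j))"
      by (subst sum.swap) (simp add: sum_distrib_left)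
    finally show ?thesis
      unfolding cdot_def Au_def Hu_def
      by (simp add: left_diff_distrib right_diff_distrib sum_subtractf)
  qed
  \<comment> \<open>For \<open>k < i\<close> the conjugated term of \<open>uHu\<close> is zero,
    since \<open>T\<close> has nothing below the diagonal.\<close>
  have "(\<Sum>i<n. \<Sum>k<i. (cmod (T k i))\<^sup>2) = (\<Sum>i<n. \<Sum>k<i. (cmod (cdot n (u k) (Hu i)))\<^sup>2)"
    by (intro sum.cong) (auto simp: uHu uAu)
  also have "\<dots> \<le> (\<Sum>i<n. \<Sum>k<n. (cmod (cdot n (u k) (Hu i)))\<^sup>2)"
    by (intro sum_mono sum_mono2) auto
  also have "\<dots> = (\<Sum>i<n. \<Sum>j<n. (cmod (Hu i j))\<^sup>2)"
    by (simp add: parseval[OF orth])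
  \<comment> \<open>Parseval a second time, now in the Schur index \<open>i\<close>, applied to the
    conjugated \<open>j\<close>-th row of \<open>A - A^*\<close>.\<close>
  also have "\<dots> = (\<Sum>j<n. \<Sum>i<n. (cmod (cdot n (u i) (\<lambda>k. cnj (A j k - cnj (A k j)))))\<^sup>2)"
  proof (subst sum.swap, intro sum.cong refl)
    fix i j
    have "Hu i j = cnj (cdot n (u i) (\<lambda>k. cnj (A j k - cnj (A k j))))"
      unfolding Hu_def cdot_def by (simp add: mult_ac)
    then show "(cmod (Hu i j))\<^sup>2 = (cmod (cdot n (u i) (\<lambda>k. cnj (A j k - cnj (A k j)))))\<^sup>2"
      by simp
  qed
  also have "\<dots> = (\<Sum>j<n. \<Sum>k<n. (cmod (A j k - cnj (A k j)))\<^sup>2)"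
    unfolding parseval[OF orth] complex_mod_cnj ..
  finally show ?thesis .
qed

text \<open>The weights are squared overlaps of \<open>g \<alpha>\<close> with Schur vectors.
  Pairing \<open>g \<alpha>\<close> with \<open>A u_i\<close>, the eigenvalue times
  \<open>u_i\<close> plus a strictly triangular remainder, shows that the difference of eigenvalue
  and \<open>\<kappa> \<alpha>\<close> times the overlap is a residual part minus a remainder part.
  The residual part is summed over \<open>i\<close> by Parseval, the remainder part over
  \<open>\<alpha>\<close> by \<open>bessel\<close>, so the vectors \<open>g \<alpha>\<close> need
  not be orthogonal.\<close>

lemma eigenvalue_weights:
  fixes A :: "complex mat" and g :: "'a \<Rightarrow> nat \<Rightarrow> complex" and \<kappa> :: "'a \<Rightarrow> complex"
  assumes A: "A \<in> carrier_mat n n" and cp: "char_poly A = (\<Prod>e\<leftarrow>es. [:- e, 1:])"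
    and bessel: "\<And>w. (\<Sum>\<alpha>\<in>S. (cmod (cdot n (g \<alpha>) w))\<^sup>2) \<le> (\<Sum>j<n. (cmod (w j))\<^sup>2)"
  shows "\<exists>p :: 'a \<Rightarrow> nat \<Rightarrow> real. (\<forall>\<alpha> i. 0 \<le> p \<alpha> i) \<and> (\<forall>i<n. (\<Sum>\<alpha>\<in>S. p \<alpha> i) \<le> 1) \<and>
     (\<forall>\<alpha>. (\<Sum>i<n. p \<alpha> i) = (\<Sum>j<n. (cmod (g \<alpha> j))\<^sup>2)) \<and>
     (\<Sum>\<alpha>\<in>S. \<Sum>i<n. p \<alpha> i * (cmod (es ! i - \<kappa> \<alpha>))\<^sup>2) \<le>
       2 * (\<Sum>\<alpha>\<in>S. \<Sum>k<n. (cmod ((\<Sum>j<n. cnj (g \<alpha> j) * A $$ (j,k)) - \<kappa> \<alpha> * cnj (g \<alpha> k)))\<^sup>2) +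
       2 * (\<Sum>j<n. \<Sum>k<n. (cmod (A $$ (j,k) - cnj (A $$ (k,j))))\<^sup>2)"
proof -
  from schur_unitary[OF A cp] obtain u T where
    orth: "\<forall>k<n. \<forall>l<n. cdot n (u k) (u l) = (if k = l then 1 else 0)"
    and AuT: "\<forall>i<n. \<forall>j<n. (\<Sum>k<n. A $$ (j,k) * u i k) = (\<Sum>k\<le>i. T k i * u k j)"
    and diag: "\<forall>i<n. T i i = es ! i"
    by (elim exE conjE) (rule that; assumption)
  define p where "p \<alpha> i = (cmod (cdot n (g \<alpha>) (u i)))\<^sup>2" for \<alpha> i
  define r where "r \<alpha> k = (\<Sum>j<n. cnj (g \<alpha> j) * A $$ (j,k)) - \<kappa> \<alpha> * cnj (g \<alpha> k)" for \<alpha> k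
  define v where "v i j = (\<Sum>k<i. T k i * u k j)" for i j
  have "cmod (cdot n (g \<alpha>) (u i)) = cmod (cdot n (u i) (g \<alpha>))" for \<alpha> i
    by (subst cdot_commute) simp
  then have sum_p: "(\<Sum>i<n. p \<alpha> i) = (\<Sum>j<n. (cmod (g \<alpha> j))\<^sup>2)" for \<alpha>
    by (simp add: p_def parseval[OF orth])
  have p_le: "(\<Sum>\<alpha>\<in>S. p \<alpha> i) \<le> 1" if "i < n" for i
  proof -
    have "complex_of_real (\<Sum>j<n. (cmod (u i j))\<^sup>2) = 1"
      using orth that cdot_self[of n "u i", symmetric] by (simp del: of_real_sum of_real_power)
    then have "(\<Sum>j<n. (cmod (u i j))\<^sup>2) = 1" by (simp only: of_real_eq_1_iff)
    then show ?thesis using bessel[of "u i"] by (simp add: p_def)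
  qed
  have key: "(es ! i - \<kappa> \<alpha>) * cdot n (g \<alpha>) (u i) = cdot n (\<lambda>k. cnj (r \<alpha> k)) (u i) - cdot n (g \<alpha>) (v i)"
    if i: "i < n" for i \<alpha>
  proof -
    have "cdot n (\<lambda>k. cnj (r \<alpha> k)) (u i) =
      (\<Sum>k<n. \<Sum>j<n. cnj (g \<alpha> j) * (A $$ (j,k) * u i k)) - \<kappa> \<alpha> * cdot n (g \<alpha>) (u i)"
      unfolding cdot_def r_def
      by (simp add: algebra_simps sum_subtractf sum_distrib_left)
    also have "(\<Sum>k<n. \<Sum>j<n. cnj (g \<alpha> j) * (A $$ (j,k) * u i k)) = cdot n (g \<alpha>) (\<lambda>j. \<Sum>k<n. A $$ (j,k) * u i k)"
      unfolding cdot_def by (subst sum.swap) (simp add: sum_distrib_left)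
    also have "\<dots> = cdot n (g \<alpha>) (\<lambda>j. v i j + es ! i * u i j)"
      using i AuT diag by (intro cdot_cong) (auto simp: v_def lessThan_Suc_atMost[symmetric])
    also have "\<dots> = cdot n (g \<alpha>) (v i) + es ! i * cdot n (g \<alpha>) (u i)"
      unfolding cdot_def by (simp add: algebra_simps sum.distrib sum_distrib_left)
    finally show ?thesis by (simp add: algebra_simps)
  qed
  have sq: "(cmod (x - y))\<^sup>2 \<le> 2 * (cmod x)\<^sup>2 + 2 * (cmod y)\<^sup>2" for x y
  proof -
    have "(cmod (x - y))\<^sup>2 \<le> (cmod x + cmod y)\<^sup>2"
      by (intro power_mono norm_triangle_ineq4) auto
    also have "\<dots> \<le> 2 * (cmod x)\<^sup>2 + 2 * (cmod y)\<^sup>2"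
      using sum_squares_bound[of "cmod x" "cmod y"] by (simp add: power2_sum)
    finally show ?thesis .
  qed
  have "(\<Sum>\<alpha>\<in>S. \<Sum>i<n. p \<alpha> i * (cmod (es ! i - \<kappa> \<alpha>))\<^sup>2) =
    (\<Sum>\<alpha>\<in>S. \<Sum>i<n. (cmod ((es ! i - \<kappa> \<alpha>) * cdot n (g \<alpha>) (u i)))\<^sup>2)"
    by (simp add: p_def norm_mult power_mult_distrib mult.commute)
  also have "\<dots> \<le> (\<Sum>\<alpha>\<in>S. \<Sum>i<n. 2 * (cmod (cdot n (\<lambda>k. cnj (r \<alpha> k)) (u i)))\<^sup>2 + 2 * (cmod (cdot n (g \<alpha>) (v i)))\<^sup>2)"
    by (intro sum_mono) (simp add: key sq)
  also have "\<dots> = 2 * (\<Sum>\<alpha>\<in>S. \<Sum>i<n. (cmod (cdot n (\<lambda>k. cnj (r \<alpha> k)) (u i)))\<^sup>2)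
      + 2 * (\<Sum>\<alpha>\<in>S. \<Sum>i<n. (cmod (cdot n (g \<alpha>) (v i)))\<^sup>2)"
    by (simp add: sum.distrib sum_distrib_left)
  also have "(\<Sum>\<alpha>\<in>S. \<Sum>i<n. (cmod (cdot n (\<lambda>k. cnj (r \<alpha> k)) (u i)))\<^sup>2) = (\<Sum>\<alpha>\<in>S. \<Sum>k<n. (cmod (r \<alpha> k))\<^sup>2)"
  proof (rule sum.cong[OF refl])
    fix \<alpha>
    have "cmod (cdot n (\<lambda>k. cnj (r \<alpha> k)) (u i)) = cmod (cdot n (u i) (\<lambda>k. cnj (r \<alpha> k)))" for i
      by (subst cdot_commute) simp
    then show "(\<Sum>i<n. (cmod (cdot n (\<lambda>k. cnj (r \<alpha> k)) (u i)))\<^sup>2) = (\<Sum>k<n. (cmod (r \<alpha> k))\<^sup>2)"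
      by (simp add: parseval[OF orth])
  qed
  also have "(\<Sum>\<alpha>\<in>S. \<Sum>i<n. (cmod (cdot n (g \<alpha>) (v i)))\<^sup>2) \<le> (\<Sum>i<n. \<Sum>k<i. (cmod (T k i))\<^sup>2)"
  proof (subst sum.swap, intro sum_mono)
    fix i assume "i \<in> {..<n}"
    have "(\<Sum>\<alpha>\<in>S. (cmod (cdot n (g \<alpha>) (v i)))\<^sup>2) \<le> (\<Sum>j<n. (cmod (v i j))\<^sup>2)"
      by (rule bessel)
    also have "\<dots> = (\<Sum>k<i. (cmod (T k i))\<^sup>2)"
      unfolding v_def using \<open>i \<in> {..<n}\<close> by (intro norm_sq_orthonormal_sum[OF orth]) auto
    finally show "(\<Sum>\<alpha>\<in>S. (cmod (cdot n (g \<alpha>) (v i)))\<^sup>2) \<le> (\<Sum>k<i. (cmod (T k i))\<^sup>2)" .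
  qed
  also have "\<dots> \<le> (\<Sum>j<n. \<Sum>k<n. (cmod (A $$ (j,k) - cnj (A $$ (k,j))))\<^sup>2)"
    using schur_strict_part[OF orth AuT] .
  finally have "(\<Sum>\<alpha>\<in>S. \<Sum>i<n. p \<alpha> i * (cmod (es ! i - \<kappa> \<alpha>))\<^sup>2) \<le> 2 * (\<Sum>\<alpha>\<in>S. \<Sum>k<n. (cmod (r \<alpha> k))\<^sup>2) +
       2 * (\<Sum>j<n. \<Sum>k<n. (cmod (A $$ (j,k) - cnj (A $$ (k,j))))\<^sup>2)"
    by simp
  then show ?thesis
    unfolding r_def using sum_p p_le by (intro exI[of _ p]) (auto simp: p_def)
qed

subsection \<open>Lattice sums\<close>

text \<open>Integer points are kept as real vectors, like the matrix indices, so that shifts and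
  inner products need no coercion. The range may depend on the coordinate; this describes the layers
  at opposite faces of a cube.\<close>

definition lattice_box :: "('d \<Rightarrow> int set) \<Rightarrow> (real ^ 'd) set" where
  "lattice_box Z = {v. \<forall>i. v $ i \<in> of_int ` Z i}"

lemma lattice_box_eq:
  fixes Z :: "'d::finite \<Rightarrow> int set"
  shows "lattice_box Z = (\<lambda>z. \<chi> i. of_int (z i)) ` (PiE UNIV Z)"
proof (intro Set.set_eqI iffI)
  fix v :: "real ^ 'd" assume "v \<in> lattice_box Z"
  then have "\<forall>i. \<exists>z. z \<in> Z i \<and> v $ i = of_int z" by (auto simp: lattice_box_def)
  then obtain z where "\<And>i. z i \<in> Z i" "\<And>i. v $ i = of_int (z i)" by metis
  then show "v \<in> (\<lambda>z. \<chi> i. of_int (z i)) ` (PiE UNIV Z)"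
    by (intro image_eqI[of _ _ z]) (auto simp: Finite_Cartesian_Product.vec_eq_iff)
qed (auto simp: lattice_box_def PiE_iff)

lemma inj_of_int_vec: "inj_on (\<lambda>z. (\<chi> i. of_int (z i)) :: real ^ 'd) A"
  by (rule inj_onI) (auto simp: Finite_Cartesian_Product.vec_eq_iff fun_eq_iff)

lemma finite_lattice_box: "(\<And>i. finite (Z i)) \<Longrightarrow> finite (lattice_box Z)"
  unfolding lattice_box_eq by (intro finite_imageI finite_PiE) auto

lemma card_lattice_box: "card (lattice_box Z) = (\<Prod>i\<in>UNIV. card (Z i))"
  unfolding lattice_box_eq by (simp add: card_image[OF inj_of_int_vec] card_PiE)

lemma sum_prod_lattice_box:
  fixes f :: "'d::finite \<Rightarrow> real \<Rightarrow> 'a::comm_semiring_1"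
  assumes "\<And>i. finite (Z i)"
  shows "(\<Sum>v\<in>lattice_box Z. \<Prod>i\<in>UNIV. f i (v $ i)) = (\<Prod>i\<in>UNIV. \<Sum>z\<in>Z i. f i (of_int z))"
  unfolding lattice_box_eq using assms
  by (simp add: sum.reindex[OF inj_of_int_vec] o_def prod_sum_PiE)

text \<open>Orthogonality of characters of the cyclic group of order \<open>2 * Q\<close>. The bound
  on \<open>z\<close> is the one satisfied by differences of points of the cube; it keeps the root
  of unity \<open>\<omega>\<close> away from 1, so the geometric sum vanishes.\<close>

lemma sum_cis_interval:
  fixes Q :: nat and z :: int
  assumes Q: "Q > 0" and z: "\<bar>z\<bar> < 2 * int Q"
  shows "(\<Sum>k\<in>{- int Q..<int Q}. cis (pi / Q * of_int k * of_int z)) = (if z = 0 then of_nat (2 * Q) else 0)"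
proof (cases "z = 0")
  case False
  define \<omega> where "\<omega> = cis (pi / Q * of_int z)"
  have ne: "\<omega> \<noteq> 1"
  proof
    assume "\<omega> = 1"
    then obtain m where "pi / Q * of_int z = of_int m * (2 * pi)"
      by (auto simp: \<omega>_def cis_eq_1_iff)
    then have "real_of_int z = of_int (m * (2 * int Q))"
      using Q by (simp add: field_simps)
    then have "z = m * (2 * int Q)" by (simp only: of_int_eq_iff)
    then show False using z False by (auto simp: abs_mult)
  qed
  \<comment> \<open>Shifting the frequencies to start at 0 only costs a constant phase and leaves a
    geometric sum.\<close>
  have "{- int Q..<int Q} = (\<lambda>l. int l - int Q) ` {..<2 * Q}"
  proof (intro Set.set_eqI iffI)
    fix k assume "k \<in> {- int Q..<int Q}"
    then show "k \<in> (\<lambda>l. int l - int Q) ` {..<2 * Q}"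
      by (intro image_eqI[of _ _ "nat (k + int Q)"]) auto
  qed auto
  then have "(\<Sum>k\<in>{- int Q..<int Q}. cis (pi / Q * of_int k * of_int z)) =
     (\<Sum>l<2*Q. cis (pi / Q * of_int (int l - int Q) * of_int z))"
    by (simp add: sum.reindex inj_on_def)
  also have "\<dots> = (\<Sum>l<2*Q. cis (- pi * of_int z) * \<omega> ^ l)"
  proof (rule sum.cong[OF refl])
    fix l
    have "pi / Q * of_int (int l - int Q) * of_int z = - pi * of_int z + real l * (pi / Q * of_int z)"
      using Q by (simp add: field_simps)
    then show "cis (pi / Q * of_int (int l - int Q) * of_int z) = cis (- pi * of_int z) * \<omega> ^ l"
      unfolding \<omega>_def Complex.DeMoivre cis_mult by (rule arg_cong)
  qed
  also have "\<dots> = cis (- pi * of_int z) * ((\<omega> ^ (2 * Q) - 1) / (\<omega> - 1))"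
    using ne by (simp flip: sum_distrib_left add: geometric_sum)
  also have "\<omega> ^ (2 * Q) = cis (of_int z * (2 * pi))"
    unfolding \<omega>_def Complex.DeMoivre using Q by (intro arg_cong[where f = cis]) (simp add: field_simps)
  also have "\<dots> = 1" using cis_eq_1_iff by blast
  finally show ?thesis using False by simp
qed simp

lemma cis_inner_prod: "cis (c * (k \<bullet> t)) = (\<Prod>i\<in>UNIV. cis (c * k $ i * t $ i))" for k t :: "real ^ 'd"
  unfolding cis_conv_exp inner_vec_def
  by (simp add: sum_distrib_left exp_sum flip: exp_sum mult.assoc)

lemma sum_cis_lattice_box:
  fixes t t' :: "real ^ 'd"
  assumes Q: "Q > 0" and t: "t \<in> lattice_box (\<lambda>_. {0..<2 * int Q})" "t' \<in> lattice_box (\<lambda>_. {0..<2 * int Q})"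
  shows "(\<Sum>k\<in>lattice_box (\<lambda>_. {- int Q..<int Q}). cis (pi / Q * (k \<bullet> (t - t')))) =
    (if t = t' then of_nat ((2 * Q) ^ CARD('d)) else 0)"
proof -
  have "\<forall>i. \<exists>z. t $ i - t' $ i = real_of_int z \<and> \<bar>z\<bar> < 2 * int Q"
  proof
    fix i
    obtain x y where "t $ i = of_int x" "t' $ i = of_int y" "x \<in> {0..<2 * int Q}" "y \<in> {0..<2 * int Q}"
      using t unfolding lattice_box_def by blast
    then show "\<exists>z. t $ i - t' $ i = real_of_int z \<and> \<bar>z\<bar> < 2 * int Q"
      by (intro exI[of _ "x - y"]) auto
  qed
  then obtain z where z: "\<And>i. t $ i - t' $ i = real_of_int (z i)" "\<And>i. \<bar>z i\<bar> < 2 * int Q" by metis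
  have "(\<Sum>k\<in>lattice_box (\<lambda>_. {- int Q..<int Q}). cis (pi / Q * (k \<bullet> (t - t')))) =
    (\<Prod>i\<in>UNIV. \<Sum>k\<in>{- int Q..<int Q}. cis (pi / Q * of_int k * of_int (z i)))"
    unfolding cis_inner_prod by (subst sum_prod_lattice_box) (simp_all add: z)
  also have "\<dots> = (\<Prod>i\<in>UNIV. if z i = 0 then of_nat (2 * Q) else 0)"
    by (intro prod.cong refl sum_cis_interval Q z)
  also have "\<dots> = (if t = t' then of_nat ((2 * Q) ^ CARD('d)) else 0)"
  proof (cases "t = t'")
    case True
    then have "z i = 0" for i using z(1)[of i] by simp
    then show ?thesis using True by simp
  next
    case False
    then obtain i where "t $ i \<noteq> t' $ i" by (auto simp: Finite_Cartesian_Product.vec_eq_iff)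
    then have "z i \<noteq> 0" using z(1)[of i] by auto
    then show ?thesis using False by (auto intro!: prod_zero)
  qed
  finally show ?thesis .
qed

text \<open>There are as many frequencies as points, and after division by the square root of that
  number the character matrix is unitary.\<close>

lemma parseval_lattice_box:
  fixes w :: "real ^ 'd \<Rightarrow> complex"
  assumes Q: "Q > 0"
  defines "B \<equiv> lattice_box (\<lambda>_::'d. {0..<2 * int Q})"
  shows "(\<Sum>k\<in>lattice_box (\<lambda>_. {- int Q..<int Q}). (cmod (\<Sum>t\<in>B. cis (- (pi / Q * (k \<bullet> t))) * w t))\<^sup>2) =
     real ((2 * Q) ^ CARD('d)) * (\<Sum>t\<in>B. (cmod (w t))\<^sup>2)"
proof -
  let ?K = "lattice_box (\<lambda>_::'d. {- int Q..<int Q})"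
  define c where "c = pi / real Q"
  note orth = sum_cis_lattice_box[OF Q, folded c_def]
  have fin: "finite B" unfolding B_def by (intro finite_lattice_box) simp
  have "complex_of_real (\<Sum>k\<in>?K. (cmod (\<Sum>t\<in>B. cis (- (pi / Q * (k \<bullet> t))) * w t))\<^sup>2) =
    (\<Sum>k\<in>?K. (\<Sum>t\<in>B. cis (- (pi / Q * (k \<bullet> t))) * w t) * cnj (\<Sum>t\<in>B. cis (- (pi / Q * (k \<bullet> t))) * w t))"
    by (simp add: complex_norm_square del: of_real_power cnj_sum)
  also have "\<dots> = (\<Sum>k\<in>?K. \<Sum>t\<in>B. \<Sum>t'\<in>B. w t * cnj (w t') * cis (pi / Q * (k \<bullet> (t' - t))))"
    unfolding c_def[symmetric]
  proof (rule sum.cong[OF refl])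
    fix k
    have "cis (- (c * (k \<bullet> t))) * w t * cnj (cis (- (c * (k \<bullet> t'))) * w t') =
      w t * cnj (w t') * cis (c * (k \<bullet> (t' - t)))" for t t'
    proof -
      have "cis (c * (k \<bullet> (t' - t))) = cis (- (c * (k \<bullet> t))) * cis (c * (k \<bullet> t'))"
        unfolding cis_mult inner_diff_right by (simp add: algebra_simps)
      then show ?thesis by (simp add: cis_cnj mult_ac)
    qed
    then show "(\<Sum>t\<in>B. cis (- (c * (k \<bullet> t))) * w t) * cnj (\<Sum>t\<in>B. cis (- (c * (k \<bullet> t))) * w t) =
      (\<Sum>t\<in>B. \<Sum>t'\<in>B. w t * cnj (w t') * cis (c * (k \<bullet> (t' - t))))"
      unfolding cnj_sum sum_product by (intro sum.cong refl)
  qed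
  also have "\<dots> = (\<Sum>t\<in>B. \<Sum>k\<in>?K. \<Sum>t'\<in>B. w t * cnj (w t') * cis (pi / Q * (k \<bullet> (t' - t))))"
    by (rule sum.swap)
  also have "\<dots> = (\<Sum>t\<in>B. \<Sum>t'\<in>B. w t * cnj (w t') * (\<Sum>k\<in>?K. cis (pi / Q * (k \<bullet> (t' - t)))))"
    unfolding sum_distrib_left by (intro sum.cong refl sum.swap)
  also have "\<dots> = (\<Sum>t\<in>B. \<Sum>t'\<in>B. if t' = t then w t * cnj (w t') * of_nat ((2 * Q) ^ CARD('d)) else 0)"
    unfolding c_def[symmetric] by (intro sum.cong refl) (simp add: orth B_def del: of_nat_power)
  also have "\<dots> = (\<Sum>t\<in>B. of_nat ((2 * Q) ^ CARD('d)) * complex_of_real ((cmod (w t))\<^sup>2))"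
    using fin by (simp add: complex_norm_square mult_ac del: of_real_power)
  also have "\<dots> = complex_of_real (real ((2 * Q) ^ CARD('d)) * (\<Sum>t\<in>B. (cmod (w t))\<^sup>2))"
    by (simp add: sum_distrib_left)
  finally show ?thesis by (simp only: of_real_eq_iff)
qed

section \<open>Riemann sums on anisotropic grids\<close>

definition grid_point :: "('d \<Rightarrow> real) \<Rightarrow> real ^ 'd \<Rightarrow> real ^ 'd" where
  "grid_point h j = (\<chi> i. j $ i * h i)"

text \<open>Rounds down to the grid. Composition with it turns a lattice sum into the integral of a
  step function, which makes dominated convergence available.\<close>

definition grid_floor :: "('d \<Rightarrow> real) \<Rightarrow> real ^ 'd \<Rightarrow> real ^ 'd" where
  "grid_floor h x = grid_point h (\<chi> i. of_int \<lfloor>x $ i / h i\<rfloor>)"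

lemma grid_floor_close:
  assumes "h i > 0"
  shows "\<bar>grid_floor h x $ i - x $ i\<bar> \<le> h i"
proof -
  have "of_int \<lfloor>x $ i / h i\<rfloor> * h i \<le> x $ i" "x $ i \<le> (of_int \<lfloor>x $ i / h i\<rfloor> + 1) * h i"
    using assms by (simp_all flip: pos_le_divide_eq add: pos_divide_le_eq[symmetric])
  then show ?thesis by (simp add: grid_floor_def grid_point_def algebra_simps)
qed

text \<open>Half-open, so that each point lies in exactly one cell and no overlaps have to be
  discarded.\<close>

definition grid_cell :: "('d \<Rightarrow> real) \<Rightarrow> real ^ 'd \<Rightarrow> (real ^ 'd) set" where
  "grid_cell h j = {x. \<forall>i. j $ i * h i \<le> x $ i \<and> x $ i < (j $ i + 1) * h i}"

lemma grid_cell_iff: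
  assumes h: "\<And>i. h i > 0" and j: "\<And>i. j $ i \<in> \<int>"
  shows "x \<in> grid_cell h j \<longleftrightarrow> (\<chi> i. of_int \<lfloor>x $ i / h i\<rfloor>) = j"
proof -
  have "j $ i * h i \<le> x $ i \<and> x $ i < (j $ i + 1) * h i \<longleftrightarrow> of_int \<lfloor>x $ i / h i\<rfloor> = j $ i" for i
  proof -
    obtain z where z: "j $ i = of_int z" using j[of i] by (auto elim: Ints_cases)
    have "j $ i * h i \<le> x $ i \<and> x $ i < (j $ i + 1) * h i \<longleftrightarrow> of_int z \<le> x $ i / h i \<and> x $ i / h i < of_int z + 1"
      using h[of i] by (simp add: z pos_le_divide_eq pos_divide_less_eq)
    also have "\<dots> \<longleftrightarrow> \<lfloor>x $ i / h i\<rfloor> = z" by (simp add: floor_eq_iff)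
    finally show ?thesis by (simp add: z)
  qed
  then show ?thesis by (auto simp: grid_cell_def Finite_Cartesian_Product.vec_eq_iff)
qed

lemma grid_cell_measurable [measurable]: "grid_cell h j \<in> sets borel"
  unfolding grid_cell_def by measurable

text \<open>The half-open cell is squeezed between an open and a closed box of equal volume.\<close>

lemma emeasure_grid_cell:
  assumes h: "\<And>i. h i > 0"
  shows "emeasure lborel (grid_cell h j) = ennreal (\<Prod>i\<in>UNIV. h i)"
proof -
  let ?a = "\<chi> i. j $ i * h i" and ?b = "\<chi> i. (j $ i + 1) * h i"
  have le: "?a $ i < ?b $ i" for i using h[of i] by (simp add: algebra_simps)
  then have ne: "cbox ?a ?b \<noteq> {}" by (simp add: interval_ne_empty_cart less_imp_le)
  have "measure lborel (cbox ?a ?b) = (\<Prod>i\<in>UNIV. h i)"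
    unfolding content_cbox_cart[OF ne] by (simp add: algebra_simps)
  then have cbox: "emeasure lborel (cbox ?a ?b) = ennreal (\<Prod>i\<in>UNIV. h i)"
    using emeasure_lborel_cbox_finite[of ?a ?b] by (simp add: emeasure_eq_ennreal_measure)
  have box: "emeasure lborel (box ?a ?b) = emeasure lborel (cbox ?a ?b)"
    unfolding emeasure_lborel_cbox_eq emeasure_lborel_box_eq by simp
  have "emeasure lborel (box ?a ?b) \<le> emeasure lborel (grid_cell h j)"
    by (intro emeasure_mono) (auto simp: grid_cell_def mem_box_cart less_imp_le)
  moreover have "emeasure lborel (grid_cell h j) \<le> emeasure lborel (cbox ?a ?b)"
    by (intro emeasure_mono) (auto simp: grid_cell_def mem_box_cart less_imp_le)
  ultimately show ?thesis using box cbox by simp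
qed

lemma integral_grid_floor:
  fixes f :: "real ^ 'd \<Rightarrow> complex"
  assumes h: "\<And>i. h i > 0" and J: "finite J" "\<And>j. j \<in> J \<Longrightarrow> \<forall>i. j $ i \<in> \<int>"
    and supp: "\<And>j. (\<forall>i. j $ i \<in> \<int>) \<Longrightarrow> f (grid_point h j) \<noteq> 0 \<Longrightarrow> j \<in> J"
  shows "(\<lambda>x. f (grid_floor h x)) \<in> borel_measurable borel"
    and "(\<integral>x. f (grid_floor h x) \<partial>lborel) = of_real (\<Prod>i\<in>UNIV. h i) * (\<Sum>j\<in>J. f (grid_point h j))"
proof -
  \<comment> \<open>The step function is a finite combination of cell indicators; grid points
    outside \<open>J\<close> carry the value 0 by \<open>supp\<close>.\<close>
  have eq: "f (grid_floor h x) = (\<Sum>j\<in>J. indicator (grid_cell h j) x *\<^sub>R f (grid_point h j))" for x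
  proof -
    let ?j = "\<chi> i. of_int \<lfloor>x $ i / h i\<rfloor>"
    have "(\<Sum>j\<in>J. indicator (grid_cell h j) x *\<^sub>R f (grid_point h j)) = (\<Sum>j\<in>J. if ?j = j then f (grid_point h j) else 0)"
    proof (intro sum.cong refl)
      fix j assume "j \<in> J"
      then show "indicator (grid_cell h j) x *\<^sub>R f (grid_point h j) = (if ?j = j then f (grid_point h j) else 0)"
        using grid_cell_iff[of h j x, OF h] J(2) by (auto simp: indicator_def)
    qed
    also have "\<dots> = f (grid_point h ?j)"
      using J(1) supp[of ?j] by auto
    finally show ?thesis by (simp add: grid_floor_def)
  qed
  show "(\<lambda>x. f (grid_floor h x)) \<in> borel_measurable borel"
    unfolding eq by measurable
  have int: "integrable lborel (\<lambda>x. indicator (grid_cell h j) x *\<^sub>R f (grid_point h j))" for j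
    using emeasure_grid_cell[of h j, OF h]
    by (intro integrable_scaleR_left integrable_real_indicator) auto
  have vol: "measure lborel (grid_cell h j) = (\<Prod>i\<in>UNIV. h i)" for j
    using emeasure_grid_cell[of h j, OF h] h by (simp add: measure_def prod_nonneg less_imp_le)
  have intv: "(\<integral>x. indicator (grid_cell h j) x *\<^sub>R f (grid_point h j) \<partial>lborel) =
      measure lborel (grid_cell h j) *\<^sub>R f (grid_point h j)" for j
    using emeasure_grid_cell[of h j, OF h]
    by (subst integral_scaleR_left) (auto intro!: integrable_real_indicator)
  have "(\<integral>x. f (grid_floor h x) \<partial>lborel) = (\<Sum>j\<in>J. measure lborel (grid_cell h j) *\<^sub>R f (grid_point h j))"
    unfolding eq by (subst Bochner_Integration.integral_sum) (simp_all add: int intv)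
  then show "(\<integral>x. f (grid_floor h x) \<partial>lborel) = of_real (\<Prod>i\<in>UNIV. h i) * (\<Sum>j\<in>J. f (grid_point h j))"
    by (simp add: vol sum_distrib_left scaleR_conv_of_real)
qed

lemma grid_floor_tendsto:
  assumes "\<And>k i. h k i > 0" and "\<And>i. (\<lambda>k. h k i) \<longlonglongrightarrow> 0"
  shows "(\<lambda>k. grid_floor (h k) x) \<longlonglongrightarrow> x"
proof (rule vec_tendstoI)
  fix i
  have "(\<lambda>k. grid_floor (h k) x $ i - x $ i) \<longlonglongrightarrow> 0"
    by (rule Lim_null_comparison[OF _ assms(2)[of i]]) (use grid_floor_close[of "h _" i x] assms(1) in auto)
  then show "(\<lambda>k. grid_floor (h k) x $ i) \<longlonglongrightarrow> x $ i"
    by (simp add: LIM_zero_iff)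
qed

text \<open>Dominated convergence for the step functions. The integrand may vary with
  \<open>k\<close>, which later covers indicators of shrinking sets, and convergence almost
  everywhere suffices, so a null boundary does no harm.\<close>

lemma riemann_sum_tendsto:
  fixes f :: "real ^ 'd \<Rightarrow> complex"
  assumes h: "\<And>k i. h k i > 0" "\<And>i. (\<lambda>k. h k i) \<longlonglongrightarrow> 0" "\<And>k i. h k i \<le> H"
    and J: "\<And>k. finite (J k)" "\<And>k j. j \<in> J k \<Longrightarrow> \<forall>i. j $ i \<in> \<int>"
    and supp: "\<And>k j. (\<forall>i. j $ i \<in> \<int>) \<Longrightarrow> F k (grid_point (h k) j) \<noteq> 0 \<Longrightarrow> j \<in> J k"
    and bound: "\<And>k x. cmod (F k x) \<le> M" "\<And>k x. F k x \<noteq> 0 \<Longrightarrow> \<forall>i. \<bar>x $ i\<bar> \<le> R"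
    and f: "f \<in> borel_measurable borel"
    and lim: "AE x in lborel. (\<lambda>k. F k (grid_floor (h k) x)) \<longlonglongrightarrow> f x"
  shows "(\<lambda>k. of_real (\<Prod>i\<in>UNIV. h k i) * (\<Sum>j\<in>J k. F k (grid_point (h k) j))) \<longlonglongrightarrow> (\<integral>x. f x \<partial>lborel)"
proof -
  \<comment> \<open>Rounding moves a point by at most \<open>H\<close> per coordinate, hence the
    support bound \<open>R\<close> is enlarged by \<open>H\<close>.\<close>
  let ?C = "cbox (\<chi> i. - (R + H)) (\<chi> i. R + H) :: (real ^ 'd) set"
  have "(\<lambda>k. \<integral>x. F k (grid_floor (h k) x) \<partial>lborel) \<longlonglongrightarrow> (\<integral>x. f x \<partial>lborel)"
  proof (rule integral_dominated_convergence[where w = "\<lambda>x. M * indicator ?C x"])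
    show "f \<in> borel_measurable lborel" using f by simp
    show "(\<lambda>x. F k (grid_floor (h k) x)) \<in> borel_measurable lborel" for k
      using integral_grid_floor(1)[of "h k" "J k" "F k"] h J supp by auto
    show "integrable lborel (\<lambda>x. M * indicator ?C x)"
      by (intro integrable_mult_right integrable_real_indicator) (auto simp: emeasure_lborel_cbox_eq)
    show "AE x in lborel. (\<lambda>k. F k (grid_floor (h k) x)) \<longlonglongrightarrow> f x" by (rule lim)
    show "AE x in lborel. norm (F k (grid_floor (h k) x)) \<le> M * indicator ?C x" for k
    proof (rule AE_I2)
      fix x
      show "norm (F k (grid_floor (h k) x)) \<le> M * indicator ?C x"
      proof (cases "F k (grid_floor (h k) x) = 0")
        case True
        have "M \<ge> 0" using order_trans[OF norm_ge_zero bound(1)] .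
        then show ?thesis using True by (auto simp: indicator_def)
      next
        case False
        have "- (R + H) \<le> x $ i \<and> x $ i \<le> R + H" for i
          using bound(2)[OF False] grid_floor_close[of "h k" i x] h(1,3)[of k i] by (smt (verit))
        then have "x \<in> ?C" by (simp add: mem_box_cart)
        then show ?thesis using bound(1) by simp
      qed
    qed
  qed
  moreover have "(\<integral>x. F k (grid_floor (h k) x) \<partial>lborel) = of_real (\<Prod>i\<in>UNIV. h k i) * (\<Sum>j\<in>J k. F k (grid_point (h k) j))" for k
    using integral_grid_floor(2)[of "h k" "J k" "F k"] h J supp by auto
  ultimately show ?thesis by simp
qed

subsection \<open>Wave packets\<close>

text \<open>The normalisation makes the squared norms of the packets based at a fixed \<open>m\<close> add up to 1.\<close>

definition wave_packet :: "nat \<Rightarrow> real ^ 'd \<Rightarrow> real ^ 'd \<Rightarrow> real ^ 'd \<Rightarrow> complex" where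
  "wave_packet Q m k j = (if j - m \<in> lattice_box (\<lambda>_. {0..<2 * int Q})
     then cis (pi / Q * (k \<bullet> (j - m))) / of_nat ((2 * Q) ^ CARD('d)) else 0)"

lemma card_fixed_box: "card (lattice_box (\<lambda>_::'d::finite. {0..<2 * int Q})) = (2 * Q) ^ CARD('d)"
  and card_freq_box: "card (lattice_box (\<lambda>_::'d::finite. {- int Q..<int Q})) = (2 * Q) ^ CARD('d)"
  unfolding card_lattice_box by (simp_all add: nat_mult_distrib)

lemma norm_wave_packet:
  fixes m k j :: "real ^ 'd"
  shows "cmod (wave_packet Q m k j) =
    (if j - m \<in> lattice_box (\<lambda>_. {0..<2 * int Q}) then 1 / real ((2 * Q) ^ CARD('d)) else 0)"
  unfolding wave_packet_def by (simp add: norm_divide norm_mult norm_power)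

lemma sum_wave_packet:
  fixes m k :: "real ^ 'd" and f :: "real ^ 'd \<Rightarrow> 'a::comm_monoid_add" and Q :: nat
  defines "B \<equiv> lattice_box (\<lambda>_::'d. {0..<2 * int Q})"
  assumes "finite S" "(+) m ` B \<subseteq> S" and "\<And>j. j - m \<notin> B \<Longrightarrow> f j = 0"
  shows "(\<Sum>j\<in>S. f j) = (\<Sum>t\<in>B. f (m + t))"
proof -
  have "(\<Sum>j\<in>S. f j) = (\<Sum>j\<in>(+) m ` B. f j)"
  proof (rule sum.mono_neutral_right[OF assms(2,3)], rule ballI)
    fix j assume "j \<in> S - (+) m ` B"
    then have "j - m \<notin> B" using image_eqI[of j "(+) m" "j - m" B] by auto
    then show "f j = 0" by (rule assms(4))
  qed
  then show ?thesis by (simp add: sum.reindex)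
qed

lemma wave_packet_norm_sq:
  fixes m k :: "real ^ 'd"
  assumes "finite S" "(+) m ` lattice_box (\<lambda>_. {0..<2 * int Q}) \<subseteq> S" and "Q > 0"
  shows "(\<Sum>j\<in>S. (cmod (wave_packet Q m k j))\<^sup>2) = 1 / real ((2 * Q) ^ CARD('d))"
proof -
  have "(\<Sum>j\<in>S. (cmod (wave_packet Q m k j))\<^sup>2) =
    (\<Sum>t\<in>lattice_box (\<lambda>_::'d. {0..<2 * int Q}). (cmod (wave_packet Q m k (m + t)))\<^sup>2)"
    by (rule sum_wave_packet[OF assms(1,2)]) (simp add: norm_wave_packet)
  also have "\<dots> = 1 / real ((2 * Q) ^ CARD('d))"
    using \<open>Q > 0\<close> by (simp add: norm_wave_packet card_fixed_box power2_eq_square)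
  finally show ?thesis .
qed

text \<open>For fixed \<open>m\<close>, summation over the frequencies gives the squared norm of
  \<open>w\<close> on the cube at \<open>m\<close>, divided by the number of its points. A grid
  point lies in at most that many cubes: for a fixed offset \<open>t\<close> the map from
  \<open>m\<close> to \<open>m + t\<close> is injective.\<close>

lemma wave_packet_bessel:
  fixes w :: "real ^ 'd \<Rightarrow> complex"
  assumes Q: "Q > 0" and S: "finite S" and G: "finite G"
    "\<And>m. m \<in> G \<Longrightarrow> (+) m ` lattice_box (\<lambda>_. {0..<2 * int Q}) \<subseteq> S"
  shows "(\<Sum>m\<in>G. \<Sum>k\<in>lattice_box (\<lambda>_. {- int Q..<int Q}). (cmod (\<Sum>j\<in>S. cnj (wave_packet Q m k j) * w j))\<^sup>2) \<le>
    (\<Sum>j\<in>S. (cmod (w j))\<^sup>2)"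
proof -
  let ?K = "lattice_box (\<lambda>_::'d. {- int Q..<int Q})"
  let ?B = "lattice_box (\<lambda>_::'d. {0..<2 * int Q})"
  let ?D = "(2 * Q) ^ CARD('d)"
  have D: "real ?D > 0" using Q by simp
  have "(\<Sum>k\<in>?K. (cmod (\<Sum>j\<in>S. cnj (wave_packet Q m k j) * w j))\<^sup>2) = (\<Sum>t\<in>?B. (cmod (w (m + t)))\<^sup>2) / real ?D"
    if "m \<in> G" for m
  proof -
    have "cmod (\<Sum>j\<in>S. cnj (wave_packet Q m k j) * w j) = cmod (\<Sum>t\<in>?B. cis (- (pi / Q * (k \<bullet> t))) * w (m + t)) / real ?D" for k
    proof -
      have "(\<Sum>j\<in>S. cnj (wave_packet Q m k j) * w j) = (\<Sum>t\<in>?B. cnj (wave_packet Q m k (m + t)) * w (m + t))"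
        by (rule sum_wave_packet[OF S G(2)[OF that]]) (simp add: wave_packet_def)
      also have "\<dots> = (\<Sum>t\<in>?B. cis (- (pi / Q * (k \<bullet> t))) * w (m + t)) / of_nat ?D"
        unfolding sum_divide_distrib by (intro sum.cong) (simp_all add: wave_packet_def cis_cnj)
      finally show ?thesis by (simp add: norm_divide norm_mult norm_power)
    qed
    then have "(\<Sum>k\<in>?K. (cmod (\<Sum>j\<in>S. cnj (wave_packet Q m k j) * w j))\<^sup>2) =
      (\<Sum>k\<in>?K. (cmod (\<Sum>t\<in>?B. cis (- (pi / Q * (k \<bullet> t))) * w (m + t)))\<^sup>2) / (real ?D)\<^sup>2"
      by (simp only: power_divide sum_divide_distrib)
    also have "\<dots> = (\<Sum>t\<in>?B. (cmod (w (m + t)))\<^sup>2) / real ?D"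
      unfolding parseval_lattice_box[OF Q, of "\<lambda>t. w (m + t)"] using D by (simp add: power2_eq_square)
    finally show ?thesis .
  qed
  then have "(\<Sum>m\<in>G. \<Sum>k\<in>?K. (cmod (\<Sum>j\<in>S. cnj (wave_packet Q m k j) * w j))\<^sup>2) =
    (\<Sum>m\<in>G. (\<Sum>t\<in>?B. (cmod (w (m + t)))\<^sup>2) / real ?D)"
    by (intro sum.cong refl)
  also have "\<dots> = (\<Sum>t\<in>?B. \<Sum>m\<in>G. (cmod (w (m + t)))\<^sup>2) / real ?D"
    by (subst sum.swap) (simp add: sum_divide_distrib)
  also have "\<dots> \<le> (\<Sum>t\<in>?B. \<Sum>j\<in>S. (cmod (w j))\<^sup>2) / real ?D"
  proof (intro divide_right_mono sum_mono)
    fix t assume "t \<in> ?B"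
    have "(\<Sum>m\<in>G. (cmod (w (m + t)))\<^sup>2) = (\<Sum>j\<in>(\<lambda>m. m + t) ` G. (cmod (w j))\<^sup>2)"
      by (subst sum.reindex) (auto simp: inj_on_def)
    also have "\<dots> \<le> (\<Sum>j\<in>S. (cmod (w j))\<^sup>2)"
      using G(2) \<open>t \<in> ?B\<close> by (intro sum_mono2 S) auto
    finally show "(\<Sum>m\<in>G. (cmod (w (m + t)))\<^sup>2) \<le> (\<Sum>j\<in>S. (cmod (w j))\<^sup>2)" .
  qed simp
  also have "\<dots> = (\<Sum>j\<in>S. (cmod (w j))\<^sup>2)"
    using D Q by (simp add: card_fixed_box)
  finally show ?thesis .
qed

text \<open>Only an inequality, since the shifted cube may stick out of \<open>S\<close>.\<close>

lemma wave_packet_shift_norm_sq: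
  fixes m k v :: "real ^ 'd"
  assumes "finite S" and "Q > 0"
  shows "(\<Sum>l\<in>S. (cmod (wave_packet Q m k (l + v)))\<^sup>2) \<le> 1 / real ((2 * Q) ^ CARD('d))"
proof -
  let ?B = "lattice_box (\<lambda>_::'d. {0..<2 * int Q})"
  let ?D = "(2 * Q) ^ CARD('d)"
  have "card {l\<in>S. l + v - m \<in> ?B} \<le> card ?B"
    by (rule card_inj_on_le[of "\<lambda>l. l + v - m"]) (auto simp: inj_on_def intro: finite_lattice_box)
  then have c: "real (card {l\<in>S. l + v - m \<in> ?B}) \<le> real ?D"
    unfolding card_fixed_box of_nat_le_iff .
  have "(\<Sum>l\<in>S. (cmod (wave_packet Q m k (l + v)))\<^sup>2) = (\<Sum>l\<in>S. if l + v - m \<in> ?B then (1 / real ?D)\<^sup>2 else 0)"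
    by (intro sum.cong) (auto simp: norm_wave_packet)
  also have "\<dots> = real (card {l\<in>S. l + v - m \<in> ?B}) * (1 / real ?D)\<^sup>2"
    using assms by (simp add: sum.If_cases Int_def)
  also have "\<dots> \<le> real ?D * (1 / real ?D)\<^sup>2"
    by (intro mult_right_mono c) simp
  also have "\<dots> = 1 / real ?D" by (simp add: power2_eq_square)
  finally show ?thesis .
qed

lemma lattice_box_split:
  "u \<in> lattice_box Z \<longleftrightarrow> u $ i \<in> of_int ` Z i \<and> (\<forall>i'. i' \<noteq> i \<longrightarrow> u $ i' \<in> of_int ` Z i')"
proof
  assume u: "u $ i \<in> of_int ` Z i \<and> (\<forall>i'. i' \<noteq> i \<longrightarrow> u $ i' \<in> of_int ` Z i')"
  have "u $ i' \<in> of_int ` Z i'" for i' using u by (cases "i' = i") simp_all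
  then show "u \<in> lattice_box Z" unfolding lattice_box_def by simp
qed (simp add: lattice_box_def)

lemma wave_packet_step:
  fixes m k l :: "real ^ 'd"
  assumes "l - m \<in> lattice_box (\<lambda>_. {0..<2 * int Q})" "l + axis i s - m \<in> lattice_box (\<lambda>_. {0..<2 * int Q})"
  shows "wave_packet Q m k (l + axis i s) = cis (pi / Q * k $ i * s) * wave_packet Q m k l"
proof -
  have "cis (pi / Q * (k \<bullet> (l + axis i s - m))) = cis (pi / Q * k $ i * s) * cis (pi / Q * (k \<bullet> (l - m)))"
    unfolding cis_mult by (simp add: inner_diff_right inner_add_right inner_axis algebra_simps)
  then show ?thesis using assms by (simp add: wave_packet_def)
qed

text \<open>In the interior of its cube the packet is an exact eigenvector of the second difference, so only
  layers at two opposite faces contribute.\<close>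

lemma wave_packet_laplace:
  fixes m k :: "real ^ 'd"
  assumes Q: "Q > 0" and S: "finite S"
  defines "D \<equiv> \<lambda>i l. 2 * of_real (cos (pi / Q * k $ i)) * wave_packet Q m k l
      - wave_packet Q m k (l - axis i 1) - wave_packet Q m k (l + axis i 1)"
  shows "(\<Sum>l\<in>S. (cmod (D i l))\<^sup>2) \<le> 64 / (2 * real Q) / real ((2 * Q) ^ CARD('d))"
proof -
  let ?B = "lattice_box (\<lambda>_::'d. {0..<2 * int Q})"
  \<comment> \<open>Offsets 0 and \<open>2 * Q - 1\<close> have a neighbour outside the cube;
    offsets \<open>- 1\<close> and \<open>2 * Q\<close> lie outside but have a neighbour inside.
    Elsewhere the three points involved are all inside or all outside.\<close>
  let ?E = "lattice_box (\<lambda>i'. if i' = i then {- 1, 0, 2 * int Q - 1, 2 * int Q} else {0..<2 * int Q})"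
  let ?N = "(2 * Q) ^ CARD('d)"
  have D_zero: "D i l = 0" if "l - m \<notin> ?E" for l
  proof -
    define other where "other \<longleftrightarrow> (\<forall>i'. i' \<noteq> i \<longrightarrow> (l - m) $ i' \<in> of_int ` {0..<2 * int Q})"
    have mem_B: "l + axis i s - m \<in> ?B \<longleftrightarrow> (l - m) $ i + s \<in> of_int ` {0..<2 * int Q} \<and> other" for s
    proof -
      have "(l + axis i s - m) $ i = (l - m) $ i + s" "i' \<noteq> i \<Longrightarrow> (l + axis i s - m) $ i' = (l - m) $ i'" for i'
        by (auto simp: axis_def)
      then show ?thesis unfolding lattice_box_split[where i = i] other_def by (simp add: diff_add_eq)
    qed
    have mem_E: "l - m \<in> ?E \<longleftrightarrow> (l - m) $ i \<in> of_int ` {- 1, 0, 2 * int Q - 1, 2 * int Q} \<and> other"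
      unfolding lattice_box_split[where i = i] other_def by simp
    have m0: "l = l + axis i 0" and m1: "l - axis i 1 = l + axis i (- 1)"
      by (simp_all add: axis_def Finite_Cartesian_Product.vec_eq_iff)
    have mem_1: "l - axis i 1 - m \<in> ?B \<longleftrightarrow> (l - m) $ i - 1 \<in> of_int ` {0..<2 * int Q} \<and> other"
      using mem_B[of "- 1"] unfolding m1 by simp
    have mem_0: "l - m \<in> ?B \<longleftrightarrow> (l - m) $ i \<in> of_int ` {0..<2 * int Q} \<and> other"
      using mem_B[of 0] unfolding m0[symmetric] by simp
    have "(l - m \<in> ?B \<and> l - axis i 1 - m \<in> ?B \<and> l + axis i 1 - m \<in> ?B) \<or>
      (l - m \<notin> ?B \<and> l - axis i 1 - m \<notin> ?B \<and> l + axis i 1 - m \<notin> ?B)"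
    proof (cases "\<exists>z. (l - m) $ i = of_int z")
      case True
      then obtain z where z: "(l - m) $ i = of_int z" by blast
      have inj: "inj (of_int :: int \<Rightarrow> real)" by (simp add: inj_def)
      have "(l - m) $ i + 1 = of_int (z + 1)" "(l - m) $ i - 1 = of_int (z - 1)" using z by simp_all
      then have eqs: "(l - m) $ i \<in> of_int ` A \<longleftrightarrow> z \<in> A" "(l - m) $ i + 1 \<in> of_int ` A \<longleftrightarrow> z + 1 \<in> A"
        "(l - m) $ i - 1 \<in> of_int ` A \<longleftrightarrow> z - 1 \<in> A" for A
        unfolding z by (simp_all only: inj_image_mem_iff[OF inj])
      show ?thesis using that unfolding mem_0 mem_1 mem_B mem_E eqs by auto
    next
      \<comment> \<open>The point \<open>l\<close> is an arbitrary real vector; off the lattice in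
        direction \<open>i\<close> all three packet values vanish.\<close>
      case False
      have "(l - m) $ i + of_int s \<notin> of_int ` A" for s A
      proof
        assume "(l - m) $ i + of_int s \<in> of_int ` A"
        then obtain z where "(l - m) $ i + of_int s = of_int z" by blast
        then have "(l - m) $ i = of_int (z - s)" by simp
        then show False using False by blast
      qed
      from this[of 0] this[of 1] this[of "- 1"] show ?thesis
        unfolding mem_0 mem_1 mem_B by simp
    qed
    then show ?thesis
    proof
      assume A: "l - m \<in> ?B \<and> l - axis i 1 - m \<in> ?B \<and> l + axis i 1 - m \<in> ?B"
      have "wave_packet Q m k (l - axis i 1) = cis (pi / Q * k $ i * (- 1)) * wave_packet Q m k l"
        using wave_packet_step[of l m Q i "- 1" k] A unfolding m1 by blast
      moreover have "wave_packet Q m k (l + axis i 1) = cis (pi / Q * k $ i * 1) * wave_packet Q m k l"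
        using wave_packet_step[of l m Q i 1 k] A by blast
      moreover have "2 * complex_of_real (cos x) = cis (x * (- 1)) + cis (x * 1)" for x
        by (simp add: complex_eq_iff)
      ultimately show ?thesis unfolding D_def by (simp add: distrib_right del: mult_minus1_right)
    next
      assume "l - m \<notin> ?B \<and> l - axis i 1 - m \<notin> ?B \<and> l + axis i 1 - m \<notin> ?B"
      then show ?thesis unfolding D_def wave_packet_def by simp
    qed
  qed
  have D_le: "cmod (D i l) \<le> 4 / real ?N" for l
  proof -
    have 1: "cmod (wave_packet Q m k j) \<le> 1 / real ?N" for j by (simp add: norm_wave_packet)
    have "cmod (D i l) \<le> cmod (2 * of_real (cos (pi / Q * k $ i)) * wave_packet Q m k l)
        + cmod (wave_packet Q m k (l - axis i 1)) + cmod (wave_packet Q m k (l + axis i 1))"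
      unfolding D_def by (intro order_trans[OF norm_triangle_ineq4] add_mono norm_triangle_ineq4 order_refl)
    also have "\<dots> \<le> 2 * (1 / real ?N) + 1 / real ?N + 1 / real ?N"
    proof (intro add_mono 1)
      have "cmod (2 * of_real (cos (pi / Q * k $ i)) * wave_packet Q m k l) = 2 * \<bar>cos (pi / Q * k $ i)\<bar> * cmod (wave_packet Q m k l)"
        by (simp add: norm_mult)
      also have "\<dots> \<le> (2 * 1) * (1 / real ?N)"
        by (intro mult_mono 1) auto
      finally show "cmod (2 * of_real (cos (pi / Q * k $ i)) * wave_packet Q m k l) \<le> 2 * (1 / real ?N)" by simp
    qed
    finally show ?thesis by (simp add: mult_ac)
  qed
  have cE: "2 * real Q * real (card ?E) \<le> 4 * real ?N"
  proof -
    have "card ?E = card {- 1, 0, 2 * int Q - 1, 2 * int Q} * (2 * Q) ^ (CARD('d) - 1)"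
      unfolding card_lattice_box by (subst prod.remove[of _ i]) (simp_all add: nat_mult_distrib)
    moreover have "card {- 1, 0, 2 * int Q - 1, 2 * int Q} \<le> 4"
      by (simp add: card_insert_if)
    moreover have "?N = (2 * Q) * (2 * Q) ^ (CARD('d) - 1)"
      by (subst power_Suc[symmetric]) simp
    ultimately have "(2 * Q) * card ?E \<le> 4 * ?N"
      by (simp add: mult.assoc mult.left_commute)
    then have "real ((2 * Q) * card ?E) \<le> real (4 * ?N)" by (rule of_nat_mono)
    then show ?thesis by simp
  qed
  have "(\<Sum>l\<in>S. (cmod (D i l))\<^sup>2) \<le> (\<Sum>l\<in>S. if l - m \<in> ?E then (4 / real ?N)\<^sup>2 else 0)"
    using D_zero D_le by (intro sum_mono) (auto intro: power_mono)
  also have "\<dots> = real (card {l\<in>S. l - m \<in> ?E}) * (4 / real ?N)\<^sup>2"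
    using S by (simp add: sum.If_cases Int_def)
  also have "\<dots> \<le> real (card ?E) * (4 / real ?N)\<^sup>2"
  proof (intro mult_right_mono of_nat_mono)
    show "card {l\<in>S. l - m \<in> ?E} \<le> card ?E"
      by (rule card_inj_on_le[of "\<lambda>l. l - m"]) (auto simp: inj_on_def intro: finite_lattice_box)
  qed simp
  \<comment> \<open>The constant \<open>64\<close> is \<open>4 * 4^2\<close>: four layers, each a
    fraction \<open>1 / (2 * Q)\<close> of the cube, and the pointwise bound
    \<open>4 / real ?N\<close>.\<close>
  also have "\<dots> \<le> (4 * real ?N / (2 * real Q)) * (4 / real ?N)\<^sup>2"
    using cE Q by (intro mult_right_mono) (auto simp: field_simps)
  also have "\<dots> = 64 / (2 * real Q) / real ?N"
    using Q by (simp add: power2_eq_square)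
  finally show ?thesis .
qed

text \<open>Comparison with the stencil of constant coefficients \<open>\<alpha> i\<close>. Only
  rows meeting the cube are described, because the packet multiplies from the left and vanishes on
  all others. The error has two sources: deviation of the coefficients, bounded by
  \<open>\<eta>\<close>, and the cut-off of the plane wave, which costs a term of order
  \<open>1 / Q\<close>.\<close>

lemma wave_packet_residual:
  fixes m k :: "real ^ 'd" and E :: "real ^ 'd \<Rightarrow> real ^ 'd \<Rightarrow> real"
    and Q :: nat and p :: "real ^ 'd \<Rightarrow> real" and qp qm :: "'d \<Rightarrow> real ^ 'd \<Rightarrow> real"
  defines "B \<equiv> lattice_box (\<lambda>_::'d. {0..<2 * int Q})"
  assumes Q: "Q > 0" and S: "finite S" "(+) m ` B \<subseteq> S"
    and row: "\<And>j l. j - m \<in> B \<Longrightarrow> E j l = (if l = j then p j else 0) +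
       (\<Sum>i\<in>UNIV. (if l = j + axis i 1 then qp i j else 0) + (if l = j - axis i 1 then qm i j else 0))"
    and p: "\<And>j. j - m \<in> B \<Longrightarrow> \<bar>p j - 2 * (\<Sum>i\<in>UNIV. \<alpha> i)\<bar> \<le> \<eta>"
    and q: "\<And>j i. j - m \<in> B \<Longrightarrow> \<bar>qp i j + \<alpha> i\<bar> \<le> \<eta>" "\<And>j i. j - m \<in> B \<Longrightarrow> \<bar>qm i j + \<alpha> i\<bar> \<le> \<eta>"
    and M: "\<And>i. \<bar>\<alpha> i\<bar> \<le> M"
  defines "\<kappa> \<equiv> (\<Sum>i\<in>UNIV. \<alpha> i * (2 - 2 * cos (pi / Q * k $ i)))"
  shows "(\<Sum>l\<in>S. (cmod ((\<Sum>j\<in>S. cnj (wave_packet Q m k j) * of_real (E j l)) - of_real \<kappa> * cnj (wave_packet Q m k l)))\<^sup>2) \<le>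
     ((2 + 12 * (real CARD('d))\<^sup>2) * \<eta>\<^sup>2 + 384 * (real CARD('d))\<^sup>2 * M\<^sup>2 / (2 * Q)) / real ((2 * Q) ^ CARD('d))"
proof -
  define d where "d = real CARD('d)"
  define W where "W = 1 / real ((2 * Q) ^ CARD('d))"
  define g where "g = wave_packet Q m k"
  have g0: "g j = 0" if "j - m \<notin> B" for j using that by (simp add: g_def wave_packet_def B_def)
  have gS: "g j = 0" if "j \<notin> S" for j
  proof (rule g0, rule notI)
    assume "j - m \<in> B"
    then have "m + (j - m) \<in> S" using S(2) by blast
    then show False using that by simp
  qed
  have d: "d \<ge> 1" by (simp add: d_def Suc_le_eq)
  have \<eta>: "\<eta> \<ge> 0"
  proof -
    have "m + 0 - m \<in> B" using Q by (auto simp: B_def lattice_box_def intro!: image_eqI[of _ _ 0])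
    from order_trans[OF abs_ge_zero p[OF this]] show ?thesis .
  qed
  define D where "D i l = 2 * of_real (cos (pi / Q * k $ i)) * g l - g (l - axis i 1) - g (l + axis i 1)" for i l
  define r where "r l = (\<Sum>j\<in>S. cnj (g j) * of_real (E j l)) - of_real \<kappa> * cnj (g l)" for l
  have r_eq: "r l = cnj (g l) * of_real (p l - 2 * (\<Sum>i\<in>UNIV. \<alpha> i)) +
     (\<Sum>i\<in>UNIV. cnj (g (l - axis i 1)) * of_real (qp i (l - axis i 1) + \<alpha> i) +
        cnj (g (l + axis i 1)) * of_real (qm i (l + axis i 1) + \<alpha> i) + of_real (\<alpha> i) * cnj (D i l))" if l: "l \<in> S" for l
  proof -
    have delta: "(\<Sum>j\<in>S. if l = j + v then cnj (g j) * of_real (f j) else 0) = cnj (g (l - v)) * of_real (f (l - v))" for v f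
    proof -
      have "(\<Sum>j\<in>S. if l = j + v then cnj (g j) * of_real (f j) else 0) = (\<Sum>j\<in>S. if l - v = j then cnj (g j) * of_real (f j) else 0)"
        by (intro sum.cong refl if_cong) (auto simp: algebra_simps)
      also have "\<dots> = cnj (g (l - v)) * of_real (f (l - v))" using S(1) gS by auto
      finally show ?thesis .
    qed
    define P where "P j = (if l = j + 0 then cnj (g j) * of_real (p j) else 0)" for j
    define X where "X i j = (if l = j + axis i 1 then cnj (g j) * of_real (qp i j) else 0) +
         (if l = j + (- axis i 1) then cnj (g j) * of_real (qm i j) else 0)" for i j
    have "cnj (g j) * of_real (E j l) = P j + (\<Sum>i\<in>UNIV. X i j)" for j
    proof (cases "j - m \<in> B")
      case True
      have iff: "z * complex_of_real (if T then x else 0) = (if T then z * of_real x else 0)" for z T x by simp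
      show ?thesis unfolding row[OF True] P_def X_def
        by (simp only: distrib_left sum_distrib_left of_real_add of_real_sum iff add_0_right diff_conv_add_uminus)
    qed (simp add: g0 P_def X_def)
    then have "(\<Sum>j\<in>S. cnj (g j) * of_real (E j l)) = (\<Sum>j\<in>S. P j) + (\<Sum>j\<in>S. \<Sum>i\<in>UNIV. X i j)"
      by (simp only: sum.distrib)
    moreover have "(\<Sum>j\<in>S. \<Sum>i\<in>UNIV. X i j) = (\<Sum>i\<in>UNIV. \<Sum>j\<in>S. X i j)" by (rule sum.swap)
    moreover have "(\<Sum>j\<in>S. X i j) = cnj (g (l - axis i 1)) * of_real (qp i (l - axis i 1)) +
        cnj (g (l + axis i 1)) * of_real (qm i (l + axis i 1))" for i
      unfolding X_def sum.distrib delta by simp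
    moreover have "(\<Sum>j\<in>S. P j) = cnj (g l) * of_real (p l)"
      unfolding P_def delta by simp
    ultimately have lhs: "(\<Sum>j\<in>S. cnj (g j) * of_real (E j l)) = cnj (g l) * of_real (p l) +
      (\<Sum>i\<in>UNIV. cnj (g (l - axis i 1)) * of_real (qp i (l - axis i 1)) + cnj (g (l + axis i 1)) * of_real (qm i (l + axis i 1)))" by simp
    have t: "cnj (g (l - axis i 1)) * of_real (qp i (l - axis i 1) + \<alpha> i) +
        cnj (g (l + axis i 1)) * of_real (qm i (l + axis i 1) + \<alpha> i) + of_real (\<alpha> i) * cnj (D i l) =
       (cnj (g (l - axis i 1)) * of_real (qp i (l - axis i 1)) + cnj (g (l + axis i 1)) * of_real (qm i (l + axis i 1)))
       + (of_real (2 * \<alpha> i) * cnj (g l) - of_real (\<alpha> i * (2 - 2 * cos (pi / Q * k $ i))) * cnj (g l))" for i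
      unfolding D_def by (simp add: algebra_simps)
    have "(\<Sum>i\<in>UNIV. of_real (2 * \<alpha> i) * cnj (g l) - of_real (\<alpha> i * (2 - 2 * cos (pi / Q * k $ i))) * cnj (g l)) =
      of_real (2 * (\<Sum>i\<in>UNIV. \<alpha> i)) * cnj (g l) - of_real \<kappa> * cnj (g l)"
      unfolding \<kappa>_def sum_subtractf sum_distrib_left of_real_sum sum_distrib_right ..
    then show ?thesis
      unfolding r_def lhs t sum.distrib by (simp add: algebra_simps)
  qed
  have r_le: "cmod (r l) \<le> \<eta> * cmod (g l) + (\<Sum>i\<in>UNIV. \<eta> * cmod (g (l - axis i 1)) + \<eta> * cmod (g (l + axis i 1)) + M * cmod (D i l))"
    if l: "l \<in> S" for l
  proof -
    have prod: "cmod (cnj (g j) * of_real x) \<le> \<eta> * cmod (g j)" if "j - m \<in> B \<Longrightarrow> \<bar>x\<bar> \<le> \<eta>" for j x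
    proof (cases "j - m \<in> B")
      case True
      from mult_right_mono[OF that[OF True], of "cmod (g j)"] show ?thesis
        by (simp add: norm_mult mult.commute)
    qed (simp add: g0)
    have prodD: "cmod (of_real (\<alpha> i) * cnj (D i l)) \<le> M * cmod (D i l)" for i
      using mult_right_mono[OF M[of i], of "cmod (D i l)"] by (simp add: norm_mult)
    show ?thesis unfolding r_eq[OF l]
      by (intro order_trans[OF norm_triangle_ineq] add_mono sum_norm_le prod prodD p q)
  qed
  have sq2: "(x + y)\<^sup>2 \<le> 2 * x\<^sup>2 + 2 * y\<^sup>2" for x y :: real
    using sum_squares_bound[of x y] by (simp add: power2_sum)
  have sq3: "(x + y + z)\<^sup>2 \<le> 3 * x\<^sup>2 + 3 * y\<^sup>2 + 3 * z\<^sup>2" for x y z :: real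
  proof -
    have "(x + y + z)\<^sup>2 \<le> (x + y + z)\<^sup>2 + (x - y)\<^sup>2 + (y - z)\<^sup>2 + (x - z)\<^sup>2" by simp
    also have "\<dots> = 3 * x\<^sup>2 + 3 * y\<^sup>2 + 3 * z\<^sup>2" by (simp add: power2_eq_square algebra_simps)
    finally show ?thesis .
  qed
  define t where "t i l = \<eta>\<^sup>2 * (cmod (g (l - axis i 1)))\<^sup>2 + \<eta>\<^sup>2 * (cmod (g (l + axis i 1)))\<^sup>2 + M\<^sup>2 * (cmod (D i l))\<^sup>2" for i l
  \<comment> \<open>The factor \<open>6 * d\<close> is \<open>2 * 3 * d\<close>: two for separating
    the central term, \<open>d\<close> from Cauchy-Schwarz over the directions, three for the three
    terms in each direction.\<close>
  have r_sq: "(cmod (r l))\<^sup>2 \<le> 2 * \<eta>\<^sup>2 * (cmod (g l))\<^sup>2 + 6 * d * (\<Sum>i\<in>UNIV. t i l)" if l: "l \<in> S" for l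
  proof -
    define s where "s i = \<eta> * cmod (g (l - axis i 1)) + \<eta> * cmod (g (l + axis i 1)) + M * cmod (D i l)" for i
    have st: "(s i)\<^sup>2 \<le> 3 * t i l" for i
      unfolding s_def t_def by (rule order_trans[OF sq3]) (simp add: power_mult_distrib)
    have "(\<Sum>i\<in>UNIV. s i)\<^sup>2 \<le> (\<Sum>i\<in>UNIV. (s i)\<^sup>2) * d"
      unfolding d_def by (rule sum_squared_le_sum_of_squares)
    also have "\<dots> \<le> (\<Sum>i\<in>UNIV. 3 * t i l) * d"
      using d by (intro mult_right_mono sum_mono st) simp
    finally have S2: "(\<Sum>i\<in>UNIV. s i)\<^sup>2 \<le> 3 * d * (\<Sum>i\<in>UNIV. t i l)"
      unfolding sum_distrib_left[symmetric] by (simp only: mult_ac)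
    have "(cmod (r l))\<^sup>2 \<le> (\<eta> * cmod (g l) + (\<Sum>i\<in>UNIV. s i))\<^sup>2"
      using r_le[OF l] by (intro power_mono) (simp_all add: s_def)
    also have "\<dots> \<le> 2 * (\<eta> * cmod (g l))\<^sup>2 + 2 * (\<Sum>i\<in>UNIV. s i)\<^sup>2"
      by (rule sq2)
    finally show ?thesis using S2 by (simp add: power_mult_distrib)
  qed
  have sums: "(\<Sum>l\<in>S. (cmod (g l))\<^sup>2) \<le> W" "(\<Sum>l\<in>S. (cmod (g (l - v)))\<^sup>2) \<le> W" "(\<Sum>l\<in>S. (cmod (g (l + v)))\<^sup>2) \<le> W"
    "(\<Sum>l\<in>S. (cmod (D i l))\<^sup>2) \<le> 64 / (2 * real Q) * W" for v i
    using wave_packet_shift_norm_sq[OF S(1) Q, of m k 0] wave_packet_shift_norm_sq[OF S(1) Q, of m k "- v"]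
      wave_packet_shift_norm_sq[OF S(1) Q, of m k v] wave_packet_laplace[OF Q S(1), of k i m]
    unfolding g_def D_def W_def by simp_all
  have "(\<Sum>l\<in>S. (cmod (r l))\<^sup>2) \<le> (\<Sum>l\<in>S. 2 * \<eta>\<^sup>2 * (cmod (g l))\<^sup>2 + 6 * d * (\<Sum>i\<in>UNIV. t i l))"
    by (intro sum_mono r_sq)
  also have "\<dots> = (\<Sum>l\<in>S. 2 * \<eta>\<^sup>2 * (cmod (g l))\<^sup>2) + (\<Sum>l\<in>S. 6 * d * (\<Sum>i\<in>UNIV. t i l))"
    by (rule sum.distrib)
  also have "\<dots> = 2 * \<eta>\<^sup>2 * (\<Sum>l\<in>S. (cmod (g l))\<^sup>2) + 6 * d * (\<Sum>l\<in>S. \<Sum>i\<in>UNIV. t i l)"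
    by (simp only: sum_distrib_left)
  also have "\<dots> = 2 * \<eta>\<^sup>2 * (\<Sum>l\<in>S. (cmod (g l))\<^sup>2) + 6 * d * (\<Sum>i\<in>UNIV. \<Sum>l\<in>S. t i l)"
    by (subst sum.swap) (rule refl)
  also have "\<dots> = 2 * \<eta>\<^sup>2 * (\<Sum>l\<in>S. (cmod (g l))\<^sup>2) + 6 * d * (\<Sum>i\<in>UNIV. \<eta>\<^sup>2 * (\<Sum>l\<in>S. (cmod (g (l - axis i 1)))\<^sup>2) +
      \<eta>\<^sup>2 * (\<Sum>l\<in>S. (cmod (g (l + axis i 1)))\<^sup>2) + M\<^sup>2 * (\<Sum>l\<in>S. (cmod (D i l))\<^sup>2))"
    unfolding t_def by (simp only: sum.distrib sum_distrib_left)
  also have "\<dots> \<le> 2 * \<eta>\<^sup>2 * W + 6 * d * (\<Sum>i\<in>(UNIV::'d set). \<eta>\<^sup>2 * W + \<eta>\<^sup>2 * W + M\<^sup>2 * (64 / (2 * real Q) * W))"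
    using d by (intro add_mono mult_left_mono sum_mono sums) auto
  also have "\<dots> = 2 * \<eta>\<^sup>2 * W + 6 * d * (d * (\<eta>\<^sup>2 * W + \<eta>\<^sup>2 * W + M\<^sup>2 * (64 / (2 * real Q) * W)))"
    by (simp add: d_def)
  also have "\<dots> = ((2 + 12 * d\<^sup>2) * \<eta>\<^sup>2 + 384 * d\<^sup>2 * M\<^sup>2 / (2 * Q)) * W"
    by (simp add: power2_eq_square algebra_simps)
  finally show ?thesis unfolding r_def g_def W_def d_def by simp
qed

subsection \<open>Rows of the Shortley--Weller matrix\<close>

lemma sw_point_shift: "sw_point N (j + s *\<^sub>R axis i 1) = sw_point N j + (s * sw_step N i) *\<^sub>R axis i 1"
  by (auto simp: sw_point_def axis_def Finite_Cartesian_Product.vec_eq_iff algebra_simps)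

lemma sw_s_nonneg:
  assumes "sw_point N j \<in> interior \<Omega>"
  shows "0 \<le> sw_s \<Omega> N \<sigma> i j"
  unfolding sw_s_def by (rule cSup_upper) (use assms in \<open>auto intro: bdd_aboveI[of _ 1]\<close>)

text \<open>The supremum 1 need not be attained, but some \<open>t > 1 / 2\<close> belongs to the
  set. This puts the argument of \<open>a i\<close> in an off-diagonal entry inside the open set
  where the coefficients are bounded, even in a row near the boundary.\<close>

lemma sw_s_eq_1_midpoint:
  assumes "sw_point N j \<in> interior \<Omega>" and "sw_s \<Omega> N \<sigma> i j = 1"
  shows "sw_point N (j + (\<sigma> / 2) *\<^sub>R axis i 1) \<in> interior \<Omega>"
proof -
  let ?T = "{t \<in> {0..1}. \<forall>r\<in>{0..t}. sw_point N j + (\<sigma> * r * sw_step N i) *\<^sub>R axis i 1 \<in> interior \<Omega>}"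
  have 0: "0 \<in> ?T" using assms by auto
  have "1 / 2 < Sup ?T" using assms(2) by (simp add: sw_s_def)
  then obtain t where t: "t \<in> ?T" "1 / 2 < t" using less_cSupD[of ?T "1/2"] 0 by blast
  then have "1 / 2 \<in> {0..t}" by simp
  with t(1) have "sw_point N j + (\<sigma> * (1 / 2) * sw_step N i) *\<^sub>R axis i 1 \<in> interior \<Omega>" by blast
  then show ?thesis by (simp add: sw_point_shift)
qed

text \<open>Whole segments are required, so that every arm has length 1 and the midpoints are
  interior as well.\<close>

definition sw_regular :: "(real ^ 'd) set \<Rightarrow> nat ^ 'd \<Rightarrow> real ^ 'd \<Rightarrow> bool" where
  "sw_regular \<Omega> N j \<longleftrightarrow> (\<forall>i s. \<bar>s\<bar> \<le> 1 \<longrightarrow> sw_point N (j + s *\<^sub>R axis i 1) \<in> interior \<Omega>)"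

lemma sw_s_regular:
  assumes "sw_regular \<Omega> N j" and "\<bar>\<sigma>\<bar> = 1"
  shows "sw_s \<Omega> N \<sigma> i j = 1"
proof -
  have "{t \<in> {0..1}. \<forall>r\<in>{0..t}. sw_point N j + (\<sigma> * r * sw_step N i) *\<^sub>R axis i 1 \<in> interior \<Omega>} = {0..1}"
    using assms unfolding sw_regular_def sw_point_shift by (auto simp: abs_mult)
  then show ?thesis by (simp add: sw_s_def)
qed

lemma axis_shift_neq [simp]:
  fixes j :: "real ^ 'd"
  shows "j + axis i 1 \<noteq> j" "j - axis i 1 \<noteq> j" "j \<noteq> j + axis i 1" "j \<noteq> j - axis i 1"
  by (auto simp: axis_eq_0_iff)

text \<open>Used with \<open>r = real n\<close> and \<open>v = \<nu> $ i\<close>: the scaling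
  cancels \<open>1 / h^2\<close> in the terms with \<open>a i\<close> and leaves a factor
  \<open>1 / n\<close> on the terms with \<open>b i\<close>.\<close>

lemma scaled_quotients:
  fixes r :: real
  assumes "r > 0"
  shows "(x * (r\<^sup>2 * v\<^sup>2) + y * (r\<^sup>2 * v\<^sup>2)) / r\<^sup>2 = v\<^sup>2 * (x + y)"
    "(- x * (r\<^sup>2 * v\<^sup>2) + y * (r * v) / 2) / r\<^sup>2 = - (v\<^sup>2 * x) + v * y / (2 * r)"
    "(- x * (r\<^sup>2 * v\<^sup>2) - y * (r * v) / 2) / r\<^sup>2 = - (v\<^sup>2 * x) - v * y / (2 * r)"
proof -
  show 1: "(x * (r\<^sup>2 * v\<^sup>2) + y * (r\<^sup>2 * v\<^sup>2)) / r\<^sup>2 = v\<^sup>2 * (x + y)" for x y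
    using assms by (simp add: nonzero_divide_eq_eq algebra_simps)
  show 2: "(- x * (r\<^sup>2 * v\<^sup>2) - y * (r * v) / 2) / r\<^sup>2 = - (v\<^sup>2 * x) - v * y / (2 * r)" for x y
    using assms by (simp add: nonzero_divide_eq_eq power2_eq_square left_diff_distrib)
  show "(- x * (r\<^sup>2 * v\<^sup>2) + y * (r * v) / 2) / r\<^sup>2 = - (v\<^sup>2 * x) + v * y / (2 * r)"
    using 2[of x "- y"] by simp
qed

lemma step_quotients:
  fixes h :: real
  assumes "1 / h\<^sup>2 = q" "1 / h = p"
  shows "x / (1 / 2 * 1 * (1 + 1) * h\<^sup>2) = x * q" "x / (1 / 2 * (1 + 1) * h\<^sup>2) = x * q"
    "x / ((1 + 1) * h) = x * p / 2"
  using assms by auto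

section \<open>Scaled matrix entries on one grid\<close>

locale sw_scheme =
  fixes \<Omega> :: "(real ^ 'd) set" and a b :: "'d \<Rightarrow> real ^ 'd \<Rightarrow> real" and c :: "real ^ 'd \<Rightarrow> real"
    and \<nu> :: "real ^ 'd" and N :: "nat ^ 'd" and n :: nat and M :: real
  assumes n: "n > 0" and N: "\<And>i. real (N $ i) + 1 = real n * \<nu> $ i" and \<nu>: "\<And>i. \<nu> $ i > 0"
    and bound: "\<And>i x. x \<in> interior \<Omega> \<Longrightarrow> \<bar>a i x\<bar> \<le> M" "\<And>i x. x \<in> interior \<Omega> \<Longrightarrow> \<bar>b i x\<bar> \<le> M"
      "\<And>x. x \<in> interior \<Omega> \<Longrightarrow> \<bar>c x\<bar> \<le> M"
begin

lemma sw_step_eq: "sw_step N i = 1 / (real n * \<nu> $ i)"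
  by (simp add: sw_step_def N)

definition entry :: "real ^ 'd \<Rightarrow> real ^ 'd \<Rightarrow> real" where
  "entry j k = sw_entry \<Omega> a b c N j k / (real n)\<^sup>2"

definition entry_diag :: "real ^ 'd \<Rightarrow> real" where
  "entry_diag j = (\<Sum>i\<in>UNIV. (\<nu> $ i)\<^sup>2 * (a i (sw_point N (j + (1 / 2) *\<^sub>R axis i 1)) + a i (sw_point N (j - (1 / 2) *\<^sub>R axis i 1))))
        + c (sw_point N j) / (real n)\<^sup>2"

definition entry_up :: "'d \<Rightarrow> real ^ 'd \<Rightarrow> real" where
  "entry_up i j = - ((\<nu> $ i)\<^sup>2 * a i (sw_point N (j + (1 / 2) *\<^sub>R axis i 1))) + \<nu> $ i * b i (sw_point N j) / (2 * real n)"

definition entry_down :: "'d \<Rightarrow> real ^ 'd \<Rightarrow> real" where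
  "entry_down i j = - ((\<nu> $ i)\<^sup>2 * a i (sw_point N (j - (1 / 2) *\<^sub>R axis i 1))) - \<nu> $ i * b i (sw_point N j) / (2 * real n)"

text \<open>With all arms equal to 1 the Shortley-Weller weights reduce to those of the central
  difference stencil.\<close>

lemma entry_regular:
  assumes reg: "sw_regular \<Omega> N j"
  shows "entry j k =
    (if k = j then entry_diag j else 0) +
    (\<Sum>i\<in>UNIV. (if k = j + axis i 1 then entry_up i j else 0)
      + (if k = j - axis i 1 then entry_down i j else 0))"
proof -
  have s: "sw_s \<Omega> N 1 i j = 1" "sw_s \<Omega> N (- 1) i j = 1" for i
    by (rule sw_s_regular[OF reg], simp)+
  have h: "1 / (sw_step N i)\<^sup>2 = (real n)\<^sup>2 * (\<nu> $ i)\<^sup>2" "1 / sw_step N i = real n * \<nu> $ i" for i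
    by (simp_all add: sw_step_eq power_divide power_mult_distrib)
  have div: "x / (1 / 2 * 1 * (1 + 1) * (sw_step N i)\<^sup>2) = x * ((real n)\<^sup>2 * (\<nu> $ i)\<^sup>2)"
    "x / (1 / 2 * (1 + 1) * (sw_step N i)\<^sup>2) = x * ((real n)\<^sup>2 * (\<nu> $ i)\<^sup>2)"
    "x / ((1 + 1) * sw_step N i) = x * (real n * \<nu> $ i) / 2" for x i
    using h[of i] by (rule step_quotients)+
  have e: "(x * ((real n)\<^sup>2 * (\<nu> $ i)\<^sup>2) + y * ((real n)\<^sup>2 * (\<nu> $ i)\<^sup>2)) / (real n)\<^sup>2 = (\<nu> $ i)\<^sup>2 * (x + y)"
    "(- x * ((real n)\<^sup>2 * (\<nu> $ i)\<^sup>2) + y * (real n * \<nu> $ i) / 2) / (real n)\<^sup>2 = - ((\<nu> $ i)\<^sup>2 * x) + \<nu> $ i * y / (2 * real n)"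
    "(- x * ((real n)\<^sup>2 * (\<nu> $ i)\<^sup>2) - y * (real n * \<nu> $ i) / 2) / (real n)\<^sup>2 = - ((\<nu> $ i)\<^sup>2 * x) - \<nu> $ i * y / (2 * real n)" for x y i
    using n by (simp_all only: scaled_quotients of_nat_0_less_iff)
  have if_div: "(if P then x else 0) / r = (if P then x / r else 0)" for P and x r :: real by simp
  show ?thesis
  proof (cases "k = j")
    case True
    have "entry j j = entry_diag j"
      unfolding entry_def sw_entry_def Let_def s div
      by (simp only: refl if_True, subst add_divide_distrib, subst sum_divide_distrib, simp only: e entry_diag_def)
    then show ?thesis using True by simp
  next
    case False
    have "entry j k = (\<Sum>i\<in>UNIV.
        ((if k = j + axis i 1 then - a i (sw_point N (j + (1 / 2) *\<^sub>R axis i 1)) * ((real n)\<^sup>2 * (\<nu> $ i)\<^sup>2) + b i (sw_point N j) * (real n * \<nu> $ i) / 2 else 0)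
      + (if k = j - axis i 1 then - a i (sw_point N (j - (1 / 2) *\<^sub>R axis i 1)) * ((real n)\<^sup>2 * (\<nu> $ i)\<^sup>2) - b i (sw_point N j) * (real n * \<nu> $ i) / 2 else 0)) / (real n)\<^sup>2)"
      unfolding entry_def sw_entry_def Let_def s div by (simp only: False if_False sum_divide_distrib simp_thms)
    also have "\<dots> = (\<Sum>i\<in>UNIV. (if k = j + axis i 1 then entry_up i j else 0)
      + (if k = j - axis i 1 then entry_down i j else 0))"
      by (rule sum.cong[OF refl], subst add_divide_distrib, simp only: if_div e entry_up_def entry_down_def)
    finally show ?thesis using False by simp
  qed
qed

text \<open>Per direction, \<open>2 * (\<nu> $ i)^2 * M\<close> comes from the term with
  \<open>a i\<close>, whose denominator has the factor \<open>1 / 2\<close>, and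
  \<open>\<nu> $ i * M\<close> from the term with \<open>b i\<close>; the outer 2 is for the two
  signs. All directions are added, so the active one need not be identified.\<close>

definition offdiag_bound :: real where
  "offdiag_bound = (\<Sum>i\<in>UNIV. 2 * (2 * (\<nu> $ i)\<^sup>2 * M + \<nu> $ i * M))"

text \<open>An off-diagonal entry occurs only if the arm in its direction is full. Then the sum of
  the two arms is at least 1, and no small denominator appears, however close the boundary
  is.\<close>

lemma entry_offdiag_bound:
  assumes "sw_point N j \<in> interior \<Omega>" and "k \<noteq> j"
  shows "\<bar>entry j k\<bar> \<le> offdiag_bound"
proof -
  have M: "M \<ge> 0" using order_trans[OF abs_ge_zero bound(3)[OF assms(1)]] .
  let ?sp = "\<lambda>i. sw_s \<Omega> N 1 i j" and ?sm = "\<lambda>i. sw_s \<Omega> N (- 1) i j"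
  note sb = sw_s_nonneg[OF assms(1)]
  have frac: "\<bar>(- A / (1 / 2 * s * (sw_step N i)\<^sup>2) + \<sigma> * (B / (s * sw_step N i))) / (real n)\<^sup>2\<bar> \<le> 2 * (\<nu> $ i)\<^sup>2 * M + \<nu> $ i * M"
    if "\<bar>A\<bar> \<le> M" "\<bar>B\<bar> \<le> M" "s \<ge> 1" "\<bar>\<sigma>\<bar> = 1" for A B s i \<sigma>
  proof -
    have n1: "real n \<ge> 1" using n by simp
    have "(- A / (1 / 2 * s * (sw_step N i)\<^sup>2) + \<sigma> * (B / (s * sw_step N i))) / (real n)\<^sup>2 =
      - (2 * (\<nu> $ i)\<^sup>2 * (A / s)) + \<sigma> * (\<nu> $ i * (B / (s * real n)))"
      using n \<nu>[of i] that by (simp add: sw_step_eq field_simps power2_eq_square)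
    also have "\<bar>\<dots>\<bar> \<le> \<bar>2 * (\<nu> $ i)\<^sup>2 * (A / s)\<bar> + \<bar>\<sigma> * (\<nu> $ i * (B / (s * real n)))\<bar>"
      by (rule order_trans[OF abs_triangle_ineq]) (simp only: abs_minus_cancel order_refl)
    also have "\<dots> = 2 * (\<nu> $ i)\<^sup>2 * (\<bar>A\<bar> / s) + \<nu> $ i * (\<bar>B\<bar> / (s * real n))"
      using that \<nu>[of i] n by (simp add: abs_mult)
    also have "\<dots> \<le> 2 * (\<nu> $ i)\<^sup>2 * (M / 1) + \<nu> $ i * (M / 1)"
    proof (intro add_mono mult_left_mono frac_le that M)
      show "1 \<le> s * real n" using mult_mono[of 1 s 1 "real n"] that n1 by simp
    qed (use \<nu>[of i] in auto)
    finally show ?thesis by simp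
  qed
  have *: "\<bar>(if k = j + axis i 1 \<and> ?sp i = 1
              then - a i (sw_point N (j + (1 / 2) *\<^sub>R axis i 1)) / (1 / 2 * (?sp i + ?sm i) * (sw_step N i)\<^sup>2)
                   + b i (sw_point N j) / ((?sp i + ?sm i) * sw_step N i)
              else 0) / (real n)\<^sup>2\<bar> \<le> 2 * (\<nu> $ i)\<^sup>2 * M + \<nu> $ i * M" (is "\<bar>?x i / _\<bar> \<le> _")
    and **: "\<bar>(if k = j - axis i 1 \<and> ?sm i = 1
              then - a i (sw_point N (j - (1 / 2) *\<^sub>R axis i 1)) / (1 / 2 * (?sp i + ?sm i) * (sw_step N i)\<^sup>2)
                   - b i (sw_point N j) / ((?sp i + ?sm i) * sw_step N i)
              else 0) / (real n)\<^sup>2\<bar> \<le> 2 * (\<nu> $ i)\<^sup>2 * M + \<nu> $ i * M" (is "\<bar>?y i / _\<bar> \<le> _") for i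
  proof -
    have nn: "0 \<le> 2 * (\<nu> $ i)\<^sup>2 * M + \<nu> $ i * M" using M \<nu>[of i] by simp
    show "\<bar>?x i / (real n)\<^sup>2\<bar> \<le> 2 * (\<nu> $ i)\<^sup>2 * M + \<nu> $ i * M"
    proof (cases "?sp i = 1")
      case True
      have "\<bar>a i (sw_point N (j + (1 / 2) *\<^sub>R axis i 1))\<bar> \<le> M"
        by (intro bound sw_s_eq_1_midpoint assms True)
      from frac[OF this bound(2)[OF assms(1)], of "?sp i + ?sm i" 1] show ?thesis
        using True sb[of "- 1" i] nn by auto
    qed (use nn in auto)
    show "\<bar>?y i / (real n)\<^sup>2\<bar> \<le> 2 * (\<nu> $ i)\<^sup>2 * M + \<nu> $ i * M"
    proof (cases "?sm i = 1")
      case True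
      have "\<bar>a i (sw_point N (j - (1 / 2) *\<^sub>R axis i 1))\<bar> \<le> M"
        using sw_s_eq_1_midpoint[OF assms(1) True] by (intro bound) simp
      from frac[OF this bound(2)[OF assms(1)], of "?sp i + ?sm i" "- 1"] show ?thesis
        using True sb[of 1 i] nn by auto
    qed (use nn in auto)
  qed
  have abs_add: "\<bar>x\<bar> \<le> K \<Longrightarrow> \<bar>y\<bar> \<le> K \<Longrightarrow> \<bar>x + y\<bar> \<le> 2 * K" for x y K :: real by linarith
  have "entry j k = (\<Sum>i\<in>UNIV. (?x i + ?y i) / (real n)\<^sup>2)"
    unfolding entry_def sw_entry_def Let_def by (simp only: assms(2) if_False sum_divide_distrib simp_thms)
  also have "\<dots> = (\<Sum>i\<in>UNIV. ?x i / (real n)\<^sup>2 + ?y i / (real n)\<^sup>2)"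
    by (rule sum.cong[OF refl add_divide_distrib])
  also have "\<bar>\<dots>\<bar> \<le> offdiag_bound" unfolding offdiag_bound_def
  proof (rule order_trans[OF sum_abs], rule sum_mono)
    fix i show "\<bar>?x i / (real n)\<^sup>2 + ?y i / (real n)\<^sup>2\<bar> \<le> 2 * (2 * (\<nu> $ i)\<^sup>2 * M + \<nu> $ i * M)"
      by (rule abs_add[OF * **])
  qed
  finally show ?thesis .
qed

lemma entry_eq_0:
  assumes "k \<noteq> j" "\<And>i. k \<noteq> j + axis i 1" "\<And>i. k \<noteq> j - axis i 1"
  shows "entry j k = 0"
  unfolding entry_def sw_entry_def Let_def using assms by simp

text \<open>Neighbours evaluate \<open>a i\<close> at the same midpoint, so these terms cancel. The
  central difference for \<open>b i\<close> is antisymmetric up to the change of \<open>b i\<close>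
  and survives with its factor \<open>1 / n\<close>.\<close>

lemma entry_asymmetry:
  assumes j: "sw_regular \<Omega> N j" and k: "sw_regular \<Omega> N k"
  shows "\<bar>entry j k - entry k j\<bar> \<le> offdiag_bound / real n"
proof -
  have inter: "sw_point N j \<in> interior \<Omega>" "sw_point N k \<in> interior \<Omega>"
    using j[unfolded sw_regular_def, rule_format, of 0] k[unfolded sw_regular_def, rule_format, of 0] by simp_all
  have M: "M \<ge> 0" using order_trans[OF abs_ge_zero bound(3)[OF inter(1)]] .
  let ?\<beta> = "\<lambda>i. \<nu> $ i * (b i (sw_point N j) + b i (sw_point N k)) / (2 * real n)"
  have \<beta>: "\<bar>?\<beta> i\<bar> \<le> \<nu> $ i * M / real n" for i
  proof -
    have "\<bar>?\<beta> i\<bar> = \<nu> $ i * \<bar>b i (sw_point N j) + b i (sw_point N k)\<bar> / (2 * real n)"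
      using \<nu>[of i] n by (simp add: abs_mult)
    also have "\<dots> \<le> \<nu> $ i * (M + M) / (2 * real n)"
      using \<nu>[of i] n abs_triangle_ineq[of "b i (sw_point N j)" "b i (sw_point N k)"] bound(2)[OF inter(1), of i] bound(2)[OF inter(2), of i]
      by (intro divide_right_mono mult_left_mono) (linarith | simp)+
    finally show ?thesis by simp
  qed
  have ab: "\<bar>(if P then x else 0) - (if R then x else 0)\<bar> \<le> \<bar>x\<bar> + \<bar>x\<bar>" for P R and x :: real by simp
  have *: "((if k = j + axis i 1 then entry_up i j else 0)
      + (if k = j - axis i 1 then entry_down i j else 0))
    - ((if j = k + axis i 1 then entry_up i k else 0)
      + (if j = k - axis i 1 then entry_down i k else 0))
    = (if k = j + axis i 1 then ?\<beta> i else 0) - (if k = j - axis i 1 then ?\<beta> i else 0)" (is "?l i = ?r i") for i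
  proof -
    have e: "j = k + axis i 1 \<longleftrightarrow> k = j - axis i 1" "j = k - axis i 1 \<longleftrightarrow> k = j + axis i 1" by auto
    have half: "axis i 1 = (1 / 2) *\<^sub>R axis i 1 + (1 / 2) *\<^sub>R (axis i 1 :: real ^ 'd)"
      by (simp flip: scaleR_add_left)
    have h1: "j + axis i 1 - (1 / 2) *\<^sub>R axis i 1 = j + (1 / 2) *\<^sub>R axis i 1"
      by (subst half) simp
    have h2: "j - axis i 1 + (1 / 2) *\<^sub>R axis i 1 = j - (1 / 2) *\<^sub>R axis i 1"
      by (subst half) simp
    have ne: "j + axis i 1 \<noteq> j - axis i 1"
    proof
      assume "j + axis i 1 = j - axis i 1"
      from arg_cong[OF this, of "\<lambda>v. v $ i"] show False by simp
    qed
    consider "k = j + axis i 1" | "k = j - axis i 1" | "k \<noteq> j + axis i 1" "k \<noteq> j - axis i 1" by blast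
    then show ?thesis
    proof cases
      case 1
      show ?thesis unfolding e entry_up_def entry_down_def unfolding 1 h1 simp_thms if_True using n
        by (simp only: ne if_False) (simp add: field_simps)
    next
      case 2
      show ?thesis unfolding e entry_up_def entry_down_def unfolding 2 h2 simp_thms if_True using n
        by (simp only: ne[symmetric] if_False) (simp add: field_simps)
    next
      case 3
      then show ?thesis unfolding e by simp
    qed
  qed
  have "entry j k - entry k j = (\<Sum>i\<in>UNIV. ?l i)"
    if "k \<noteq> j"
    unfolding entry_regular[OF j] entry_regular[OF k] sum_subtractf using that by simp
  moreover have "(\<Sum>i\<in>UNIV. ?l i) = 0" if "k = j"
    using that by simp
  ultimately have "entry j k - entry k j = (\<Sum>i\<in>UNIV. ?l i)" by fastforce
  also have "\<dots> = (\<Sum>i\<in>UNIV. ?r i)" by (rule sum.cong[OF refl *])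
  finally have "entry j k - entry k j = (\<Sum>i\<in>UNIV. ?r i)" .
  then have "\<bar>entry j k - entry k j\<bar> \<le> (\<Sum>i\<in>UNIV. \<bar>?\<beta> i\<bar> + \<bar>?\<beta> i\<bar>)"
    by (simp only:) (intro order_trans[OF sum_abs] sum_mono ab)
  also have "\<dots> \<le> (\<Sum>i\<in>UNIV. \<nu> $ i * M / real n + \<nu> $ i * M / real n)"
    by (intro sum_mono add_mono \<beta>)
  also have "\<dots> \<le> offdiag_bound / real n"
    unfolding offdiag_bound_def sum_divide_distrib using M \<nu> n
    by (intro sum_mono) (simp add: divide_right_mono flip: add_divide_distrib)
  finally show ?thesis .
qed

end

lemma proots_linear_factors: "proots (\<Prod>e\<leftarrow>es. [:- e, 1 :: complex:]) = mset es"
proof (induction es)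
  case (Cons e es)
  have "(\<Prod>e\<leftarrow>es. [:- e, 1 :: complex:]) \<noteq> 0" by (auto simp: prod_list_zero_iff)
  then show ?case using Cons.IH by (simp add: proots_mult del: mult_pCons_left)
qed simp

lemma distinct_lex_sorted:
  fixes xs :: "(real ^ 'd::{finite,linorder}) list"
  shows "sorted_wrt lex_less xs \<Longrightarrow> distinct xs"
  by (induction xs) (auto simp: less_fun_irrefl)

lemma lex_list_properties:
  fixes S :: "(real ^ 'd::{finite,linorder}) set"
  assumes "finite S"
  shows "distinct (lex_list S)" "set (lex_list S) = S"
proof -
  have "sorted_wrt lex_less (lex_list S) \<and> set (lex_list S) = S"
    unfolding lex_list_def by (rule theI'[OF lex_list_unique[OF assms]])
  then show "distinct (lex_list S)" "set (lex_list S) = S" by (auto intro: distinct_lex_sorted)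
qed

section \<open>Grid points far from the boundary\<close>

locale sw_scheme_cube = sw_scheme \<Omega> a b c \<nu> N n M
  for \<Omega> :: "(real ^ 'd) set" and a b c \<nu> N n M +
  assumes cube: "\<Omega> \<subseteq> {x. \<forall>i. 0 \<le> x $ i \<and> x $ i \<le> 1}"
begin

text \<open>Of the \<open>L + 1\<close> steps, \<open>L\<close> make room for the packet, used with
  \<open>L = 2 * Q\<close>, and one for the neighbours of its points. The solid cube is required and
  not only its lattice points, since \<open>sw_regular\<close> concerns segments.\<close>

definition good :: "nat \<Rightarrow> (real ^ 'd) set" where
  "good L = {m \<in> sw_indices \<Omega> N.
     \<forall>y. (\<forall>i. \<bar>y $ i - sw_point N m $ i\<bar> \<le> (real L + 1) * sw_step N i) \<longrightarrow> y \<in> interior \<Omega>}"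

lemma good_subset: "good L \<subseteq> sw_indices \<Omega> N"
  by (auto simp: good_def)

lemma step_pos: "sw_step N i > 0"
  using n \<nu>[of i] by (simp add: sw_step_eq)

lemma good_interior:
  assumes "m \<in> good L" "\<And>i. \<bar>t $ i\<bar> \<le> real L + 1"
  shows "sw_point N (m + t) \<in> interior \<Omega>"
proof -
  have "\<bar>sw_point N (m + t) $ i - sw_point N m $ i\<bar> \<le> (real L + 1) * sw_step N i" for i
    using mult_right_mono[OF assms(2)[of i], of "sw_step N i"] step_pos[of i]
    by (simp add: sw_point_def algebra_simps abs_mult)
  then show ?thesis using assms(1) by (auto simp: good_def)
qed

lemma good_regular:
  assumes "m \<in> good L" "\<And>i. \<bar>t $ i\<bar> \<le> real L"
  shows "sw_regular \<Omega> N (m + t)"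
  unfolding sw_regular_def
proof (intro allI impI)
  fix i and s :: real assume s: "\<bar>s\<bar> \<le> 1"
  have "\<bar>(t + s *\<^sub>R axis i 1) $ i'\<bar> \<le> real L + 1" for i'
    using assms(2)[of i'] s by (auto simp: axis_def)
  from good_interior[OF assms(1), of "t + s *\<^sub>R axis i 1", OF this] show "sw_point N (m + t + s *\<^sub>R axis i 1) \<in> interior \<Omega>"
    by (simp add: add.assoc)
qed

text \<open>Because the domain lies in the unit cube, the range condition on the indices is
  automatic for integer vectors.\<close>

lemma in_sw_indices:
  assumes "sw_point N j \<in> interior \<Omega>" "\<And>i. j $ i \<in> \<int>"
  shows "j \<in> sw_indices \<Omega> N"
proof -
  have "0 \<le> j $ i \<and> j $ i \<le> real (N $ i) + 1" for i
  proof -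
    have "sw_point N j \<in> \<Omega>" using assms(1) interior_subset by blast
    then have "0 \<le> j $ i * sw_step N i" "j $ i * sw_step N i \<le> 1"
      using cube by (auto simp: sw_point_def)
    then show ?thesis using step_pos[of i]
      by (simp add: zero_le_mult_iff zero_le_divide_iff sw_step_def pos_divide_le_eq)
  qed
  then show ?thesis using assms by (auto simp: sw_indices_def)
qed

lemma good_in_sw_indices:
  assumes "m \<in> good L" "\<And>i. \<bar>t $ i\<bar> \<le> real L + 1" "\<And>i. t $ i \<in> \<int>"
  shows "m + t \<in> sw_indices \<Omega> N"
  using assms good_interior[of m L t] by (intro in_sw_indices) (auto simp: good_def sw_indices_def)

lemma good_box:
  assumes "m \<in> good (2 * Q)"
  shows "(+) m ` lattice_box (\<lambda>_. {0..<2 * int Q}) \<subseteq> sw_indices \<Omega> N"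
proof (rule image_subsetI)
  fix t :: "real ^ 'd" assume "t \<in> lattice_box (\<lambda>_. {0..<2 * int Q})"
  then have t: "t $ i \<in> of_int ` {0..<2 * int Q}" for i by (simp add: lattice_box_def)
  have "t $ i \<in> \<int> \<and> \<bar>t $ i\<bar> \<le> real (2 * Q) + 1" for i
    using t[of i] by auto
  then show "m + t \<in> sw_indices \<Omega> N" by (intro good_in_sw_indices[OF assms]) auto
qed

text \<open>A row of \<open>A - A^*\<close> has at most \<open>2 * CARD('d)\<close> nonzero entries,
  the diagonal being zero. In a good row \<open>L \<ge> 1\<close> makes the neighbours regular and
  the entries of order \<open>1 / n\<close>; in the other rows they are merely bounded.\<close>

lemma asymmetry_sum:
  assumes L: "L \<ge> 1"
  shows "(\<Sum>j\<in>sw_indices \<Omega> N. \<Sum>k\<in>sw_indices \<Omega> N. (entry j k - entry k j)\<^sup>2) \<le>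
    2 * CARD('d) * (card (sw_indices \<Omega> N) * (offdiag_bound / n)\<^sup>2 + card (sw_indices \<Omega> N - good L) * (2 * offdiag_bound)\<^sup>2)"
proof -
  let ?S = "sw_indices \<Omega> N"
  let ?C = offdiag_bound
  define bd where "bd j = (if j \<in> good L then (?C / n)\<^sup>2 else (2 * ?C)\<^sup>2)" for j
  have bd0: "bd j \<ge> 0" for j by (simp add: bd_def)
  have row: "(\<Sum>k\<in>?S. (entry j k - entry k j)\<^sup>2) \<le> 2 * CARD('d) * bd j" if j: "j \<in> ?S" for j
  proof -
    define nb where "nb = (\<lambda>i. j + axis i 1) ` UNIV \<union> (\<lambda>i. j - axis i 1) ` (UNIV :: 'd set)"
    have fin: "finite nb" by (simp add: nb_def)
    have "card nb \<le> CARD('d) + CARD('d)"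
      unfolding nb_def by (intro order_trans[OF card_Un_le] add_mono card_image_le) simp_all
    then have cnb: "real (card nb) \<le> 2 * CARD('d)" by simp
    have zero: "entry j k - entry k j = 0" if "k \<notin> nb" for k
    proof (cases "k = j")
      case False
      have "entry j k = 0" using that False by (intro entry_eq_0) (auto simp: nb_def)
      moreover have "entry k j = 0"
        using that False by (intro entry_eq_0) (auto simp: nb_def image_iff algebra_simps)
      ultimately show ?thesis by simp
    qed simp
    have le: "(entry j k - entry k j)\<^sup>2 \<le> bd j" if k: "k \<in> ?S" "k \<in> nb" for k
    proof (cases "j \<in> good L")
      case True
      have "\<exists>t. k = j + t \<and> (\<forall>i. \<bar>t $ i\<bar> \<le> real L)"
      proof -
        from k(2) consider i where "k = j + axis i 1" | i where "k = j + (- axis i 1)"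
          by (auto simp: nb_def)
        then show ?thesis
        proof cases
          case (1 i)
          then show ?thesis using L by (intro exI[of _ "axis i 1"]) (auto simp: axis_def)
        next
          case (2 i)
          then show ?thesis using L by (intro exI[of _ "- axis i 1"]) (auto simp: axis_def)
        qed
      qed
      then have "sw_regular \<Omega> N k" using good_regular[OF True] by blast
      moreover have "sw_regular \<Omega> N j" using good_regular[OF True, of 0] by simp
      ultimately have "\<bar>entry j k - entry k j\<bar> \<le> ?C / n" by (intro entry_asymmetry)
      then have "\<bar>entry j k - entry k j\<bar>\<^sup>2 \<le> (?C / n)\<^sup>2" by (intro power_mono) auto
      then show ?thesis using True by (simp add: bd_def)
    next
      case False
      have "k \<noteq> j" using k(2) by (auto simp: nb_def)
      then have "\<bar>entry j k\<bar> \<le> ?C" "\<bar>entry k j\<bar> \<le> ?C"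
        using j k by (auto intro!: entry_offdiag_bound simp: sw_indices_def)
      then have "\<bar>entry j k - entry k j\<bar> \<le> 2 * ?C" by linarith
      then have "\<bar>entry j k - entry k j\<bar>\<^sup>2 \<le> (2 * ?C)\<^sup>2" by (intro power_mono) auto
      then show ?thesis using False by (simp add: bd_def)
    qed
    have "(\<Sum>k\<in>?S. (entry j k - entry k j)\<^sup>2) = (\<Sum>k\<in>?S \<inter> nb. (entry j k - entry k j)\<^sup>2)"
      using finite_sw_indices zero by (intro sum.mono_neutral_right) auto
    also have "\<dots> \<le> card (?S \<inter> nb) * bd j"
      using le by (intro sum_bounded_above) auto
    also have "\<dots> \<le> card nb * bd j"
      using bd0 fin by (intro mult_right_mono) (auto intro: card_mono)
    also have "\<dots> \<le> 2 * CARD('d) * bd j"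
      using bd0 cnb by (intro mult_right_mono) auto
    finally show ?thesis .
  qed
  have "(\<Sum>j\<in>?S. \<Sum>k\<in>?S. (entry j k - entry k j)\<^sup>2) \<le> (\<Sum>j\<in>?S. 2 * CARD('d) * bd j)"
    by (intro sum_mono row)
  also have "\<dots> = 2 * CARD('d) * (\<Sum>j\<in>?S. bd j)" by (simp only: sum_distrib_left)
  also have "(\<Sum>j\<in>?S. bd j) = card (good L) * (?C / n)\<^sup>2 + card (?S - good L) * (2 * ?C)\<^sup>2"
  proof -
    have "(\<Sum>j\<in>?S. bd j) = (\<Sum>j\<in>?S - good L. bd j) + (\<Sum>j\<in>good L. bd j)"
      by (rule sum.subset_diff[OF good_subset finite_sw_indices])
    then show ?thesis by (simp add: bd_def)
  qed
  also have "2 * CARD('d) * (card (good L) * (?C / n)\<^sup>2 + card (?S - good L) * (2 * ?C)\<^sup>2) \<le>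
    2 * CARD('d) * (card ?S * (?C / n)\<^sup>2 + card (?S - good L) * (2 * ?C)\<^sup>2)"
    using card_mono[OF finite_sw_indices good_subset[of L]]
    by (intro mult_left_mono add_right_mono mult_right_mono) auto
  finally show ?thesis .
qed

definition mode_symbol :: "nat \<Rightarrow> real ^ 'd \<Rightarrow> real ^ 'd \<Rightarrow> real" where
  "mode_symbol Q x k = (\<Sum>i\<in>UNIV. (\<nu> $ i)\<^sup>2 * a i x * (2 - 2 * cos (pi / Q * k $ i)))"

text \<open>\<open>\<delta>\<close> stands for the variation of \<open>a i\<close> over a cube,
  \<open>\<nu> $ i * M / n\<close> for the first-order term, and \<open>M / n\<close> dominates the
  reaction term. The last summand is the cut-off error of the packet and does not shrink with
  \<open>n\<close>, which is why \<open>Q\<close> has to grow too.\<close>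

definition residual_bound :: "nat \<Rightarrow> real \<Rightarrow> real" where
  "residual_bound Q \<delta> =
     (2 + 12 * (real CARD('d))\<^sup>2) * ((\<Sum>i\<in>UNIV. 2 * (\<nu> $ i)\<^sup>2 * \<delta> + \<nu> $ i * M / n) + M / n)\<^sup>2
     + 384 * (real CARD('d))\<^sup>2 * ((\<Sum>i\<in>UNIV. (\<nu> $ i)\<^sup>2) * M)\<^sup>2 / (2 * Q)"

definition packet_residual :: "nat \<Rightarrow> real ^ 'd \<Rightarrow> real ^ 'd \<Rightarrow> real ^ 'd \<Rightarrow> complex" where
  "packet_residual Q m k l = (\<Sum>j\<in>sw_indices \<Omega> N. cnj (wave_packet Q m k j) * of_real (entry j l))
      - of_real (mode_symbol Q (sw_point N m) k) * cnj (wave_packet Q m k l)"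

lemma residual_le:
  assumes Q: "Q > 0" and m: "m \<in> good (2 * Q)" and M: "M \<ge> 0" and \<delta>: "\<delta> \<ge> 0"
    and dev: "\<And>i t. (\<And>i. \<bar>t $ i\<bar> \<le> real (2 * Q) + 1) \<Longrightarrow> \<bar>a i (sw_point N (m + t)) - a i (sw_point N m)\<bar> \<le> \<delta>"
  shows "(\<Sum>l\<in>sw_indices \<Omega> N. (cmod (packet_residual Q m k l))\<^sup>2) \<le> residual_bound Q \<delta> / real ((2 * Q) ^ CARD('d))"
proof -
  define \<eta> where "\<eta> = (\<Sum>i\<in>UNIV. 2 * (\<nu> $ i)\<^sup>2 * \<delta> + \<nu> $ i * M / n) + M / n"
  define \<alpha> where "\<alpha> i = (\<nu> $ i)\<^sup>2 * a i (sw_point N m)" for i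
  let ?B = "lattice_box (\<lambda>_::'d. {0..<2 * int Q})"
  have n1: "real n \<ge> 1" using n by simp
  have B: "\<bar>(j - m) $ i\<bar> \<le> real (2 * Q)" if "j - m \<in> ?B" for j i
  proof -
    from that have "(j - m) $ i \<in> of_int ` {0..<2 * int Q}" by (simp only: lattice_box_def mem_Collect_eq)
    then obtain z where "(j - m) $ i = of_int z" "0 \<le> z" "z < 2 * int Q" by auto
    then show ?thesis by simp
  qed
  have dev2: "\<bar>a i (sw_point N (j + s *\<^sub>R axis i 1)) - a i (sw_point N m)\<bar> \<le> \<delta>"
    if "j - m \<in> ?B" "\<bar>s\<bar> \<le> 1" for j i s
  proof -
    have "\<bar>(j - m + s *\<^sub>R axis i 1) $ i'\<bar> \<le> real (2 * Q) + 1" for i'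
      using B[OF that(1), of i'] that(2) by (auto simp: axis_def)
    from dev[of "j - m + s *\<^sub>R axis i 1" i, OF this] show ?thesis by (simp add: algebra_simps)
  qed
  have reg: "sw_regular \<Omega> N j" if "j - m \<in> ?B" for j
    using good_regular[OF m, of "j - m"] B[OF that] by simp
  have inter: "sw_point N j \<in> interior \<Omega>" if "j - m \<in> ?B" for j
    using reg[OF that, unfolded sw_regular_def, rule_format, of 0] by simp
  have term_nonneg: "0 \<le> 2 * (\<nu> $ i)\<^sup>2 * \<delta> + \<nu> $ i * M / n" for i
    using \<delta> M \<nu>[of i] by simp
  \<comment> \<open>The diagonal collects the errors of all directions, so its bound
    \<open>\<eta>\<close> also serves each off-diagonal entry, whose error is bounded by one
    summand.\<close>
  have term_le: "2 * (\<nu> $ i)\<^sup>2 * \<delta> + \<nu> $ i * M / n \<le> \<eta>" for i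
  proof -
    have "2 * (\<nu> $ i)\<^sup>2 * \<delta> + \<nu> $ i * M / n \<le> (\<Sum>i\<in>UNIV. 2 * (\<nu> $ i)\<^sup>2 * \<delta> + \<nu> $ i * M / n)"
      by (rule member_le_sum) (use term_nonneg in auto)
    then show ?thesis unfolding \<eta>_def using M by (simp add: add_increasing2)
  qed
  have sq_dev: "\<bar>(\<nu> $ i)\<^sup>2 * x - \<alpha> i\<bar> \<le> (\<nu> $ i)\<^sup>2 * \<delta>" if "\<bar>x - a i (sw_point N m)\<bar> \<le> \<delta>" for x i
    unfolding \<alpha>_def right_diff_distrib[symmetric] abs_mult using mult_left_mono[OF that, of "(\<nu> $ i)\<^sup>2"] by simp
  have b_dev: "\<bar>\<nu> $ i * b i (sw_point N j) / (2 * real n)\<bar> \<le> \<nu> $ i * M / n" if "j - m \<in> ?B" for i j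
  proof -
    have "\<bar>\<nu> $ i * b i (sw_point N j) / (2 * real n)\<bar> = \<nu> $ i * \<bar>b i (sw_point N j)\<bar> / (2 * real n)"
      using \<nu>[of i] n by (simp add: abs_mult)
    also have "\<dots> \<le> \<nu> $ i * M / real n"
      using \<nu>[of i] n bound(2)[OF inter[OF that], of i] M by (intro frac_le mult_left_mono mult_nonneg_nonneg) auto
    finally show ?thesis .
  qed
  have ab: "\<bar>- x + y + z\<bar> \<le> 2 * u + v" "\<bar>- x - y + z\<bar> \<le> 2 * u + v" if "\<bar>x - z\<bar> \<le> u" "\<bar>y\<bar> \<le> v" for x y z u v :: real
    using that by linarith+
  have "(\<Sum>l\<in>sw_indices \<Omega> N. (cmod ((\<Sum>j\<in>sw_indices \<Omega> N. cnj (wave_packet Q m k j) * of_real (entry j l))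
      - of_real (\<Sum>i\<in>UNIV. \<alpha> i * (2 - 2 * cos (pi / Q * k $ i))) * cnj (wave_packet Q m k l)))\<^sup>2) \<le>
     ((2 + 12 * (real CARD('d))\<^sup>2) * \<eta>\<^sup>2 + 384 * (real CARD('d))\<^sup>2 * ((\<Sum>i\<in>UNIV. (\<nu> $ i)\<^sup>2) * M)\<^sup>2 / (2 * Q)) / real ((2 * Q) ^ CARD('d))"
  proof (rule wave_packet_residual[OF Q finite_sw_indices good_box[OF m]])
    fix j l assume j: "j - m \<in> ?B"
    show "entry j l = (if l = j then entry_diag j else 0) +
     (\<Sum>i\<in>UNIV. (if l = j + axis i 1 then entry_up i j else 0)
      + (if l = j - axis i 1 then entry_down i j else 0))"
      by (rule entry_regular[OF reg[OF j]])
  next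
    fix j assume j: "j - m \<in> ?B"
    have "entry_diag j - 2 * (\<Sum>i\<in>UNIV. \<alpha> i) =
      (\<Sum>i\<in>UNIV. ((\<nu> $ i)\<^sup>2 * a i (sw_point N (j + (1 / 2) *\<^sub>R axis i 1)) - \<alpha> i) + ((\<nu> $ i)\<^sup>2 * a i (sw_point N (j - (1 / 2) *\<^sub>R axis i 1)) - \<alpha> i))
      + c (sw_point N j) / (real n)\<^sup>2"
      by (simp add: entry_diag_def sum.distrib sum_subtractf distrib_left sum_distrib_left)
    also have "\<bar>\<dots>\<bar> \<le> (\<Sum>i\<in>UNIV. 2 * (\<nu> $ i)\<^sup>2 * \<delta> + \<nu> $ i * M / n) + M / n"
    proof (rule order_trans[OF abs_triangle_ineq], rule add_mono)
      show "\<bar>\<Sum>i\<in>UNIV. ((\<nu> $ i)\<^sup>2 * a i (sw_point N (j + (1 / 2) *\<^sub>R axis i 1)) - \<alpha> i) + ((\<nu> $ i)\<^sup>2 * a i (sw_point N (j - (1 / 2) *\<^sub>R axis i 1)) - \<alpha> i)\<bar>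
        \<le> (\<Sum>i\<in>UNIV. 2 * (\<nu> $ i)\<^sup>2 * \<delta> + \<nu> $ i * M / n)"
      proof (rule order_trans[OF sum_abs], rule sum_mono)
        fix i
        have "\<bar>x\<bar> \<le> u \<Longrightarrow> \<bar>y\<bar> \<le> u \<Longrightarrow> 0 \<le> v \<Longrightarrow> \<bar>x + y\<bar> \<le> 2 * u + v" for x y u v :: real by linarith
        from this[OF sq_dev[OF dev2[OF j, of "1/2" i]] sq_dev[OF dev2[OF j, of "- (1/2)" i]], of "\<nu> $ i * M / n"]
        show "\<bar>((\<nu> $ i)\<^sup>2 * a i (sw_point N (j + (1 / 2) *\<^sub>R axis i 1)) - \<alpha> i) + ((\<nu> $ i)\<^sup>2 * a i (sw_point N (j - (1 / 2) *\<^sub>R axis i 1)) - \<alpha> i)\<bar>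
          \<le> 2 * (\<nu> $ i)\<^sup>2 * \<delta> + \<nu> $ i * M / n"
          using M \<nu>[of i] by (simp add: mult.assoc)
      qed
      have "\<bar>c (sw_point N j) / (real n)\<^sup>2\<bar> \<le> M / (real n)\<^sup>2"
        using bound(3)[OF inter[OF j]] by (simp add: abs_divide divide_right_mono)
      also have "\<dots> \<le> M / real n"
        using n1 M by (intro divide_left_mono) (auto simp: power2_eq_square)
      finally show "\<bar>c (sw_point N j) / (real n)\<^sup>2\<bar> \<le> M / real n" .
    qed
    finally show "\<bar>entry_diag j - 2 * (\<Sum>i\<in>UNIV. \<alpha> i)\<bar> \<le> \<eta>" by (simp only: \<eta>_def)
  next
    fix j i assume j: "j - m \<in> ?B"
    show "\<bar>entry_up i j + \<alpha> i\<bar> \<le> \<eta>"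
      unfolding entry_up_def using ab(1)[OF sq_dev[OF dev2[OF j, of "1/2" i]] b_dev[OF j, of i]] term_le[of i] by simp
    have "\<bar>- ((\<nu> $ i)\<^sup>2 * a i (sw_point N (j + (- (1 / 2)) *\<^sub>R axis i 1))) - \<nu> $ i * b i (sw_point N j) / (2 * real n) + \<alpha> i\<bar> \<le> 2 * ((\<nu> $ i)\<^sup>2 * \<delta>) + \<nu> $ i * M / n"
      by (intro ab(2) sq_dev dev2 b_dev j) simp
    then show "\<bar>entry_down i j + \<alpha> i\<bar> \<le> \<eta>"
      unfolding entry_down_def using term_le[of i] by simp
  next
    fix i
    have m0: "sw_point N m \<in> interior \<Omega>" using m by (simp add: good_def sw_indices_def)
    have "\<bar>\<alpha> i\<bar> = (\<nu> $ i)\<^sup>2 * \<bar>a i (sw_point N m)\<bar>" by (simp add: \<alpha>_def abs_mult)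
    also have "\<dots> \<le> (\<Sum>i\<in>UNIV. (\<nu> $ i)\<^sup>2) * M"
      using bound(1)[OF m0] by (intro mult_mono member_le_sum sum_nonneg) auto
    finally show "\<bar>\<alpha> i\<bar> \<le> (\<Sum>i\<in>UNIV. (\<nu> $ i)\<^sup>2) * M" .
  qed
  then show ?thesis unfolding residual_bound_def packet_residual_def mode_symbol_def \<alpha>_def \<eta>_def .
qed

end

definition sw_symbol :: "real ^ 'd \<Rightarrow> ('d \<Rightarrow> real ^ 'd \<Rightarrow> real) \<Rightarrow> real ^ 'd \<Rightarrow> real ^ 'd \<Rightarrow> real" where
  "sw_symbol \<nu> a x \<theta> = (\<Sum>i\<in>UNIV. (\<nu> $ i)\<^sup>2 * a i x * (2 - 2 * cos (\<theta> $ i)))"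

lemma (in sw_scheme_cube) mode_symbol_eq: "mode_symbol Q x k = sw_symbol \<nu> a x ((pi / Q) *\<^sub>R k)"
  by (simp add: mode_symbol_def sw_symbol_def)

section \<open>Eigenvalue sums on one grid\<close>

text \<open>\<open>p\<close> is a partial transport plan between the \<open>z i\<close> and the
  \<open>w \<alpha>\<close>. The undelivered mass \<open>n - q * card T\<close> costs at most
  \<open>K\<close> per unit. Delivered mass costs \<open>\<epsilon> + C\<close> times the squared
  distance, and the total of the squared distances is \<open>R\<close>; this is why \<open>F\<close>
  enters through a quadratic modulus.\<close>

lemma weighted_average_estimate:
  fixes F :: "complex \<Rightarrow> complex" and p :: "'a \<Rightarrow> nat \<Rightarrow> real"
  assumes T: "finite T" and p: "\<And>\<alpha> i. 0 \<le> p \<alpha> i" "\<And>i. i < n \<Longrightarrow> (\<Sum>\<alpha>\<in>T. p \<alpha> i) \<le> 1"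
    "\<And>\<alpha>. \<alpha> \<in> T \<Longrightarrow> (\<Sum>i<n. p \<alpha> i) = q"
    and R: "(\<Sum>\<alpha>\<in>T. \<Sum>i<n. p \<alpha> i * (cmod (z i - w \<alpha>))\<^sup>2) \<le> R"
    and F: "\<And>z. cmod (F z) \<le> K" "\<And>z w. cmod (F z - F w) \<le> \<epsilon> + C * (cmod (z - w))\<^sup>2" "\<epsilon> \<ge> 0" "C \<ge> 0"
  shows "cmod ((\<Sum>i<n. F (z i)) - of_real q * (\<Sum>\<alpha>\<in>T. F (w \<alpha>))) \<le> K * (real n - q * card T) + \<epsilon> * n + C * R"
proof -
  define s where "s i = (\<Sum>\<alpha>\<in>T. p \<alpha> i)" for i
  have sum_s: "(\<Sum>i<n. s i) = q * card T"
    unfolding s_def by (subst sum.swap) (simp add: p(3))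
  have "of_real q * (\<Sum>\<alpha>\<in>T. F (w \<alpha>)) = (\<Sum>\<alpha>\<in>T. (\<Sum>i<n. of_real (p \<alpha> i)) * F (w \<alpha>))"
    unfolding sum_distrib_left by (intro sum.cong refl) (simp add: p(3) flip: of_real_sum)
  also have "\<dots> = (\<Sum>i<n. \<Sum>\<alpha>\<in>T. of_real (p \<alpha> i) * F (w \<alpha>))"
    unfolding sum_distrib_right by (rule sum.swap)
  finally have "(\<Sum>i<n. F (z i)) - of_real q * (\<Sum>\<alpha>\<in>T. F (w \<alpha>)) =
      (\<Sum>i<n. F (z i) - (\<Sum>\<alpha>\<in>T. of_real (p \<alpha> i) * F (w \<alpha>)))"
    by (simp add: sum_subtractf)
  also have "\<dots> = (\<Sum>i<n. of_real (1 - s i) * F (z i) + (\<Sum>\<alpha>\<in>T. of_real (p \<alpha> i) * (F (z i) - F (w \<alpha>))))"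
    unfolding s_def by (simp add: algebra_simps sum_subtractf sum_distrib_left)
  also have "cmod \<dots> \<le> (\<Sum>i<n. (1 - s i) * K + (\<Sum>\<alpha>\<in>T. p \<alpha> i * (\<epsilon> + C * (cmod (z i - w \<alpha>))\<^sup>2)))"
  proof (rule sum_norm_le)
    fix i assume "i \<in> {..<n}"
    then have s1: "1 - s i \<ge> 0" using p(2)[of i] by (simp add: s_def)
    have "cmod (of_real (1 - s i) * F (z i)) = (1 - s i) * cmod (F (z i))"
      using s1 by (simp only: norm_mult norm_of_real abs_of_nonneg)
    also have "\<dots> \<le> (1 - s i) * K" by (rule mult_left_mono[OF F(1) s1])
    finally have 1: "cmod (of_real (1 - s i) * F (z i)) \<le> (1 - s i) * K" .
    have 2: "cmod (\<Sum>\<alpha>\<in>T. of_real (p \<alpha> i) * (F (z i) - F (w \<alpha>))) \<le> (\<Sum>\<alpha>\<in>T. p \<alpha> i * (\<epsilon> + C * (cmod (z i - w \<alpha>))\<^sup>2))"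
      using p(1) by (intro sum_norm_le) (simp add: norm_mult mult_left_mono[OF F(2)])
    show "cmod (of_real (1 - s i) * F (z i) + (\<Sum>\<alpha>\<in>T. of_real (p \<alpha> i) * (F (z i) - F (w \<alpha>)))) \<le>
      (1 - s i) * K + (\<Sum>\<alpha>\<in>T. p \<alpha> i * (\<epsilon> + C * (cmod (z i - w \<alpha>))\<^sup>2))"
      by (rule order_trans[OF norm_triangle_ineq add_mono[OF 1 2]])
  qed
  also have "\<dots> = (\<Sum>i<n. (1 - s i) * K) + (\<Sum>i<n. \<Sum>\<alpha>\<in>T. p \<alpha> i * (\<epsilon> + C * (cmod (z i - w \<alpha>))\<^sup>2))"
    by (rule sum.distrib)
  also have "(\<Sum>i<n. (1 - s i) * K) = K * (real n - q * card T)"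
    unfolding sum_distrib_right[symmetric] by (simp add: sum_subtractf sum_s)
  also have "(\<Sum>i<n. \<Sum>\<alpha>\<in>T. p \<alpha> i * (\<epsilon> + C * (cmod (z i - w \<alpha>))\<^sup>2)) =
      \<epsilon> * (\<Sum>i<n. s i) + C * (\<Sum>i<n. \<Sum>\<alpha>\<in>T. p \<alpha> i * (cmod (z i - w \<alpha>))\<^sup>2)"
    unfolding s_def by (simp add: distrib_left sum.distrib sum_distrib_left mult_ac)
  finally have *: "cmod ((\<Sum>i<n. F (z i)) - of_real q * (\<Sum>\<alpha>\<in>T. F (w \<alpha>))) \<le> K * (real n - q * card T) +
    (\<epsilon> * (\<Sum>i<n. s i) + C * (\<Sum>i<n. \<Sum>\<alpha>\<in>T. p \<alpha> i * (cmod (z i - w \<alpha>))\<^sup>2))" .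
  have "(\<Sum>i<n. s i) \<le> (\<Sum>i<n. 1)" using p(2) by (intro sum_mono) (auto simp: s_def)
  then have 3: "\<epsilon> * (\<Sum>i<n. s i) \<le> \<epsilon> * n" using F(3) by (intro mult_left_mono) auto
  have 4: "C * (\<Sum>i<n. \<Sum>\<alpha>\<in>T. p \<alpha> i * (cmod (z i - w \<alpha>))\<^sup>2) \<le> C * R"
    using R F(4) by (subst sum.swap) (intro mult_left_mono)
  show ?thesis using * 3 4 by linarith
qed

locale sw_scheme_ordered = sw_scheme_cube \<Omega> a b c \<nu> N n M
  for \<Omega> :: "(real ^ 'd::{finite,linorder}) set" and a b c \<nu> N n M
begin

definition A :: "complex mat" where
  "A = map_mat complex_of_real ((1 / (real n)\<^sup>2) \<cdot>\<^sub>m shortley_weller_mat \<Omega> a b c N)"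

abbreviation "js \<equiv> lex_list (sw_indices \<Omega> N)"

lemma length_js: "length js = card (sw_indices \<Omega> N)"
  using lex_list_properties[OF finite_sw_indices, of \<Omega> N] distinct_card by fastforce

lemma A_carrier: "A \<in> carrier_mat (card (sw_indices \<Omega> N)) (card (sw_indices \<Omega> N))"
  unfolding A_def shortley_weller_mat_def Let_def by (simp add: length_js)

lemma A_entry:
  "p < card (sw_indices \<Omega> N) \<Longrightarrow> q < card (sw_indices \<Omega> N) \<Longrightarrow> A $$ (p, q) = of_real (entry (js ! p) (js ! q))"
  unfolding A_def shortley_weller_mat_def Let_def entry_def by (simp add: length_js)

lemma bij_js: "bij_betw ((!) js) {..<card (sw_indices \<Omega> N)} (sw_indices \<Omega> N)"
  using bij_betw_nth[OF lex_list_properties(1)[OF finite_sw_indices, of \<Omega> N] refl] lex_list_properties(2)[OF finite_sw_indices, of \<Omega> N]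
  by (simp add: length_js)

lemma sum_js: "(\<Sum>p<card (sw_indices \<Omega> N). f (js ! p)) = (\<Sum>j\<in>sw_indices \<Omega> N. f j)"
  by (rule sum.reindex_bij_betw[OF bij_js])

text \<open>Packets sit on good base points, whereas the Riemann sum runs over all grid points;
  \<open>K * bad\<close> is paid once for the missing mass and once for completing the sum. The
  factor \<open>4 * CARD('d)\<close> is the 2 of \<open>eigenvalue_weights\<close> times the
  \<open>2 * CARD('d)\<close> of \<open>asymmetry_sum\<close>. The set counted by \<open>bad\<close>
  is phrased with Euclidean balls, a form in which its density can be shown to vanish.\<close>

lemma eigenvalue_sum_estimate:
  assumes Q: "Q > 0" and M: "M \<ge> 0" and \<delta>: "\<delta> \<ge> 0"
    and r: "(\<Sum>i\<in>UNIV. (2 * real Q + 1) * sw_step N i) \<le> r"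
    and dev: "\<And>i x y. x \<in> interior \<Omega> \<Longrightarrow> y \<in> interior \<Omega> \<Longrightarrow> dist x y \<le> r \<Longrightarrow> \<bar>a i x - a i y\<bar> \<le> \<delta>"
    and F: "\<And>z. cmod (F z) \<le> K" "\<And>z w. cmod (F z - F w) \<le> \<epsilon> + C * (cmod (z - w))\<^sup>2" "\<epsilon> \<ge> 0" "C \<ge> 0"
  defines "s \<equiv> real (card (sw_indices \<Omega> N))"
    and "bad \<equiv> real (card {m \<in> sw_indices \<Omega> N. \<not> cball (sw_point N m) r \<subseteq> interior \<Omega>})"
  shows "cmod ((\<Sum>z\<in>#eigenvalues_mset A. F z) - (\<Sum>m\<in>sw_indices \<Omega> N. \<Sum>k\<in>lattice_box (\<lambda>_. {- int Q..<int Q}).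
      F (of_real (sw_symbol \<nu> a (sw_point N m) ((pi / Q) *\<^sub>R k)))) / of_nat ((2 * Q) ^ CARD('d))) \<le>
    2 * K * bad + \<epsilon> * s + C * (2 * (s * residual_bound Q \<delta>) + 4 * CARD('d) * (s * (offdiag_bound / n)\<^sup>2 + bad * (2 * offdiag_bound)\<^sup>2))"
proof -
  let ?S = "sw_indices \<Omega> N" and ?Kf = "lattice_box (\<lambda>_::'d. {- int Q..<int Q})"
  let ?G = "good (2 * Q)" and ?N = "(2 * Q) ^ CARD('d)"
  let ?n = "card ?S"
  define q where "q = 1 / real ?N"
  have N0: "real ?N > 0" using Q by simp
  have finG: "finite ?G" using finite_subset[OF good_subset finite_sw_indices] .
  have finK: "finite ?Kf" by (intro finite_lattice_box) simp
  have K0: "K \<ge> 0" using order_trans[OF norm_ge_zero F(1)[of 0]] .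
  \<comment> \<open>The Euclidean norm is at most the sum of the coordinates, so the ball of radius
    \<open>r\<close> contains the cube used in \<open>good\<close>.\<close>
  have close: "dist y (sw_point N m) \<le> r" if "\<And>i. \<bar>y $ i - sw_point N m $ i\<bar> \<le> (2 * real Q + 1) * sw_step N i" for y m
  proof -
    have "dist y (sw_point N m) \<le> (\<Sum>i\<in>UNIV. \<bar>(y - sw_point N m) $ i\<bar>)"
      unfolding dist_norm by (rule norm_le_l1_cart)
    also have "\<dots> \<le> (\<Sum>i\<in>UNIV. (2 * real Q + 1) * sw_step N i)"
      using that by (intro sum_mono) simp
    finally show ?thesis using r by simp
  qed
  have bad_le: "real (card (?S - ?G)) \<le> bad"
  proof -
    have "?S - ?G \<subseteq> {m \<in> ?S. \<not> cball (sw_point N m) r \<subseteq> interior \<Omega>}"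
    proof (safe)
      fix m assume m: "m \<in> ?S" "m \<notin> ?G" and sub: "cball (sw_point N m) r \<subseteq> interior \<Omega>"
      have "y \<in> interior \<Omega>" if "\<forall>i. \<bar>y $ i - sw_point N m $ i\<bar> \<le> (real (2 * Q) + 1) * sw_step N i" for y
        using close[of y m] that sub by (auto simp: dist_commute subset_iff)
      then show False using m by (auto simp: good_def)
    qed
    then show ?thesis unfolding bad_def using finite_sw_indices[of \<Omega> N] by (intro of_nat_mono card_mono) auto
  qed
  have dev': "\<bar>a i (sw_point N (m + t)) - a i (sw_point N m)\<bar> \<le> \<delta>"
    if m: "m \<in> ?G" and t: "\<And>i. \<bar>t $ i\<bar> \<le> real (2 * Q) + 1" for m t i
  proof (rule dev)
    show "sw_point N (m + t) \<in> interior \<Omega>" by (rule good_interior[OF m t])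
    show "sw_point N m \<in> interior \<Omega>" using m by (simp add: good_def sw_indices_def)
    show "dist (sw_point N (m + t)) (sw_point N m) \<le> r"
    proof (rule close)
      fix i show "\<bar>sw_point N (m + t) $ i - sw_point N m $ i\<bar> \<le> (2 * real Q + 1) * sw_step N i"
        using mult_right_mono[OF t[of i], of "sw_step N i"] step_pos[of i]
        by (simp add: sw_point_def algebra_simps abs_mult)
    qed
  qed
  obtain es where es: "char_poly A = (\<Prod>e\<leftarrow>es. [:- e, 1:])" "length es = ?n"
    using char_poly_factorized[OF A_carrier] by blast
  define g where "g \<alpha> p = wave_packet Q (fst \<alpha>) (snd \<alpha>) (js ! p)" for \<alpha> :: "_ \<times> _" and p
  define \<kappa> where "\<kappa> \<alpha> = complex_of_real (mode_symbol Q (sw_point N (fst \<alpha>)) (snd \<alpha>))" for \<alpha> :: "_ \<times> _"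
  have bessel: "(\<Sum>\<alpha>\<in>?G \<times> ?Kf. (cmod (cdot ?n (g \<alpha>) w))\<^sup>2) \<le> (\<Sum>p<?n. (cmod (w p))\<^sup>2)" for w
  proof -
    \<comment> \<open>\<open>wave_packet_bessel\<close> is about functions of grid points;
      \<open>w\<close> is carried over along the inverse of the enumeration
      \<open>js\<close>.\<close>
    define w' where "w' j = w (the_inv_into {..<?n} ((!) js) j)" for j
    have w': "w' (js ! p) = w p" if "p < ?n" for p
      using that bij_js by (simp add: w'_def the_inv_into_f_f bij_betw_def)
    have "cdot ?n (g \<alpha>) w = (\<Sum>j\<in>?S. cnj (wave_packet Q (fst \<alpha>) (snd \<alpha>) j) * w' j)" for \<alpha>
      unfolding cdot_def g_def sum_js[symmetric] by (intro sum.cong refl) (simp add: w')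
    then have "(\<Sum>\<alpha>\<in>?G \<times> ?Kf. (cmod (cdot ?n (g \<alpha>) w))\<^sup>2) =
        (\<Sum>m\<in>?G. \<Sum>k\<in>?Kf. (cmod (\<Sum>j\<in>?S. cnj (wave_packet Q m k j) * w' j))\<^sup>2)"
      by (simp add: sum.cartesian_product split_beta)
    also have "\<dots> \<le> (\<Sum>j\<in>?S. (cmod (w' j))\<^sup>2)"
      by (rule wave_packet_bessel[OF Q finite_sw_indices finG good_box])
    also have "\<dots> = (\<Sum>p<?n. (cmod (w p))\<^sup>2)"
      unfolding sum_js[symmetric] by (intro sum.cong refl) (simp add: w')
    finally show ?thesis .
  qed
  from eigenvalue_weights[OF A_carrier es(1), where S = "?G \<times> ?Kf" and g = g and \<kappa> = \<kappa>, OF bessel]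
  obtain p where p: "\<forall>\<alpha> i. 0 \<le> p \<alpha> i" "\<forall>i<?n. (\<Sum>\<alpha>\<in>?G \<times> ?Kf. p \<alpha> i) \<le> 1"
     "\<forall>\<alpha>. (\<Sum>i<?n. p \<alpha> i) = (\<Sum>j<?n. (cmod (g \<alpha> j))\<^sup>2)"
     "(\<Sum>\<alpha>\<in>?G \<times> ?Kf. \<Sum>i<?n. p \<alpha> i * (cmod (es ! i - \<kappa> \<alpha>))\<^sup>2) \<le>
       2 * (\<Sum>\<alpha>\<in>?G \<times> ?Kf. \<Sum>k<?n. (cmod ((\<Sum>j<?n. cnj (g \<alpha> j) * A $$ (j,k)) - \<kappa> \<alpha> * cnj (g \<alpha> k)))\<^sup>2) +
       2 * (\<Sum>j<?n. \<Sum>k<?n. (cmod (A $$ (j,k) - cnj (A $$ (k,j))))\<^sup>2)"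
    by (elim exE conjE) (rule that; assumption)
  have sum_p: "(\<Sum>i<?n. p \<alpha> i) = q" if "\<alpha> \<in> ?G \<times> ?Kf" for \<alpha>
  proof -
    have "(\<Sum>i<?n. p \<alpha> i) = (\<Sum>j\<in>?S. (cmod (wave_packet Q (fst \<alpha>) (snd \<alpha>) j))\<^sup>2)"
      using p(3)[rule_format, of \<alpha>] unfolding g_def by (simp only: sum_js[of "\<lambda>j. (cmod (wave_packet Q _ _ j))\<^sup>2"])
    also have "\<dots> = q" unfolding q_def
      using that by (intro wave_packet_norm_sq finite_sw_indices good_box Q) auto
    finally show ?thesis .
  qed
  have asym: "(\<Sum>j<?n. \<Sum>k<?n. (cmod (A $$ (j,k) - cnj (A $$ (k,j))))\<^sup>2) \<le>
    2 * CARD('d) * (s * (offdiag_bound / n)\<^sup>2 + bad * (2 * offdiag_bound)\<^sup>2)"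
  proof -
    have "(\<Sum>j<?n. \<Sum>k<?n. (cmod (A $$ (j,k) - cnj (A $$ (k,j))))\<^sup>2) =
      (\<Sum>p<?n. \<Sum>q<?n. (entry (js ! p) (js ! q) - entry (js ! q) (js ! p))\<^sup>2)"
      by (intro sum.cong refl) (simp add: A_entry norm_of_real flip: of_real_diff)
    also have "\<dots> = (\<Sum>j\<in>?S. \<Sum>k\<in>?S. (entry j k - entry k j)\<^sup>2)"
      by (simp only: sum_js[of "\<lambda>k. (entry (js ! _) k - entry k (js ! _))\<^sup>2"] sum_js[of "\<lambda>j. \<Sum>k\<in>?S. (entry j k - entry k j)\<^sup>2"])
    also have "\<dots> \<le> 2 * CARD('d) * (card ?S * (offdiag_bound / n)\<^sup>2 + card (?S - ?G) * (2 * offdiag_bound)\<^sup>2)"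
      using Q by (intro asymmetry_sum) simp
    also have "\<dots> \<le> 2 * CARD('d) * (s * (offdiag_bound / n)\<^sup>2 + bad * (2 * offdiag_bound)\<^sup>2)"
      unfolding s_def using bad_le by (intro mult_left_mono add_left_mono mult_right_mono) auto
    finally show ?thesis .
  qed
  have res: "(\<Sum>\<alpha>\<in>?G \<times> ?Kf. \<Sum>k<?n. (cmod ((\<Sum>j<?n. cnj (g \<alpha> j) * A $$ (j,k)) - \<kappa> \<alpha> * cnj (g \<alpha> k)))\<^sup>2) \<le> s * residual_bound Q \<delta>"
  proof -
    have rb: "residual_bound Q \<delta> \<ge> 0" unfolding residual_bound_def by simp
    have "(\<Sum>\<alpha>\<in>?G \<times> ?Kf. \<Sum>k<?n. (cmod ((\<Sum>j<?n. cnj (g \<alpha> j) * A $$ (j,k)) - \<kappa> \<alpha> * cnj (g \<alpha> k)))\<^sup>2) \<le>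
      (\<Sum>\<alpha>\<in>?G \<times> ?Kf. residual_bound Q \<delta> / real ?N)"
    proof (rule sum_mono)
      fix \<alpha> assume \<alpha>: "\<alpha> \<in> ?G \<times> ?Kf"
      obtain m k where mk: "\<alpha> = (m, k)" by fastforce
      have "(\<Sum>q<?n. (cmod ((\<Sum>j<?n. cnj (g \<alpha> j) * A $$ (j,q)) - \<kappa> \<alpha> * cnj (g \<alpha> q)))\<^sup>2) =
        (\<Sum>q<?n. (cmod ((\<Sum>p<?n. cnj (wave_packet Q m k (js ! p)) * of_real (entry (js ! p) (js ! q)))
           - of_real (mode_symbol Q (sw_point N m) k) * cnj (wave_packet Q m k (js ! q))))\<^sup>2)"
        by (intro sum.cong refl arg_cong[where f = "\<lambda>x. (cmod x)\<^sup>2"] arg_cong2[where f = "(-)"])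
          (simp_all add: A_entry g_def \<kappa>_def mk)
      also have "\<dots> = (\<Sum>l\<in>?S. (cmod (packet_residual Q m k l))\<^sup>2)"
        by (simp only: sum_js[of "\<lambda>j. cnj (wave_packet Q m k j) * of_real (entry j _)"]
            packet_residual_def[symmetric] sum_js[of "\<lambda>l. (cmod (packet_residual Q m k l))\<^sup>2"])
      also have "\<dots> \<le> residual_bound Q \<delta> / real ?N"
        using \<alpha> mk by (intro residual_le Q M \<delta> dev') auto
      finally show "(\<Sum>q<?n. (cmod ((\<Sum>j<?n. cnj (g \<alpha> j) * A $$ (j,q)) - \<kappa> \<alpha> * cnj (g \<alpha> q)))\<^sup>2) \<le> residual_bound Q \<delta> / real ?N" .
    qed
    also have "\<dots> = card ?G * residual_bound Q \<delta>"
      using Q by (simp add: card_cartesian_product card_freq_box)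
    also have "\<dots> \<le> s * residual_bound Q \<delta>"
      unfolding s_def using card_mono[OF finite_sw_indices good_subset] rb by (intro mult_right_mono) auto
    finally show ?thesis .
  qed
  have R: "(\<Sum>\<alpha>\<in>?G \<times> ?Kf. \<Sum>i<?n. p \<alpha> i * (cmod (es ! i - \<kappa> \<alpha>))\<^sup>2) \<le>
    2 * (s * residual_bound Q \<delta>) + 4 * CARD('d) * (s * (offdiag_bound / n)\<^sup>2 + bad * (2 * offdiag_bound)\<^sup>2)"
    using p(4) res asym by simp
  have eig: "(\<Sum>z\<in>#eigenvalues_mset A. F z) = (\<Sum>i<?n. F (es ! i))"
  proof -
    have "(\<Sum>z\<in>#eigenvalues_mset A. F z) = sum_list (map F es)"
      unfolding eigenvalues_mset_def es(1) proots_linear_factors by (simp flip: mset_map sum_mset_sum_list)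
    also have "\<dots> = (\<Sum>i<?n. F (es ! i))"
      by (simp add: sum_list_sum_nth es(2) lessThan_atLeast0)
    finally show ?thesis .
  qed
  \<comment> \<open>A base point carries as many frequencies as its cube has points, each of weight
    \<open>q\<close>, so its total mass is 1.\<close>
  have cardT: "q * card (?G \<times> ?Kf) = card ?G"
    using Q by (simp add: q_def card_cartesian_product card_freq_box)
  have G_le: "card ?G \<le> ?n" by (rule card_mono[OF finite_sw_indices good_subset])
  have "real ?n - real (card ?G) = real (card (?S - ?G))"
    using G_le by (simp add: card_Diff_subset[OF finG good_subset] of_nat_diff)
  then have nG: "real ?n - real (card ?G) \<le> bad" using bad_le by simp
  have est: "cmod ((\<Sum>i<?n. F (es ! i)) - of_real q * (\<Sum>\<alpha>\<in>?G \<times> ?Kf. F (\<kappa> \<alpha>))) \<le>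
    K * (real ?n - q * card (?G \<times> ?Kf)) + \<epsilon> * ?n + C * (2 * (s * residual_bound Q \<delta>) + 4 * CARD('d) * (s * (offdiag_bound / n)\<^sup>2 + bad * (2 * offdiag_bound)\<^sup>2))"
    by (rule weighted_average_estimate[where p = p, OF finite_cartesian_product[OF finG finK] _ _ sum_p R F])
      (use p in auto)
  define f where "f m = (\<Sum>k\<in>?Kf. F (of_real (sw_symbol \<nu> a (sw_point N m) ((pi / Q) *\<^sub>R k))))" for m
  have sumG: "of_real q * (\<Sum>\<alpha>\<in>?G \<times> ?Kf. F (\<kappa> \<alpha>)) = (\<Sum>m\<in>?G. f m) / of_nat ?N"
    unfolding f_def \<kappa>_def mode_symbol_eq q_def by (simp add: sum.cartesian_product split_beta)
  have f_le: "cmod (f m) \<le> K * real ?N" for m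
  proof -
    have "cmod (f m) \<le> real (card ?Kf) * K"
      unfolding f_def by (intro sum_norm_bound F(1))
    then show ?thesis by (simp add: card_freq_box mult.commute)
  qed
  have "(\<Sum>m\<in>?S. f m) - (\<Sum>m\<in>?G. f m) = (\<Sum>m\<in>?S - ?G. f m)"
    by (simp add: sum_diff[OF finite_sw_indices good_subset])
  then have "cmod ((\<Sum>m\<in>?G. f m) / of_nat ?N - (\<Sum>m\<in>?S. f m) / of_nat ?N) = cmod (\<Sum>m\<in>?S - ?G. f m) / real ?N"
    by (simp add: norm_divide norm_mult norm_power norm_minus_commute flip: diff_divide_distrib)
  also have "\<dots> \<le> real (card (?S - ?G)) * (K * real ?N) / real ?N"
    by (intro divide_right_mono sum_norm_bound f_le) simp
  also have "\<dots> = K * real (card (?S - ?G))" using Q by simp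
  also have "\<dots> \<le> K * bad" by (intro mult_left_mono bad_le K0)
  finally have diff: "cmod ((\<Sum>m\<in>?G. f m) / of_nat ?N - (\<Sum>m\<in>?S. f m) / of_nat ?N) \<le> K * bad" .
  have "K * (real ?n - real (card ?G)) \<le> K * bad" by (intro mult_left_mono nG K0)
  then have "cmod ((\<Sum>i<?n. F (es ! i)) - (\<Sum>m\<in>?G. f m) / of_nat ?N) \<le>
    K * bad + \<epsilon> * s + C * (2 * (s * residual_bound Q \<delta>) + 4 * CARD('d) * (s * (offdiag_bound / n)\<^sup>2 + bad * (2 * offdiag_bound)\<^sup>2))"
    using est unfolding cardT sumG s_def by linarith
  with diff have "cmod ((\<Sum>i<?n. F (es ! i)) - (\<Sum>m\<in>?S. f m) / of_nat ?N) \<le>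
    2 * K * bad + \<epsilon> * s + C * (2 * (s * residual_bound Q \<delta>) + 4 * CARD('d) * (s * (offdiag_bound / n)\<^sup>2 + bad * (2 * offdiag_bound)\<^sup>2))"
    using norm_triangle_ineq[of "(\<Sum>i<?n. F (es ! i)) - (\<Sum>m\<in>?G. f m) / of_nat ?N" "(\<Sum>m\<in>?G. f m) / of_nat ?N - (\<Sum>m\<in>?S. f m) / of_nat ?N"]
    by simp
  then show ?thesis unfolding eig f_def .
qed

end

subsection \<open>Limits along the grid sequence\<close>

text \<open>Reduces limits within \<open>I\<close> to ordinary sequences, for which dominated
  convergence is stated. As \<open>enumerate\<close> is strictly increasing, a large member of
  \<open>I\<close> has a large position.\<close>

lemma filterlim_enumerate:
  assumes I: "infinite (I :: nat set)" and f: "filterlim (\<lambda>k. f (enumerate I k)) F sequentially"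
  shows "filterlim f F (inf sequentially (principal I))"
  unfolding filterlim_iff
proof (intro allI impI)
  fix P assume "eventually P F"
  with f have "eventually (\<lambda>k. P (f (enumerate I k))) sequentially" by (auto simp: filterlim_iff)
  then obtain k0 where k0: "\<And>k. k \<ge> k0 \<Longrightarrow> P (f (enumerate I k))" by (auto simp: eventually_sequentially)
  have "P (f n)" if n: "n \<ge> enumerate I k0" "n \<in> I" for n
  proof -
    obtain k where k: "n = enumerate I k" using n(2) range_enumerate[OF I] by auto
    have "k \<ge> k0"
    proof (rule ccontr)
      assume "\<not> k \<ge> k0"
      then have "enumerate I k < enumerate I k0" using I by (intro enumerate_mono) auto
      then show False using n k by simp
    qed
    then show ?thesis using k0 k by simp
  qed
  then show "eventually (\<lambda>x. P (f x)) (inf sequentially (principal I))"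
    unfolding eventually_inf_principal eventually_sequentially by (intro exI[of _ "enumerate I k0"]) auto
qed

text \<open>Close pairs are handled by uniform continuity with error \<open>\<epsilon>\<close>; for
  pairs at distance at least \<open>d\<close> the trivial bound \<open>2 * K\<close> is at most
  \<open>2 * K / d^2\<close> times the squared distance.\<close>

lemma compact_support_bounds:
  fixes F :: "complex \<Rightarrow> complex"
  assumes cont: "continuous_on UNIV F" and supp: "compact (closure {z. F z \<noteq> 0})"
  obtains K where "\<And>z. cmod (F z) \<le> K"
    and "\<And>\<epsilon>. \<epsilon> > 0 \<Longrightarrow> \<exists>C\<ge>0. \<forall>z w. cmod (F z - F w) \<le> \<epsilon> + C * (cmod (z - w))\<^sup>2"
proof -
  have "bounded (closure {z. F z \<noteq> 0})" using supp by (rule compact_imp_bounded)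
  then obtain R where R: "\<And>z. z \<in> closure {z. F z \<noteq> 0} \<Longrightarrow> cmod z \<le> R" by (auto simp: bounded_iff)
  have zero: "F z = 0" if "cmod z > R" for z
    using R[of z] that closure_subset[of "{z. F z \<noteq> 0}"] by force
  have "compact (F ` cball 0 R)"
    by (intro compact_continuous_image continuous_on_subset[OF cont]) auto
  then have "bounded (F ` cball 0 R)" by (rule compact_imp_bounded)
  then obtain K0 where "\<forall>y\<in>F ` cball 0 R. cmod y \<le> K0" unfolding bounded_iff by blast
  then have K0: "cmod (F z) \<le> K0" if "z \<in> cball 0 R" for z using that by blast
  define K where "K = max K0 0"
  have K: "cmod (F z) \<le> K" for z
    using K0[of z] zero[of z] by (cases "cmod z \<le> R") (auto simp: K_def)
  have K_nonneg: "K \<ge> 0" by (simp add: K_def)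
  have "\<exists>C\<ge>0. \<forall>z w. cmod (F z - F w) \<le> \<epsilon> + C * (cmod (z - w))\<^sup>2" if \<epsilon>: "\<epsilon> > 0" for \<epsilon>
  proof -
    have "uniformly_continuous_on (cball 0 (R + 1)) F"
      by (intro compact_uniformly_continuous continuous_on_subset[OF cont]) auto
    then obtain d0 where d0: "d0 > 0"
      "\<And>z w. z \<in> cball 0 (R + 1) \<Longrightarrow> w \<in> cball 0 (R + 1) \<Longrightarrow> dist w z < d0 \<Longrightarrow> dist (F w) (F z) < \<epsilon>"
      using \<epsilon> unfolding uniformly_continuous_on_def by metis
    \<comment> \<open>With \<open>d \<le> 1\<close>, a pair closer than \<open>d\<close> lies either
      entirely in the larger ball or entirely outside the support.\<close>
    define d where "d = min d0 1"
    have d: "d > 0" using d0(1) by (simp add: d_def)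
    have "cmod (F z - F w) \<le> \<epsilon> + 2 * K / d\<^sup>2 * (cmod (z - w))\<^sup>2" for z w
    proof (cases "cmod (z - w) < d")
      case True
      have "cmod (F z - F w) \<le> \<epsilon>"
      proof (cases "z \<in> cball 0 (R + 1) \<and> w \<in> cball 0 (R + 1)")
        case T: True
        then show ?thesis using d0(2)[of w z] True by (simp add: dist_norm d_def)
      next
        case False
        have "cmod z \<le> cmod w + cmod (z - w)" "cmod w \<le> cmod z + cmod (z - w)"
          using norm_triangle_ineq[of w "z - w"] norm_triangle_ineq[of z "w - z"] by (simp_all add: norm_minus_commute)
        then have "cmod z > R \<and> cmod w > R" using False True by (auto simp: d_def)
        then show ?thesis using zero \<epsilon> by simp
      qed
      moreover have "0 \<le> 2 * K / d\<^sup>2 * (cmod (z - w))\<^sup>2" using K_nonneg by simp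
      ultimately show ?thesis by linarith
    next
      case False
      then have "d\<^sup>2 \<le> (cmod (z - w))\<^sup>2" using d by (intro power_mono) auto
      then have "2 * K / d\<^sup>2 * d\<^sup>2 \<le> 2 * K / d\<^sup>2 * (cmod (z - w))\<^sup>2"
        using K_nonneg by (intro mult_left_mono) auto
      then have "2 * K \<le> 2 * K / d\<^sup>2 * (cmod (z - w))\<^sup>2" using d by simp
      moreover have "cmod (F z - F w) \<le> 2 * K" using norm_triangle_ineq4[of "F z" "F w"] K[of z] K[of w] by linarith
      ultimately show ?thesis using \<epsilon> by linarith
    qed
    moreover have "2 * K / d\<^sup>2 \<ge> 0" using K_nonneg by simp
    ultimately show ?thesis by blast
  qed
  with K show ?thesis by (rule that)
qed

lemma sw_point_eq_grid_point: "sw_point N j = grid_point (sw_step N) j"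
  by (simp add: sw_point_def grid_point_def)

section \<open>Riemann sums over the interior of the domain\<close>

text \<open>\<open>n\<close> is any sequence of scaling parameters tending to infinity, later the
  enumeration of the admissible ones. \<open>M\<close> does not depend on \<open>k\<close>, so all
  estimates are uniform.\<close>

locale sw_sequence =
  fixes \<Omega> :: "(real ^ 'd::{finite,linorder}) set" and a b c \<nu> and N :: "nat \<Rightarrow> nat ^ 'd::{finite,linorder}" and n :: "nat \<Rightarrow> nat" and M
  assumes scheme: "\<And>k. sw_scheme_ordered \<Omega> a b c \<nu> (N k) (n k) M"
    and n_top: "filterlim n at_top sequentially"
    and closed: "closed \<Omega>" and frontier: "emeasure lborel (frontier \<Omega>) = 0"
    and a_cont: "\<And>i. continuous_on \<Omega> (a i)"
    and pos: "measure lborel (interior \<Omega>) > 0" and M: "M \<ge> 0"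
begin

abbreviation "S k \<equiv> sw_indices \<Omega> (N k)"
abbreviation "vol k \<equiv> \<Prod>i\<in>UNIV. sw_step (N k) i"

lemma step: "sw_step (N k) i > 0" "sw_step (N k) i \<le> 1" "(\<lambda>k. sw_step (N k) i) \<longlonglongrightarrow> 0"
proof -
  interpret s: sw_scheme_ordered \<Omega> a b c \<nu> "N k" "n k" M for k by (rule scheme)
  show "sw_step (N k) i > 0" by (rule s.step_pos)
  show "sw_step (N k) i \<le> 1" by (simp add: sw_step_def)
  have "filterlim (\<lambda>k. real (n k)) at_top sequentially"
    by (rule filterlim_compose[OF filterlim_real_sequentially n_top])
  then have "filterlim (\<lambda>k. \<nu> $ i * real (n k)) at_top sequentially"
    using s.\<nu>[of i] by (intro filterlim_tendsto_pos_mult_at_top[OF tendsto_const]) auto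
  then have "(\<lambda>k. inverse (\<nu> $ i * real (n k))) \<longlonglongrightarrow> 0"
    by (rule tendsto_inverse_0_at_top)
  then show "(\<lambda>k. sw_step (N k) i) \<longlonglongrightarrow> 0"
    by (simp add: s.sw_step_eq divide_inverse mult.commute)
qed

lemma vol_pos: "vol k > 0"
  using step(1) by (intro prod_pos) auto

lemma S_iff: "(\<forall>i. j $ i \<in> \<int>) \<Longrightarrow> j \<in> S k \<longleftrightarrow> sw_point (N k) j \<in> interior \<Omega>"
  using sw_scheme_cube.in_sw_indices[of \<Omega> a b c \<nu> "N k" "n k" M j] scheme[of k]
  by (auto simp: sw_scheme_ordered_def sw_indices_def)

lemma S_int: "j \<in> S k \<Longrightarrow> \<forall>i. j $ i \<in> \<int>"
  by (simp add: sw_indices_def)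

lemma interior_bounded: "x \<in> interior \<Omega> \<Longrightarrow> \<forall>i. \<bar>x $ i\<bar> \<le> 1"
  using scheme[of 0] interior_subset[of \<Omega>]
  by (auto simp: sw_scheme_ordered_def sw_scheme_cube_def sw_scheme_cube_axioms_def subset_iff abs_le_iff)

lemma AE_not_frontier: "AE x in lborel. x \<notin> frontier \<Omega>"
  by (rule AE_I[where N = "frontier \<Omega>"]) (auto simp: frontier)

text \<open>Off the null frontier a point lies in the open interior or in the open complement of the
  closed domain, so the rounded point is eventually on the same side and the indicators
  converge.\<close>

lemma riemann_interior:
  fixes f :: "nat \<Rightarrow> real ^ 'd::{finite,linorder} \<Rightarrow> complex"
  assumes bound: "\<And>k x. x \<in> interior \<Omega> \<Longrightarrow> cmod (f k x) \<le> K"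
    and g: "(\<lambda>x. indicator (interior \<Omega>) x *\<^sub>R g x) \<in> borel_measurable borel"
    and lim: "\<And>x. x \<in> interior \<Omega> \<Longrightarrow> (\<lambda>k. f k (grid_floor (sw_step (N k)) x)) \<longlonglongrightarrow> g x"
  shows "(\<lambda>k. of_real (vol k) * (\<Sum>j\<in>S k. f k (sw_point (N k) j))) \<longlonglongrightarrow> (\<integral>x. indicator (interior \<Omega>) x *\<^sub>R g x \<partial>lborel)"
proof -
  have fl: "(\<lambda>k. grid_floor (sw_step (N k)) x) \<longlonglongrightarrow> x" for x
    by (rule grid_floor_tendsto) (rule step)+
  have "(\<lambda>k. of_real (vol k) * (\<Sum>j\<in>S k. (\<lambda>x. indicator (interior \<Omega>) x *\<^sub>R f k x) (grid_point (sw_step (N k)) j)))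
     \<longlonglongrightarrow> (\<integral>x. indicator (interior \<Omega>) x *\<^sub>R g x \<partial>lborel)"
  proof (rule riemann_sum_tendsto[where H = 1 and R = 1 and M = "max K 0"])
    show "sw_step (N k) i > 0" "sw_step (N k) i \<le> 1" "(\<lambda>k. sw_step (N k) i) \<longlonglongrightarrow> 0" for k i by (rule step)+
    show "finite (S k)" for k by (rule finite_sw_indices)
    show "\<forall>i. j $ i \<in> \<int>" if "j \<in> S k" for k j using that by (rule S_int)
    show "j \<in> S k" if "\<forall>i. j $ i \<in> \<int>" "indicator (interior \<Omega>) (grid_point (sw_step (N k)) j) *\<^sub>R f k (grid_point (sw_step (N k)) j) \<noteq> 0" for k j
      using that S_iff[of j k] by (auto simp: sw_point_eq_grid_point indicator_def split: if_splits)
    show "cmod (indicator (interior \<Omega>) x *\<^sub>R f k x) \<le> max K 0" for k x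
      using bound[of x k] by (auto simp: indicator_def le_max_iff_disj)
    show "\<forall>i. \<bar>x $ i\<bar> \<le> 1" if "indicator (interior \<Omega>) x *\<^sub>R f k x \<noteq> 0" for k x
      using that interior_bounded[of x] by (auto simp: indicator_def split: if_splits)
    show "(\<lambda>x. indicator (interior \<Omega>) x *\<^sub>R g x) \<in> borel_measurable borel" by (rule g)
    show "AE x in lborel. (\<lambda>k. indicator (interior \<Omega>) (grid_floor (sw_step (N k)) x) *\<^sub>R f k (grid_floor (sw_step (N k)) x)) \<longlonglongrightarrow>
      indicator (interior \<Omega>) x *\<^sub>R g x"
      using AE_not_frontier
    proof eventually_elim
      case (elim x)
      show ?case
      proof (cases "x \<in> interior \<Omega>")
        case True
        have "eventually (\<lambda>k. grid_floor (sw_step (N k)) x \<in> interior \<Omega>) sequentially"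
          by (rule topological_tendstoD[OF fl open_interior True])
        then have "eventually (\<lambda>k. f k (grid_floor (sw_step (N k)) x) = indicator (interior \<Omega>) (grid_floor (sw_step (N k)) x) *\<^sub>R f k (grid_floor (sw_step (N k)) x)) sequentially"
          by eventually_elim simp
        from Lim_transform_eventually[OF lim[OF True] this] show ?thesis using True by simp
      next
        case False
        then have "x \<in> - \<Omega>" using elim closed by (auto simp: frontier_def)
        then have "eventually (\<lambda>k. grid_floor (sw_step (N k)) x \<in> - \<Omega>) sequentially"
          using closed by (intro topological_tendstoD[OF fl]) auto
        then have "eventually (\<lambda>k. indicator (interior \<Omega>) (grid_floor (sw_step (N k)) x) *\<^sub>R f k (grid_floor (sw_step (N k)) x) = 0) sequentially"
          by eventually_elim (use interior_subset[of \<Omega>] in \<open>auto simp: indicator_def\<close>)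
        then show ?thesis using False by (simp add: tendsto_eventually)
      qed
    qed
  qed
  moreover have "(\<Sum>j\<in>S k. (\<lambda>x. indicator (interior \<Omega>) x *\<^sub>R f k x) (grid_point (sw_step (N k)) j)) = (\<Sum>j\<in>S k. f k (sw_point (N k) j))" for k
    by (intro sum.cong refl) (simp add: sw_indices_def sw_point_eq_grid_point[symmetric])
  ultimately show ?thesis by simp
qed

lemma riemann_interior_continuous:
  fixes g :: "real ^ 'd::{finite,linorder} \<Rightarrow> complex"
  assumes g: "continuous_on (interior \<Omega>) g" and bound: "\<And>x. x \<in> interior \<Omega> \<Longrightarrow> cmod (g x) \<le> K"
  shows "(\<lambda>k. of_real (vol k) * (\<Sum>j\<in>S k. g (sw_point (N k) j))) \<longlonglongrightarrow> (\<integral>x. indicator (interior \<Omega>) x *\<^sub>R g x \<partial>lborel)"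
proof (rule riemann_interior[OF bound])
  show "(\<lambda>x. indicator (interior \<Omega>) x *\<^sub>R g x) \<in> borel_measurable borel"
    by (rule borel_measurable_continuous_on_indicator[OF _ g]) simp
  fix x assume x: "x \<in> interior \<Omega>"
  have "isCont g x" using g x by (simp add: continuous_on_eq_continuous_at)
  then show "(\<lambda>k. g (grid_floor (sw_step (N k)) x)) \<longlonglongrightarrow> g x"
    by (rule isCont_tendsto_compose) (rule grid_floor_tendsto; rule step)
qed

definition \<mu> :: real where "\<mu> = measure lborel (interior \<Omega>)"

lemma interior_finite: "emeasure lborel (interior \<Omega>) < \<infinity>"
  using interior_bounded
  by (intro emeasure_bounded_finite) (auto intro!: boundedI[where B = "real CARD('d)"] order_trans[OF norm_le_l1_cart] sum_bounded_above[where K = "1::real", simplified])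

lemma count_limit: "(\<lambda>k. vol k * real (card (S k))) \<longlonglongrightarrow> \<mu>"
proof -
  have "(\<integral>x. indicator (interior \<Omega>) x *\<^sub>R (1::complex) \<partial>lborel) = of_real \<mu>"
    using interior_finite by (simp add: \<mu>_def scaleR_conv_of_real)
  then have "(\<lambda>k. complex_of_real (vol k * real (card (S k)))) \<longlonglongrightarrow> of_real \<mu>"
    using riemann_interior_continuous[of "\<lambda>_. 1" 1] by (simp del: of_real_prod)
  then show ?thesis by (simp only: tendsto_of_real_iff)
qed

lemma card_S_pos: "eventually (\<lambda>k. card (S k) > 0) sequentially"
proof -
  have "eventually (\<lambda>k. vol k * real (card (S k)) > 0) sequentially"
    using order_tendstoD(1)[OF count_limit, of 0] pos by (simp add: \<mu>_def)
  then show ?thesis by eventually_elim (use vol_pos in \<open>auto simp: zero_less_mult_iff intro: Nat.gr0I\<close>)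
qed

lemma card_S_top: "filterlim (\<lambda>k. card (S k)) at_top sequentially"
proof -
  have "(\<lambda>k. vol k) \<longlonglongrightarrow> (\<Prod>i\<in>(UNIV :: 'd set). 0)"
    by (intro tendsto_prod step)
  then have "(\<lambda>k. vol k) \<longlonglongrightarrow> 0" by (simp add: zero_power)
  then have "filterlim (\<lambda>k. inverse (vol k)) at_top sequentially"
    by (rule filterlim_inverse_at_top) (intro always_eventually allI vol_pos)
  then have "filterlim (\<lambda>k. vol k * real (card (S k)) * inverse (vol k)) at_top sequentially"
    using pos by (intro filterlim_tendsto_pos_mult_at_top[OF count_limit]) (simp_all add: \<mu>_def)
  moreover have "vol k * real (card (S k)) * inverse (vol k) = real (card (S k))" for k
    using less_imp_neq[OF vol_pos[of k]] by (metis mult.assoc mult.commute mult.right_neutral right_inverse)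
  ultimately have "filterlim (\<lambda>k. real (card (S k))) at_top sequentially" by simp
  then show ?thesis by (simp add: filterlim_sequentially_iff_filterlim_real)
qed

text \<open>Dividing by \<open>count_limit\<close> replaces the cell volume by the number of grid
  points, the dimension of the matrix.\<close>

lemma average_limit:
  fixes g :: "real ^ 'd::{finite,linorder} \<Rightarrow> complex"
  assumes g: "continuous_on (interior \<Omega>) g" and bound: "\<And>x. x \<in> interior \<Omega> \<Longrightarrow> cmod (g x) \<le> K"
  shows "(\<lambda>k. (\<Sum>j\<in>S k. g (sw_point (N k) j)) / of_nat (card (S k))) \<longlonglongrightarrow> (\<integral>x. indicator (interior \<Omega>) x *\<^sub>R g x \<partial>lborel) / of_real \<mu>"
proof -
  have "(\<lambda>k. (of_real (vol k) * (\<Sum>j\<in>S k. g (sw_point (N k) j))) / of_real (vol k * real (card (S k)))) \<longlonglongrightarrow>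
    (\<integral>x. indicator (interior \<Omega>) x *\<^sub>R g x \<partial>lborel) / of_real \<mu>"
    using pos by (intro tendsto_divide riemann_interior_continuous[OF g bound] tendsto_of_real count_limit) (auto simp: \<mu>_def)
  moreover have "(of_real (vol k) * (\<Sum>j\<in>S k. g (sw_point (N k) j))) / of_real (vol k * real (card (S k))) =
    (\<Sum>j\<in>S k. g (sw_point (N k) j)) / of_nat (card (S k))" for k
  proof -
    have "complex_of_real (vol k) \<noteq> 0" using vol_pos[of k] by (simp only: of_real_eq_0_iff)
    then show ?thesis by (simp del: of_real_prod prod_zero_iff)
  qed
  ultimately show ?thesis by simp
qed

text \<open>An interior point keeps some ball inside the domain, so for shrinking radii the
  indicator of badness tends to 0 there. The null frontier enters through
  \<open>riemann_interior\<close>.\<close>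

lemma bad_limit:
  assumes r: "r \<longlonglongrightarrow> 0"
  shows "(\<lambda>k. real (card {m \<in> S k. \<not> cball (sw_point (N k) m) (r k) \<subseteq> interior \<Omega>}) / real (card (S k))) \<longlonglongrightarrow> 0"
proof -
  define f where "f k x = (if cball x (r k) \<subseteq> interior \<Omega> then 0 else 1 :: complex)" for k x
  have "(\<lambda>k. of_real (vol k) * (\<Sum>j\<in>S k. f k (sw_point (N k) j))) \<longlonglongrightarrow> (\<integral>x. indicator (interior \<Omega>) x *\<^sub>R 0 \<partial>lborel)"
  proof (rule riemann_interior[where K = 1])
    fix x assume x: "x \<in> interior \<Omega>"
    obtain e where e: "e > 0" "ball x e \<subseteq> interior \<Omega>" using x open_contains_ball[of "interior \<Omega>"] by auto
    have "(\<lambda>k. grid_floor (sw_step (N k)) x) \<longlonglongrightarrow> x"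
      by (rule grid_floor_tendsto) (rule step)+
    then have "eventually (\<lambda>k. dist (grid_floor (sw_step (N k)) x) x < e / 2) sequentially"
      using e by (intro tendstoD) auto
    moreover have "eventually (\<lambda>k. r k < e / 2) sequentially"
      using order_tendstoD(2)[OF r, of "e / 2"] e by simp
    ultimately have "eventually (\<lambda>k. f k (grid_floor (sw_step (N k)) x) = 0) sequentially"
    proof eventually_elim
      case (elim k)
      have "cball (grid_floor (sw_step (N k)) x) (r k) \<subseteq> ball x e"
      proof
        fix y assume "y \<in> cball (grid_floor (sw_step (N k)) x) (r k)"
        then show "y \<in> ball x e"
          using elim dist_triangle[of x y "grid_floor (sw_step (N k)) x"] by (simp add: dist_commute)
      qed
      then show ?case using e by (auto simp: f_def)
    qed
    then show "(\<lambda>k. f k (grid_floor (sw_step (N k)) x)) \<longlonglongrightarrow> 0" by (rule tendsto_eventually)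
  qed (auto simp: f_def)
  moreover have "(\<Sum>j\<in>S k. f k (sw_point (N k) j)) = of_nat (card {m \<in> S k. \<not> cball (sw_point (N k) m) (r k) \<subseteq> interior \<Omega>})" for k
    unfolding f_def using finite_sw_indices[of \<Omega> "N k"] by (simp add: sum.If_cases Int_def)
  ultimately have "(\<lambda>k. complex_of_real (vol k * real (card {m \<in> S k. \<not> cball (sw_point (N k) m) (r k) \<subseteq> interior \<Omega>}))) \<longlonglongrightarrow> of_real 0"
    by (simp del: of_real_prod)
  then have "(\<lambda>k. vol k * real (card {m \<in> S k. \<not> cball (sw_point (N k) m) (r k) \<subseteq> interior \<Omega>})) \<longlonglongrightarrow> 0"
    by (simp only: tendsto_of_real_iff)
  then have "(\<lambda>k. vol k * real (card {m \<in> S k. \<not> cball (sw_point (N k) m) (r k) \<subseteq> interior \<Omega>}) / (vol k * real (card (S k)))) \<longlonglongrightarrow> 0 / \<mu>"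
    using pos by (intro tendsto_divide count_limit) (auto simp: \<mu>_def)
  moreover have "vol k \<noteq> 0" for k using less_imp_neq[OF vol_pos[of k]] by (rule not_sym)
  ultimately show ?thesis by (simp del: prod_zero_iff)
qed

end

section \<open>Frequency averages and the limit of eigenvalue averages\<close>

text \<open>A cell of step \<open>pi / Suc q\<close> has, relative to the torus, exactly the volume
  \<open>1 / (2 * Suc q) ^ CARD('d)\<close>, the weight of one frequency. \<open>Suc q\<close> keeps
  the step positive.\<close>

lemma torus_riemann_sum:
  fixes G :: "real ^ 'd \<Rightarrow> complex"
  assumes G: "continuous_on UNIV G" and K: "\<And>\<theta>. cmod (G \<theta>) \<le> K"
  shows "(\<lambda>q. (\<Sum>k\<in>lattice_box (\<lambda>_. {- int (Suc q)..<int (Suc q)}). G ((pi / Suc q) *\<^sub>R k)) / of_nat ((2 * Suc q) ^ CARD('d)))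
    \<longlonglongrightarrow> (\<integral>\<theta>. indicator (cbox (\<chi> i. - pi) (\<chi> i. pi)) \<theta> *\<^sub>R G \<theta> \<partial>lborel) / of_real ((2 * pi) ^ CARD('d))"
proof -
  let ?C = "cbox (\<chi> i. - pi) (\<chi> i. pi) :: (real ^ 'd) set"
  \<comment> \<open>The frequencies sample the half-open cube; it differs from the closed one only
    by points of the frontier, a null set.\<close>
  define B where "B = {\<theta> :: real ^ 'd. \<forall>i. - pi \<le> \<theta> $ i \<and> \<theta> $ i < pi}"
  define h where "h q i = pi / real (Suc q)" for q and i :: 'd
  let ?J = "\<lambda>q. lattice_box (\<lambda>_::'d. {- int (Suc q)..<int (Suc q)})"
  have gp: "grid_point (h q) k = (pi / Suc q) *\<^sub>R k" for q k
    by (simp add: grid_point_def h_def Finite_Cartesian_Product.vec_eq_iff)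
  have B_iff: "grid_point (h q) j \<in> B \<longleftrightarrow> j \<in> ?J q" if j: "\<forall>i. j $ i \<in> \<int>" for q j
  proof -
    have "- pi \<le> grid_point (h q) j $ i \<and> grid_point (h q) j $ i < pi \<longleftrightarrow> j $ i \<in> of_int ` {- int (Suc q)..<int (Suc q)}" for i
    proof -
      obtain z where z: "j $ i = of_int z" using j by (meson Ints_cases)
      have p: "pi / real (Suc q) > 0" by simp
      have gpi: "grid_point (h q) j $ i = of_int z * (pi / real (Suc q))" by (simp add: gp z)
      have pe: "- real (Suc q) * (pi / real (Suc q)) = - pi" "real (Suc q) * (pi / real (Suc q)) = pi"
        by (simp_all del: of_nat_Suc)
      have "- pi \<le> grid_point (h q) j $ i \<longleftrightarrow> (- real (Suc q)) * (pi / Suc q) \<le> of_int z * (pi / Suc q)"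
        by (simp only: gpi pe)
      also have "\<dots> \<longleftrightarrow> - real (Suc q) \<le> of_int z" by (rule mult_le_cancel_right_pos[OF p])
      also have "\<dots> \<longleftrightarrow> - int (Suc q) \<le> z" by linarith
      finally have 1: "- pi \<le> grid_point (h q) j $ i \<longleftrightarrow> - int (Suc q) \<le> z" .
      have "grid_point (h q) j $ i < pi \<longleftrightarrow> of_int z * (pi / Suc q) < real (Suc q) * (pi / Suc q)"
        by (simp only: gpi pe)
      also have "\<dots> \<longleftrightarrow> of_int z < real (Suc q)" by (rule mult_less_cancel_right_pos[OF p])
      also have "\<dots> \<longleftrightarrow> z < int (Suc q)" by linarith
      finally show ?thesis using 1 by (auto simp: z)
    qed
    then show ?thesis by (simp add: B_def lattice_box_def)
  qed
  have J_int: "\<forall>i. j $ i \<in> \<int>" if "j \<in> ?J q" for q j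
  proof
    fix i
    have "j $ i \<in> of_int ` {- int (Suc q)..<int (Suc q)}" using that by (simp only: lattice_box_def mem_Collect_eq)
    then show "j $ i \<in> \<int>" by auto
  qed
  have h0: "h q i > 0" "h q i \<le> pi" "(\<lambda>q. h q i) \<longlonglongrightarrow> 0" for q i
  proof -
    show "h q i > 0" "h q i \<le> pi" by (simp_all add: h_def field_simps)
    show "(\<lambda>q. h q i) \<longlonglongrightarrow> 0" unfolding h_def by (rule LIMSEQ_Suc[OF lim_const_over_n])
  qed
  have fl: "(\<lambda>q. grid_floor (h q) x) \<longlonglongrightarrow> x" for x
    by (rule grid_floor_tendsto) (rule h0)+
  have BC: "B \<subseteq> ?C" by (auto simp: B_def mem_box_cart less_imp_le)
  have CB: "interior ?C \<subseteq> B" unfolding interior_cbox by (auto simp: B_def mem_box_cart less_imp_le)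
  have "emeasure lborel (frontier ?C) = 0"
  proof -
    have "frontier ?C \<in> null_sets lebesgue"
      using negligible_convex_frontier[of ?C] by (simp add: negligible_iff_null_sets)
    then show ?thesis by (simp add: null_sets_completion_iff null_sets_def)
  qed
  then have AE: "AE x in lborel. x \<notin> frontier ?C"
    by (intro AE_I[where N = "frontier ?C"]) auto
  have "(\<lambda>q. of_real (\<Prod>i\<in>UNIV. h q i) * (\<Sum>j\<in>?J q. (\<lambda>x. indicator B x *\<^sub>R G x) (grid_point (h q) j)))
     \<longlonglongrightarrow> (\<integral>x. indicator ?C x *\<^sub>R G x \<partial>lborel)"
  proof (rule riemann_sum_tendsto[where H = pi and R = pi and M = "max K 0"])
    show "finite (?J q)" for q by (intro finite_lattice_box) simp
    show "j \<in> ?J q" if "\<forall>i. j $ i \<in> \<int>" "indicator B (grid_point (h q) j) *\<^sub>R G (grid_point (h q) j) \<noteq> 0" for q j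
      using that B_iff[OF that(1), of q] by (auto simp: indicator_def split: if_splits)
    show "cmod (indicator B x *\<^sub>R G x) \<le> max K 0" for x
      using K[of x] by (auto simp: indicator_def le_max_iff_disj)
    show "\<forall>i. \<bar>x $ i\<bar> \<le> pi" if "indicator B x *\<^sub>R G x \<noteq> 0" for x
      using that by (auto simp: indicator_def B_def abs_le_iff less_imp_le split: if_splits) (metis minus_le_iff)
    show "(\<lambda>x. indicator ?C x *\<^sub>R G x) \<in> borel_measurable borel"
      by (intro borel_measurable_continuous_on_indicator continuous_on_subset[OF G]) auto
    show "AE x in lborel. (\<lambda>q. indicator B (grid_floor (h q) x) *\<^sub>R G (grid_floor (h q) x)) \<longlonglongrightarrow> indicator ?C x *\<^sub>R G x"
      using AE
    proof eventually_elim
      case (elim x)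
      have Gx: "(\<lambda>q. G (grid_floor (h q) x)) \<longlonglongrightarrow> G x"
        using G by (intro isCont_tendsto_compose[OF _ fl]) (simp add: continuous_on_eq_continuous_at)
      show ?case
      proof (cases "x \<in> ?C")
        case True
        then have "x \<in> interior ?C" using elim by (auto simp: frontier_def)
        then have "eventually (\<lambda>q. grid_floor (h q) x \<in> interior ?C) sequentially"
          by (intro topological_tendstoD[OF fl]) auto
        then have "eventually (\<lambda>q. G (grid_floor (h q) x) = indicator B (grid_floor (h q) x) *\<^sub>R G (grid_floor (h q) x)) sequentially"
          by eventually_elim (use CB in \<open>auto simp: indicator_def\<close>)
        from Lim_transform_eventually[OF Gx this] show ?thesis using True by simp
      next
        case False
        then have "eventually (\<lambda>q. grid_floor (h q) x \<in> - ?C) sequentially"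
          by (intro topological_tendstoD[OF fl]) auto
        then have "eventually (\<lambda>q. indicator B (grid_floor (h q) x) *\<^sub>R G (grid_floor (h q) x) = 0) sequentially"
          by eventually_elim (use BC in \<open>auto simp: indicator_def\<close>)
        then show ?thesis using False by (simp add: tendsto_eventually)
      qed
    qed
  qed (rule h0 J_int | assumption)+
  then have "(\<lambda>q. of_real (\<Prod>i\<in>UNIV. h q i) * (\<Sum>j\<in>?J q. (\<lambda>x. indicator B x *\<^sub>R G x) (grid_point (h q) j)) / of_real ((2 * pi) ^ CARD('d)))
     \<longlonglongrightarrow> (\<integral>x. indicator ?C x *\<^sub>R G x \<partial>lborel) / of_real ((2 * pi) ^ CARD('d))"
    by (intro tendsto_divide tendsto_const) auto
  moreover have "of_real (\<Prod>i\<in>UNIV. h q i) * (\<Sum>j\<in>?J q. (\<lambda>x. indicator B x *\<^sub>R G x) (grid_point (h q) j)) / of_real ((2 * pi) ^ CARD('d)) =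
    (\<Sum>k\<in>?J q. G ((pi / Suc q) *\<^sub>R k)) / of_nat ((2 * Suc q) ^ CARD('d))" for q
  proof -
    have "(\<Sum>j\<in>?J q. (\<lambda>x. indicator B x *\<^sub>R G x) (grid_point (h q) j)) = (\<Sum>k\<in>?J q. G ((pi / Suc q) *\<^sub>R k))"
    proof (rule sum.cong[OF refl])
      fix j assume "j \<in> ?J q"
      then have "grid_point (h q) j \<in> B" using B_iff[OF J_int] by blast
      then show "(\<lambda>x. indicator B x *\<^sub>R G x) (grid_point (h q) j) = G ((pi / Suc q) *\<^sub>R j)"
        by (simp add: gp)
    qed
    moreover have "complex_of_real (\<Prod>i\<in>(UNIV::'d set). h q i) * X / of_real ((2 * pi) ^ CARD('d)) = X / of_nat ((2 * Suc q) ^ CARD('d))" for X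
    proof -
      have "(\<Prod>i\<in>(UNIV::'d set). h q i) / (2 * pi) ^ CARD('d) = 1 / real ((2 * Suc q) ^ CARD('d))"
        by (simp add: h_def power_divide power_mult_distrib del: of_nat_Suc mult_Suc_right)
      then have "complex_of_real ((\<Prod>i\<in>(UNIV::'d set). h q i) / (2 * pi) ^ CARD('d)) = 1 / of_nat ((2 * Suc q) ^ CARD('d))"
        by (simp only: of_real_divide of_real_1 of_real_of_nat_eq)
      then have "X * complex_of_real ((\<Prod>i\<in>(UNIV::'d set). h q i) / (2 * pi) ^ CARD('d)) = X * (1 / of_nat ((2 * Suc q) ^ CARD('d)))"
        by (rule arg_cong)
      then have "X * (complex_of_real (\<Prod>i\<in>(UNIV::'d set). h q i) / of_real ((2 * pi) ^ CARD('d))) = X / of_nat ((2 * Suc q) ^ CARD('d))"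
        unfolding of_real_divide by (simp only: times_divide_eq_right mult_1_right)
      then show ?thesis by (subst mult.commute) (simp only: times_divide_eq_right)
    qed
    ultimately show ?thesis by (simp only:)
  qed
  ultimately show ?thesis by (simp only:)
qed

context sw_sequence
begin

abbreviation "SWmat k \<equiv> map_mat complex_of_real ((1 / (real (n k))\<^sup>2) \<cdot>\<^sub>m shortley_weller_mat \<Omega> a b c (N k))"

abbreviation "freq Q \<equiv> lattice_box (\<lambda>_::'d. {- int Q..<int Q})"

definition freq_mean :: "(complex \<Rightarrow> complex) \<Rightarrow> nat \<Rightarrow> real ^ 'd::{finite,linorder} \<Rightarrow> complex" where
  "freq_mean F Q x = (\<Sum>\<theta>\<in>freq Q. F (of_real (sw_symbol \<nu> a x ((pi / Q) *\<^sub>R \<theta>)))) / of_nat ((2 * Q) ^ CARD('d))"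

lemma compact_\<Omega>: "compact \<Omega>"
proof -
  have "\<Omega> \<subseteq> cbox (\<chi> i. 0) (\<chi> i. 1)"
    using scheme[of 0]
    by (auto simp: sw_scheme_ordered_def sw_scheme_cube_def sw_scheme_cube_axioms_def subset_iff mem_box_cart)
  then show ?thesis using closed bounded_subset[OF bounded_cbox] by (auto simp: compact_eq_bounded_closed)
qed

lemma coefficient_variation:
  assumes r: "r \<longlonglongrightarrow> 0" and \<delta>: "\<delta> > 0"
  shows "eventually (\<lambda>k. \<forall>i x y. x \<in> interior \<Omega> \<longrightarrow> y \<in> interior \<Omega> \<longrightarrow> dist x y \<le> r k \<longrightarrow> \<bar>a i x - a i y\<bar> \<le> \<delta>) sequentially"
proof (rule eventually_all_finite)
  fix i
  have "uniformly_continuous_on \<Omega> (a i)"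
    using a_cont compact_\<Omega> by (rule compact_uniformly_continuous)
  then obtain d where d: "d > 0" "\<And>x y. x \<in> \<Omega> \<Longrightarrow> y \<in> \<Omega> \<Longrightarrow> dist y x < d \<Longrightarrow> dist (a i y) (a i x) < \<delta>"
    using \<delta> unfolding uniformly_continuous_on_def by metis
  have "eventually (\<lambda>k. r k < d) sequentially" using order_tendstoD(2)[OF r d(1)] .
  then show "eventually (\<lambda>k. \<forall>x y. x \<in> interior \<Omega> \<longrightarrow> y \<in> interior \<Omega> \<longrightarrow> dist x y \<le> r k \<longrightarrow> \<bar>a i x - a i y\<bar> \<le> \<delta>) sequentially"
  proof eventually_elim
    case (elim k)
    have "\<bar>a i x - a i y\<bar> \<le> \<delta>" if "x \<in> interior \<Omega>" "y \<in> interior \<Omega>" "dist x y \<le> r k" for x y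
      using d(2)[of y x] that elim interior_subset[of \<Omega>] by (auto simp: dist_real_def subset_iff)
    then show ?case by blast
  qed
qed

text \<open>Order of choices: \<open>C\<close> for the tolerance \<open>e / 4\<close>; then
  \<open>Q0\<close> and \<open>\<delta>\<close>, which push the cut-off error and the variation of
  the coefficients below \<open>e / 4\<close> each; last \<open>k\<close>. The remaining quarter
  absorbs the terms that vanish as \<open>k\<close> grows.\<close>

lemma eigenvalue_average_close:
  assumes K: "\<And>z. cmod (F z) \<le> K"
    and uc: "\<And>\<epsilon>. \<epsilon> > 0 \<Longrightarrow> \<exists>C\<ge>0. \<forall>z w. cmod (F z - F w) \<le> \<epsilon> + C * (cmod (z - w))\<^sup>2"
    and e: "e > 0"
  shows "\<exists>Q0. \<forall>Q\<ge>Q0. Q > 0 \<longrightarrow> eventually (\<lambda>k. cmod ((\<Sum>z\<in>#eigenvalues_mset (SWmat k). F z) / of_nat (card (S k)) -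
     (\<Sum>m\<in>S k. freq_mean F Q (sw_point (N k) m)) / of_nat (card (S k))) < e) sequentially"
proof -
  define d where "d = real CARD('d)"
  define V where "V = (\<Sum>i\<in>UNIV. (\<nu> $ i)\<^sup>2)"
  \<comment> \<open>The value of \<open>offdiag_bound\<close>, the same for all \<open>k\<close>;
    written out so that limits in \<open>k\<close> can be taken outside the locale of a single
    grid.\<close>
  define OB where "OB = (\<Sum>i\<in>UNIV. 2 * (2 * (\<nu> $ i)\<^sup>2 * M + \<nu> $ i * M))"
  obtain C where C: "C \<ge> 0" "\<And>z w. cmod (F z - F w) \<le> e / 4 + C * (cmod (z - w))\<^sup>2"
    using uc[of "e / 4"] e by auto
  have lQ: "(\<lambda>Q. C * (2 * (384 * d\<^sup>2 * (V * M)\<^sup>2 / 2)) / real Q) \<longlonglongrightarrow> 0"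
    by (rule lim_const_over_n)
  then have "eventually (\<lambda>Q. C * (2 * (384 * d\<^sup>2 * (V * M)\<^sup>2 / 2)) / real Q < e / 4) sequentially"
    using e by (intro order_tendstoD(2)[OF lQ]) simp
  then obtain Q0 where Q0: "\<And>Q. Q \<ge> Q0 \<Longrightarrow> C * (2 * (384 * d\<^sup>2 * (V * M)\<^sup>2 / 2)) / real Q < e / 4"
    by (auto simp: eventually_sequentially)
  have l\<delta>: "((\<lambda>\<delta>. C * (2 * ((2 + 12 * d\<^sup>2) * (\<Sum>i\<in>UNIV. 2 * (\<nu> $ i)\<^sup>2 * \<delta>)\<^sup>2))) \<longlongrightarrow> C * (2 * ((2 + 12 * d\<^sup>2) * (\<Sum>i\<in>UNIV. 2 * (\<nu> $ i)\<^sup>2 * 0)\<^sup>2))) (at_right 0)"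
    by (intro tendsto_intros)
  then have "eventually (\<lambda>\<delta>. C * (2 * ((2 + 12 * d\<^sup>2) * (\<Sum>i\<in>UNIV. 2 * (\<nu> $ i)\<^sup>2 * \<delta>)\<^sup>2)) < e / 4) (at_right 0)"
    using e by (intro order_tendstoD(2)[OF l\<delta>]) simp
  then obtain \<delta> where \<delta>: "\<delta> > 0" "C * (2 * ((2 + 12 * d\<^sup>2) * (\<Sum>i\<in>UNIV. 2 * (\<nu> $ i)\<^sup>2 * \<delta>)\<^sup>2)) < e / 4"
    unfolding eventually_at_right_field using dense[of 0] by metis
  show ?thesis
  proof (intro exI[of _ Q0] allI impI)
    fix Q assume Q: "Q \<ge> Q0" "Q > 0"
    define r where "r k = (\<Sum>i\<in>UNIV. (2 * real Q + 1) * sw_step (N k) i)" for k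
    have "r \<longlonglongrightarrow> (\<Sum>i\<in>(UNIV :: 'd set). (2 * real Q + 1) * 0)"
      unfolding r_def by (intro tendsto_intros step)
    then have r: "r \<longlonglongrightarrow> 0" by simp
    let ?bad = "\<lambda>k. real (card {m \<in> S k. \<not> cball (sw_point (N k) m) (r k) \<subseteq> interior \<Omega>})"
    define \<beta> where "\<beta> k = ?bad k / real (card (S k))" for k
    have \<beta>: "\<beta> \<longlonglongrightarrow> 0" unfolding \<beta>_def by (rule bad_limit[OF r])
    define RB where "RB k = (2 + 12 * d\<^sup>2) * ((\<Sum>i\<in>UNIV. 2 * (\<nu> $ i)\<^sup>2 * \<delta> + \<nu> $ i * M / n k) + M / n k)\<^sup>2 + 384 * d\<^sup>2 * (V * M)\<^sup>2 / (2 * Q)" for k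
    define E where "E k = 2 * K * \<beta> k + e / 4 + C * (2 * RB k + 4 * d * ((OB / n k)\<^sup>2 + \<beta> k * (2 * OB)\<^sup>2))" for k
    have n0: "(\<lambda>k. x / real (n k)) \<longlonglongrightarrow> 0" for x
      by (rule filterlim_compose[OF lim_const_over_n n_top])
    have "RB \<longlonglongrightarrow> (2 + 12 * d\<^sup>2) * ((\<Sum>i\<in>UNIV. 2 * (\<nu> $ i)\<^sup>2 * \<delta> + 0) + 0)\<^sup>2 + 384 * d\<^sup>2 * (V * M)\<^sup>2 / (2 * Q)"
      unfolding RB_def by (intro tendsto_intros n0)
    then have "E \<longlonglongrightarrow> 2 * K * 0 + e / 4 + C * (2 * ((2 + 12 * d\<^sup>2) * ((\<Sum>i\<in>UNIV. 2 * (\<nu> $ i)\<^sup>2 * \<delta> + 0) + 0)\<^sup>2 + 384 * d\<^sup>2 * (V * M)\<^sup>2 / (2 * Q)) + 4 * d * (0\<^sup>2 + 0 * (2 * OB)\<^sup>2))"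
      unfolding E_def by (intro tendsto_intros n0 \<beta>)
    moreover have "2 * K * 0 + e / 4 + C * (2 * ((2 + 12 * d\<^sup>2) * ((\<Sum>i\<in>UNIV. 2 * (\<nu> $ i)\<^sup>2 * \<delta> + 0) + 0)\<^sup>2 + 384 * d\<^sup>2 * (V * M)\<^sup>2 / (2 * Q)) + 4 * d * (0\<^sup>2 + 0 * (2 * OB)\<^sup>2)) < e"
      using \<delta>(2) Q0[OF Q(1)] Q(2) e by (simp add: distrib_left)
    ultimately have "eventually (\<lambda>k. E k < e) sequentially" by (rule order_tendstoD(2))
    with coefficient_variation[OF r \<delta>(1)] card_S_pos
    show "eventually (\<lambda>k. cmod ((\<Sum>z\<in>#eigenvalues_mset (SWmat k). F z) / of_nat (card (S k)) -
     (\<Sum>m\<in>S k. freq_mean F Q (sw_point (N k) m)) / of_nat (card (S k))) < e) sequentially"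
    proof eventually_elim
      case (elim k)
      interpret s: sw_scheme_ordered \<Omega> a b c \<nu> "N k" "n k" M by (rule scheme)
      let ?X = "(\<Sum>z\<in>#eigenvalues_mset (SWmat k). F z)"
      let ?Y = "\<Sum>m\<in>S k. \<Sum>\<theta>\<in>freq Q. F (of_real (sw_symbol \<nu> a (sw_point (N k) m) ((pi / Q) *\<^sub>R \<theta>)))"
      let ?s = "real (card (S k))" and ?N = "of_nat ((2 * Q) ^ CARD('d)) :: complex"
      have s0: "?s > 0" using elim(2) by simp
      have "cmod (?X - ?Y / ?N) \<le>
        2 * K * ?bad k + e / 4 * ?s +
        C * (2 * (?s * s.residual_bound Q \<delta>) + 4 * CARD('d) * (?s * (s.offdiag_bound / n k)\<^sup>2
          + ?bad k * (2 * s.offdiag_bound)\<^sup>2))"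
        unfolding s.A_def[symmetric]
        by (rule s.eigenvalue_sum_estimate[OF Q(2) M _ _ _ K C(2) _ C(1)])
          (use \<delta>(1) e elim(1) in \<open>auto simp: r_def\<close>)
      also have "?bad k = \<beta> k * ?s"
        unfolding \<beta>_def using s0 by simp
      also have "s.residual_bound Q \<delta> = RB k"
        by (simp add: s.residual_bound_def RB_def d_def V_def)
      also have "s.offdiag_bound = OB" by (simp add: s.offdiag_bound_def OB_def)
      also have "2 * K * (\<beta> k * ?s) + e / 4 * ?s + C * (2 * (?s * RB k) + 4 * CARD('d) * (?s * (OB / n k)\<^sup>2 + \<beta> k * ?s * (2 * OB)\<^sup>2)) = E k * ?s"
        unfolding E_def d_def by (simp add: algebra_simps)
      finally have "cmod (?X - ?Y / ?N) / ?s \<le> E k"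
        using s0 by (simp add: pos_divide_le_eq)
      also have "cmod (?X - ?Y / ?N) / ?s =
        cmod (?X / of_nat (card (S k)) - ?Y / ?N / of_nat (card (S k)))"
        by (simp only: diff_divide_distrib[symmetric] norm_divide norm_of_nat)
      finally show ?case using elim(3) unfolding freq_mean_def by (simp only: sum_divide_distrib)
    qed
  qed
qed

abbreviation "torus \<equiv> cbox (\<chi> i. - pi) (\<chi> i. pi) :: (real ^ 'd::{finite,linorder}) set"

lemma sw_symbol_continuous: "continuous_on (interior \<Omega> \<times> UNIV) (\<lambda>(x, \<theta>). sw_symbol \<nu> a x \<theta>)"
proof -
  have "continuous_on (interior \<Omega> \<times> (UNIV :: (real ^ 'd::{finite,linorder}) set)) (\<lambda>p. a i (fst p))" for i
    by (rule continuous_on_compose2[OF continuous_on_subset[OF a_cont interior_subset] continuous_on_fst[OF continuous_on_id]]) auto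
  then show ?thesis unfolding sw_symbol_def split_beta
    by (intro continuous_intros) auto
qed

lemma F_symbol_continuous:
  assumes "continuous_on UNIV F"
  shows "continuous_on (interior \<Omega> \<times> UNIV) (\<lambda>(x, \<theta>). F (complex_of_real (sw_symbol \<nu> a x \<theta>)))"
proof -
  have "continuous_on (interior \<Omega> \<times> UNIV) (\<lambda>p. complex_of_real (case p of (x, \<theta>) \<Rightarrow> sw_symbol \<nu> a x \<theta>))"
    by (intro continuous_on_of_real sw_symbol_continuous)
  from continuous_on_compose2[OF assms this] show ?thesis by (simp add: split_beta)
qed

lemma F_symbol_continuous_fst:
  assumes "continuous_on UNIV F"
  shows "continuous_on (interior \<Omega>) (\<lambda>x. F (complex_of_real (sw_symbol \<nu> a x \<theta>)))"
proof -
  have "continuous_on (interior \<Omega>) (\<lambda>x. (x, \<theta>))" by (intro continuous_intros)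
  from continuous_on_compose2[OF F_symbol_continuous[OF assms] this] show ?thesis by auto
qed

lemma F_symbol_continuous_snd:
  assumes "continuous_on UNIV F"
  shows "continuous_on UNIV (\<lambda>\<theta>. F (complex_of_real (sw_symbol \<nu> a x \<theta>)))"
proof -
  have "continuous_on UNIV (\<lambda>\<theta>. complex_of_real (sw_symbol \<nu> a x \<theta>))"
    unfolding sw_symbol_def by (intro continuous_intros)
  from continuous_on_compose2[OF assms this] show ?thesis by auto
qed

definition torus_mean :: "(complex \<Rightarrow> complex) \<Rightarrow> real ^ 'd::{finite,linorder} \<Rightarrow> complex" where
  "torus_mean F x = (\<integral>\<theta>. indicator torus \<theta> *\<^sub>R F (of_real (sw_symbol \<nu> a x \<theta>)) \<partial>lborel) / of_real ((2 * pi) ^ CARD('d))"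

lemma freq_mean_continuous: "continuous_on UNIV F \<Longrightarrow> continuous_on (interior \<Omega>) (freq_mean F Q)"
  unfolding freq_mean_def divide_inverse
  by (intro continuous_on_mult_right continuous_on_sum F_symbol_continuous_fst)

lemma freq_mean_bound:
  assumes "\<And>z. cmod (F z) \<le> K"
  shows "cmod (freq_mean F Q x) \<le> K"
proof -
  have K: "K \<ge> 0" using order_trans[OF norm_ge_zero assms] .
  have "cmod (\<Sum>\<theta>\<in>freq Q. F (of_real (sw_symbol \<nu> a x ((pi / Q) *\<^sub>R \<theta>)))) \<le> real (card (freq Q)) * K"
    by (intro sum_norm_bound assms)
  then have le: "cmod (\<Sum>\<theta>\<in>freq Q. F (of_real (sw_symbol \<nu> a x ((pi / Q) *\<^sub>R \<theta>)))) \<le> K * real ((2 * Q) ^ CARD('d))"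
    unfolding card_freq_box by (simp only: mult.commute)
  have "cmod (freq_mean F Q x) = cmod (\<Sum>\<theta>\<in>freq Q. F (of_real (sw_symbol \<nu> a x ((pi / Q) *\<^sub>R \<theta>)))) / real ((2 * Q) ^ CARD('d))"
    unfolding freq_mean_def norm_divide norm_of_nat ..
  also have "\<dots> \<le> K"
  \<comment> \<open>For \<open>Q = 0\<close> the denominator is 0, and division by it yields 0 by
    convention.\<close>
  proof (cases "Q = 0")
    case False
    then have "0 < real ((2 * Q) ^ CARD('d))" by simp
    then show ?thesis using le by (simp only: pos_divide_le_eq)
  qed (use K in \<open>simp add: zero_power\<close>)
  finally show ?thesis .
qed

lemma freq_mean_integral_limit:
  assumes F: "continuous_on UNIV F" and K: "\<And>z. cmod (F z) \<le> K"
  shows "(\<lambda>q. \<integral>x. indicator (interior \<Omega>) x *\<^sub>R freq_mean F (Suc q) x \<partial>lborel) \<longlonglongrightarrow> (\<integral>x. indicator (interior \<Omega>) x *\<^sub>R torus_mean F x \<partial>lborel)"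
proof -
  have meas: "(\<lambda>x. indicator (interior \<Omega>) x *\<^sub>R freq_mean F (Suc q) x) \<in> borel_measurable borel" for q
    by (intro borel_measurable_continuous_on_indicator freq_mean_continuous F) simp
  have lim: "(\<lambda>q. indicator (interior \<Omega>) x *\<^sub>R freq_mean F (Suc q) x) \<longlonglongrightarrow> indicator (interior \<Omega>) x *\<^sub>R torus_mean F x" for x
    unfolding freq_mean_def torus_mean_def
    by (intro tendsto_scaleR tendsto_const torus_riemann_sum[where K = K] F_symbol_continuous_snd F K)
  \<comment> \<open>\<open>torus_mean\<close> is a pointwise limit of continuous frequency averages
    on the interior, so its measurability needs no argument about parameter integrals.\<close>
  have meas': "(\<lambda>x. indicator (interior \<Omega>) x *\<^sub>R torus_mean F x) \<in> borel_measurable borel"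
    by (rule borel_measurable_LIMSEQ_metric[OF meas lim])
  show ?thesis
  proof (rule integral_dominated_convergence[where w = "\<lambda>x. K * indicator (interior \<Omega>) x"])
    show "integrable lborel (\<lambda>x. K * indicator (interior \<Omega>) x)"
      using interior_finite by (intro integrable_mult_right integrable_real_indicator) auto
    show "AE x in lborel. norm (indicator (interior \<Omega>) x *\<^sub>R freq_mean F (Suc q) x) \<le> K * indicator (interior \<Omega>) x" for q
      using freq_mean_bound[OF K] by (intro AE_I2) (auto simp: indicator_def)
  qed (use meas meas' lim in auto)
qed

lemma torus_measure: "emeasure lborel torus = ennreal ((2 * pi) ^ CARD('d))"
proof -
  have ne: "torus \<noteq> {}" by (simp add: interval_ne_empty_cart)
  have "measure lborel torus = (2 * pi) ^ CARD('d)"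
    unfolding content_cbox_cart[OF ne] by simp
  then show ?thesis using emeasure_lborel_cbox_finite[of "\<chi> i. - pi" "(\<chi> i. pi) :: real ^ 'd::{finite,linorder}"]
    by (simp add: emeasure_eq_ennreal_measure)
qed

lemma emeasure_phase_space: "emeasure lborel (interior \<Omega> \<times> torus) = ennreal (\<mu> * (2 * pi) ^ CARD('d))"
proof -
  have "emeasure lborel (interior \<Omega> \<times> torus) = emeasure (lborel \<Otimes>\<^sub>M lborel) (interior \<Omega> \<times> torus)"
    by (simp add: lborel_prod)
  also have "\<dots> = emeasure lborel (interior \<Omega>) * emeasure lborel torus"
    by (rule lborel.emeasure_pair_measure_Times) auto
  also have "emeasure lborel (interior \<Omega>) = ennreal \<mu>"
    using interior_finite by (simp add: \<mu>_def emeasure_eq_ennreal_measure)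
  finally show ?thesis using pos by (simp add: torus_measure ennreal_mult \<mu>_def)
qed

lemma phase_space_integral:
  assumes F: "continuous_on UNIV F" and K: "\<And>z. cmod (F z) \<le> K"
  shows "(\<integral>p. indicator (interior \<Omega> \<times> torus) p *\<^sub>R (case p of (x, \<theta>) \<Rightarrow> F (of_real (sw_symbol \<nu> a x \<theta>))) \<partial>lborel) =
    of_real ((2 * pi) ^ CARD('d)) * (\<integral>x. indicator (interior \<Omega>) x *\<^sub>R torus_mean F x \<partial>lborel)"
    and "(\<lambda>p. indicator (interior \<Omega> \<times> torus) p *\<^sub>R (case p of (x, \<theta>) \<Rightarrow> F (of_real (sw_symbol \<nu> a x \<theta>)))) \<in> borel_measurable borel"
proof -
  let ?g = "\<lambda>p. indicator (interior \<Omega> \<times> torus) p *\<^sub>R (case p of (x, \<theta>) \<Rightarrow> F (complex_of_real (sw_symbol \<nu> a x \<theta>)))"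
  have D: "interior \<Omega> \<times> torus \<in> sets borel"
    by (intro borel_Times) auto
  show meas: "?g \<in> borel_measurable borel"
    by (intro borel_measurable_continuous_on_indicator D continuous_on_subset[OF F_symbol_continuous[OF F]]) auto
  \<comment> \<open>Fubini requires joint integrability, which holds for a bounded function on a set
    of finite measure.\<close>
  have "integrable lborel ?g"
  proof (rule Bochner_Integration.integrable_bound)
    show "integrable lborel (\<lambda>p. K * indicator (interior \<Omega> \<times> torus) p :: real)"
      using D by (intro integrable_mult_right integrable_real_indicator) (auto simp: emeasure_phase_space)
    show "AE p in lborel. norm (?g p) \<le> norm (K * indicator (interior \<Omega> \<times> torus) p)"
      using K order_trans[OF norm_ge_zero K] by (intro AE_I2) (auto simp: indicator_def)
  qed (use meas in simp)
  then have int: "integrable (lborel \<Otimes>\<^sub>M lborel) ?g" by (simp add: lborel_prod)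
  have "(\<integral>p. ?g p \<partial>lborel) = (\<integral>p. ?g p \<partial>(lborel \<Otimes>\<^sub>M lborel))" by (simp add: lborel_prod)
  also have "\<dots> = (\<integral>x. \<integral>\<theta>. ?g (x, \<theta>) \<partial>lborel \<partial>lborel)"
    by (rule lborel_pair.integral_fst'[OF int, symmetric])
  also have "\<dots> = (\<integral>x. of_real ((2 * pi) ^ CARD('d)) * (indicator (interior \<Omega>) x *\<^sub>R torus_mean F x) \<partial>lborel)"
  proof (rule Bochner_Integration.integral_cong[OF refl])
    fix x
    have c: "complex_of_real ((2 * pi) ^ CARD('d)) \<noteq> 0" by simp
    have "?g (x, \<theta>) = indicator (interior \<Omega>) x *\<^sub>R (indicator torus \<theta> *\<^sub>R F (of_real (sw_symbol \<nu> a x \<theta>)))" for \<theta>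
      by (simp add: indicator_def)
    then have "(\<integral>\<theta>. ?g (x, \<theta>) \<partial>lborel) = indicator (interior \<Omega>) x *\<^sub>R (\<integral>\<theta>. indicator torus \<theta> *\<^sub>R F (of_real (sw_symbol \<nu> a x \<theta>)) \<partial>lborel)"
      by (simp only: integral_scaleR_right)
    also have "(\<integral>\<theta>. indicator torus \<theta> *\<^sub>R F (of_real (sw_symbol \<nu> a x \<theta>)) \<partial>lborel) = of_real ((2 * pi) ^ CARD('d)) * torus_mean F x"
      unfolding torus_mean_def using c by simp
    finally show "(\<integral>\<theta>. ?g (x, \<theta>) \<partial>lborel) = of_real ((2 * pi) ^ CARD('d)) * (indicator (interior \<Omega>) x *\<^sub>R torus_mean F x)"
      by (simp only: mult_scaleR_right)
  qed
  finally show "(\<integral>p. ?g p \<partial>lborel) = of_real ((2 * pi) ^ CARD('d)) * (\<integral>x. indicator (interior \<Omega>) x *\<^sub>R torus_mean F x \<partial>lborel)"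
    by (simp only: integral_mult_right_zero)
qed

text \<open>The eigenvalue average is close to the frequency average only for large
  \<open>Q\<close>, and then only eventually in \<open>k\<close>. Hence \<open>Q\<close> is fixed
  first, beyond both the threshold \<open>Q0\<close> and the one for the torus integral, and
  \<open>k\<close> tends to infinity afterwards.\<close>

lemma eigenvalue_average_limit:
  assumes F: "continuous_on UNIV F" "compact (closure {z. F z \<noteq> 0})"
  shows "(\<lambda>k. (\<Sum>z\<in>#eigenvalues_mset (SWmat k). F z) / of_nat (card (S k))) \<longlonglongrightarrow>
    (\<integral>x. indicator (interior \<Omega>) x *\<^sub>R torus_mean F x \<partial>lborel) / of_real \<mu>"
proof -
  obtain K where K: "\<And>z. cmod (F z) \<le> K"
    and uc: "\<And>\<epsilon>. \<epsilon> > 0 \<Longrightarrow> \<exists>C\<ge>0. \<forall>z w. cmod (F z - F w) \<le> \<epsilon> + C * (cmod (z - w))\<^sup>2"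
    using compact_support_bounds[OF F] by blast
  let ?u = "\<lambda>k. (\<Sum>z\<in>#eigenvalues_mset (SWmat k). F z) / of_nat (card (S k))"
  let ?v = "\<lambda>Q k. (\<Sum>m\<in>S k. freq_mean F Q (sw_point (N k) m)) / of_nat (card (S k))"
  let ?V = "\<lambda>Q. (\<integral>x. indicator (interior \<Omega>) x *\<^sub>R freq_mean F Q x \<partial>lborel) / complex_of_real \<mu>"
  let ?W = "(\<integral>x. indicator (interior \<Omega>) x *\<^sub>R torus_mean F x \<partial>lborel) / complex_of_real \<mu>"
  have V: "(\<lambda>q. ?V (Suc q)) \<longlonglongrightarrow> ?W"
    using pos by (intro tendsto_divide freq_mean_integral_limit[OF F(1) K] tendsto_const) (auto simp: \<mu>_def)
  have v: "(\<lambda>k. ?v Q k) \<longlonglongrightarrow> ?V Q" for Q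
    by (intro average_limit[where K = K] freq_mean_continuous F freq_mean_bound K)
  show ?thesis
  proof (rule tendstoI)
    fix e :: real assume e: "e > 0"
    then have e3: "e / 3 > 0" by simp
    obtain Q0 where Q0: "\<forall>Q\<ge>Q0. Q > 0 \<longrightarrow> eventually (\<lambda>k. cmod (?u k - ?v Q k) < e / 3) sequentially"
      using eigenvalue_average_close[OF K uc e3] by (rule exE)
    obtain q0 where q0: "\<And>q. q \<ge> q0 \<Longrightarrow> dist (?V (Suc q)) ?W < e / 3"
      using tendstoD[OF V e3] by (auto simp: eventually_sequentially)
    define Q where "Q = Suc (max Q0 q0)"
    have VW: "dist (?V Q) ?W < e / 3" unfolding Q_def by (rule q0) simp
    have "eventually (\<lambda>k. cmod (?u k - ?v Q k) < e / 3) sequentially"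
      by (rule Q0[rule_format]) (auto simp: Q_def)
    moreover have "eventually (\<lambda>k. dist (?v Q k) (?V Q) < e / 3) sequentially"
      by (rule tendstoD[OF v e3])
    ultimately show "eventually (\<lambda>k. dist (?u k) ?W < e) sequentially"
    proof eventually_elim
      case (elim k)
      have tri: "dist w z \<le> dist w x + (dist x y + dist y z)" for w x y z :: complex
        using dist_triangle[of w z x] dist_triangle[of x z y] by linarith
      show ?case
        using elim VW tri[of "?u k" ?W "?v Q k" "?V Q"] unfolding dist_norm[of "?u k" "?v Q k"] by linarith
    qed
  qed
qed

end

section \<open>Admissible grid parameters and final assembly\<close>

text \<open>All positive multiples of a common denominator of the coordinates are
  admissible.\<close>

lemma infinite_integral_multiples:
  fixes \<nu> :: "real ^ 'd"
  assumes "\<And>i. \<nu> $ i \<in> \<rat>"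
  shows "infinite {n :: nat. 0 < n \<and> (\<forall>i. real n * \<nu> $ i \<in> \<int>)}"
proof -
  have "\<exists>q :: nat. q > 0 \<and> real q * \<nu> $ i \<in> \<int>" for i
  proof -
    obtain p q :: int where "q > 0" "\<nu> $ i = of_int p / of_int q"
      using assms[of i] by (auto elim: Rats_cases')
    then show ?thesis by (intro exI[of _ "nat q"]) simp
  qed
  then obtain q :: "'d \<Rightarrow> nat" where q: "\<And>i. q i > 0" "\<And>i. real (q i) * \<nu> $ i \<in> \<int>" by metis
  define D where "D = (\<Prod>i\<in>UNIV. q i)"
  have D: "D > 0" using q(1) by (simp add: D_def prod_pos)
  have int: "real (t * D) * \<nu> $ i \<in> \<int>" for t i
  proof -
    have "D = q i * (\<Prod>i\<in>UNIV - {i}. q i)" unfolding D_def by (rule prod.remove) auto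
    then have "real (t * D) * \<nu> $ i = of_nat (t * (\<Prod>i\<in>UNIV - {i}. q i)) * (real (q i) * \<nu> $ i)" by simp
    also have "\<dots> \<in> \<int>" by (intro Ints_mult q Ints_of_nat)
    finally show ?thesis .
  qed
  show ?thesis unfolding infinite_nat_iff_unbounded
  proof
    fix m
    have "Suc m * D > m" using D mult_le_mono2[of 1 D "Suc m"] by simp
    then show "\<exists>n>m. n \<in> {n. 0 < n \<and> (\<forall>i. real n * \<nu> $ i \<in> \<int>)}"
      using int[of "Suc m"] by (intro exI[of _ "Suc m * D"]) auto
  qed
qed

theorem theorem5p2:
  fixes \<Omega> :: "(real ^ 'd::{finite,linorder}) set"
    and a b :: "'d \<Rightarrow> real ^ 'd::{finite,linorder} \<Rightarrow> real" and c :: "real ^ 'd::{finite,linorder} \<Rightarrow> real"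
    and \<nu> :: "real ^ 'd::{finite,linorder}" and I :: "nat set" and N :: "nat \<Rightarrow> nat ^ 'd::{finite,linorder}"
  assumes "\<Omega> \<subseteq> {x. \<forall>i. 0 \<le> x $ i \<and> x $ i \<le> 1}"
    and "closed \<Omega>" and "peano_jordan_measurable \<Omega>" and "0 < emeasure lebesgue \<Omega>"
    and "\<And>i. C1_on \<Omega> (a i)"
    and "\<And>i. continuous_on \<Omega> (b i)"
    and "continuous_on \<Omega> c"
    and "\<And>i. \<nu> $ i \<in> \<rat> \<and> 0 < \<nu> $ i"
    and "I = {n. 0 < n \<and> (\<forall>i. real n * \<nu> $ i \<in> \<int>)}"
    and "\<And>n i. n \<in> I \<Longrightarrow> real (N n $ i) + 1 = real n * \<nu> $ i"
  shows "spectral_symbol I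
           (\<lambda>n. map_mat complex_of_real ((1 / (real n)\<^sup>2) \<cdot>\<^sub>m shortley_weller_mat \<Omega> a b c (N n)))
           (interior \<Omega> \<times> cbox (\<chi> i. - pi) (\<chi> i. pi))
           (\<lambda>(x, \<theta>). complex_of_real (\<Sum>i\<in>UNIV. (\<nu> $ i)\<^sup>2 * a i x * (2 - 2 * cos (\<theta> $ i))))"
proof -
  note cube = assms(1) and closed = assms(2) and C1 = assms(5) and b_cont = assms(6) and c_cont = assms(7)
    and \<nu> = assms(8) and I_def = assms(9) and N = assms(10)
  have "infinite {n :: nat. 0 < n \<and> (\<forall>i. real n * \<nu> $ i \<in> \<int>)}"
    by (rule infinite_integral_multiples) (use \<nu> in blast)
  then have I: "infinite I" unfolding I_def .
  have a_cont: "continuous_on \<Omega> (a i)" for i using C1 by (simp add: C1_on_def)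
  have "\<Omega> \<subseteq> cbox (\<chi> i. 0) (\<chi> i. 1)" using cube by (auto simp: subset_iff mem_box_cart)
  then have compact: "compact \<Omega>" using closed bounded_subset[OF bounded_cbox] by (auto simp: compact_eq_bounded_closed)
  have bdd: "\<exists>K. \<forall>x\<in>\<Omega>. \<bar>f x\<bar> \<le> K" if "continuous_on \<Omega> f" for f :: "real ^ 'd::{finite,linorder} \<Rightarrow> real"
    using compact_imp_bounded[OF compact_continuous_image[OF that compact]] by (auto simp: bounded_iff)
  have "\<forall>i. \<exists>K. \<forall>x\<in>\<Omega>. \<bar>a i x\<bar> \<le> K" by (intro allI bdd a_cont)
  from choice[OF this] obtain Ka where "\<forall>i. \<forall>x\<in>\<Omega>. \<bar>a i x\<bar> \<le> Ka i" ..
  then have Ka: "\<bar>a i x\<bar> \<le> Ka i" if "x \<in> \<Omega>" for i x using that by blast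
  have "\<forall>i. \<exists>K. \<forall>x\<in>\<Omega>. \<bar>b i x\<bar> \<le> K" by (intro allI bdd b_cont)
  from choice[OF this] obtain Kb where "\<forall>i. \<forall>x\<in>\<Omega>. \<bar>b i x\<bar> \<le> Kb i" ..
  then have Kb: "\<bar>b i x\<bar> \<le> Kb i" if "x \<in> \<Omega>" for i x using that by blast
  obtain Kc where Kc: "\<And>x. x \<in> \<Omega> \<Longrightarrow> \<bar>c x\<bar> \<le> Kc" using bdd[OF c_cont] by blast
  define M where "M = (\<Sum>i\<in>UNIV. \<bar>Ka i\<bar>) + (\<Sum>i\<in>UNIV. \<bar>Kb i\<bar>) + \<bar>Kc\<bar>"
  have sums: "\<bar>Ka i\<bar> \<le> (\<Sum>i\<in>UNIV. \<bar>Ka i\<bar>)" "\<bar>Kb i\<bar> \<le> (\<Sum>i\<in>UNIV. \<bar>Kb i\<bar>)" for i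
    by (rule member_le_sum; simp)+
  have sums0: "0 \<le> (\<Sum>i\<in>UNIV. \<bar>Ka i\<bar>)" "0 \<le> (\<Sum>i\<in>UNIV. \<bar>Kb i\<bar>)" by (simp_all add: sum_nonneg)
  have M: "M \<ge> 0" using sums0 by (simp add: M_def)
  have bound: "\<bar>a i x\<bar> \<le> M" "\<bar>b i x\<bar> \<le> M" "\<bar>c x\<bar> \<le> M" if "x \<in> interior \<Omega>" for i x
  proof -
    have x: "x \<in> \<Omega>" using that interior_subset by blast
    show "\<bar>a i x\<bar> \<le> M" "\<bar>b i x\<bar> \<le> M" "\<bar>c x\<bar> \<le> M"
      using Ka[OF x, of i] Kb[OF x, of i] Kc[OF x] sums[of i] sums0 unfolding M_def by linarith+
  qed
  have scheme: "sw_scheme_ordered \<Omega> a b c \<nu> (N n) n M" if "n \<in> I" for n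
  proof unfold_locales
    show "n > 0" using that I_def by simp
    show "\<nu> $ i > 0" for i using \<nu> by blast
  qed (rule N[OF that] bound cube | assumption)+
  define e where "e = enumerate I"
  have eI: "e k \<in> I" for k unfolding e_def using I by (rule enumerate_in_set)
  have e_mono: "strict_mono e" unfolding e_def using I by (intro strict_monoI enumerate_mono)
  have fr: "frontier \<Omega> \<in> null_sets lborel"
    using assms(3) by (simp add: peano_jordan_measurable_def null_sets_completion_iff)
  \<comment> \<open>As the frontier is null, positivity of the measure passes from the domain to its
    interior.\<close>
  have "emeasure lebesgue \<Omega> \<le> emeasure lebesgue (interior \<Omega>) + emeasure lebesgue (frontier \<Omega>)"
    using closed by (intro order_trans[OF emeasure_mono emeasure_subadditive]) (auto simp: frontier_def)
  also have "emeasure lebesgue (frontier \<Omega>) = 0"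
    using assms(3) by (simp add: peano_jordan_measurable_def null_sets_def)
  finally have ipos: "emeasure lborel (interior \<Omega>) > 0"
    using assms(4) by (simp add: order_less_le_trans)
  have ifin: "emeasure lborel (interior \<Omega>) < \<infinity>"
    by (rule emeasure_bounded_finite[OF bounded_subset[OF compact_imp_bounded[OF compact] interior_subset]])
  interpret seq: sw_sequence \<Omega> a b c \<nu> "\<lambda>k. N (e k)" e M
  proof (rule sw_sequence.intro)
    show "sw_scheme_ordered \<Omega> a b c \<nu> (N (e k)) (e k) M" for k by (rule scheme[OF eI])
    show "filterlim e at_top sequentially" by (rule filterlim_subseq[OF e_mono])
    show "emeasure lborel (frontier \<Omega>) = 0" using fr by (simp add: null_sets_def)
    show "measure lborel (interior \<Omega>) > 0" using ipos ifin by (simp add: measure_def enn2real_positive_iff)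
  qed (rule closed a_cont M)+
  let ?A = "\<lambda>n. map_mat complex_of_real ((1 / (real n)\<^sup>2) \<cdot>\<^sub>m shortley_weller_mat \<Omega> a b c (N n))"
  let ?D = "interior \<Omega> \<times> cbox (\<chi> i. - pi) (\<chi> i. pi) :: ((real ^ 'd::{finite,linorder}) \<times> (real ^ 'd::{finite,linorder})) set"
  let ?f = "\<lambda>(x, \<theta>). complex_of_real (\<Sum>i\<in>UNIV. (\<nu> $ i)\<^sup>2 * a i x * (2 - 2 * cos (\<theta> $ i)))"
  have f_eq: "?f = (\<lambda>(x, \<theta>). complex_of_real (sw_symbol \<nu> a x \<theta>))" by (simp add: sw_symbol_def)
  have dim: "?A n \<in> carrier_mat (card (sw_indices \<Omega> (N n))) (card (sw_indices \<Omega> (N n)))" if "n \<in> I" for n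
    using sw_scheme_ordered.A_carrier[OF scheme[OF that]] unfolding sw_scheme_ordered.A_def[OF scheme[OF that]] .
  have Dborel: "?D \<in> sets borel" by (intro borel_Times) auto
  have Dleb: "?D \<in> sets lebesgue" using Dborel by simp
  have Dmeas: "emeasure lebesgue ?D = ennreal (seq.\<mu> * (2 * pi) ^ CARD('d))"
    using seq.emeasure_phase_space Dborel by simp
  have \<mu>: "seq.\<mu> > 0" using seq.pos by (simp add: seq.\<mu>_def)
  show ?thesis unfolding spectral_symbol_def
  proof (intro conjI allI impI ballI)
    show "infinite I" by (rule I)
    show "square_mat (?A n)" if "n \<in> I" for n
      by (simp only: square_mat.simps carrier_matD[OF dim[OF that]])
    show "filterlim (\<lambda>n. dim_row (?A n)) at_top (inf sequentially (principal I))"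
    proof (rule filterlim_enumerate[OF I], fold e_def)
      have "dim_row (?A (e k)) = card (sw_indices \<Omega> (N (e k)))" for k by (rule carrier_matD(1)[OF dim[OF eI]])
      then show "filterlim (\<lambda>k. dim_row (?A (e k))) at_top sequentially" using seq.card_S_top by (simp only:)
    qed
    show "?D \<in> sets lebesgue" by (rule Dleb)
    show "0 < emeasure lebesgue ?D" "emeasure lebesgue ?D < \<infinity>"
      unfolding Dmeas using \<mu> by auto
    show "?f \<in> borel_measurable (lebesgue_on ?D)"
    proof (rule continuous_imp_measurable_on_sets_lebesgue[OF _ Dleb])
      \<comment> \<open>With the identity as \<open>F\<close>, the continuity lemma gives continuity
        of the symbol itself.\<close>
      have "continuous_on UNIV (\<lambda>z::complex. z)" by simp
      from seq.F_symbol_continuous[OF this] show "continuous_on ?D ?f"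
        unfolding f_eq by (rule continuous_on_subset) auto
    qed
    fix F :: "complex \<Rightarrow> complex"
    assume F: "continuous_on UNIV F \<and> compact (closure {z. F z \<noteq> 0})"
    obtain K where K: "\<And>z. cmod (F z) \<le> K"
      by (rule compact_support_bounds[OF conjunct1[OF F] conjunct2[OF F]]) (rule that)
    have "(LINT x:?D|lebesgue. F (?f x)) = (\<integral>p. indicator ?D p *\<^sub>R (case p of (x, \<theta>) \<Rightarrow> F (of_real (sw_symbol \<nu> a x \<theta>))) \<partial>lebesgue)"
      unfolding set_lebesgue_integral_def f_eq by (intro Bochner_Integration.integral_cong refl) (simp add: split_beta)
    \<comment> \<open>The integrand is Borel measurable, so passing from the completed measure to
      \<open>lborel\<close> does not change the integral.\<close>
    also have "\<dots> = (\<integral>p. indicator ?D p *\<^sub>R (case p of (x, \<theta>) \<Rightarrow> F (of_real (sw_symbol \<nu> a x \<theta>))) \<partial>lborel)"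
      using seq.phase_space_integral(2)[OF conjunct1[OF F] K] by (intro integral_completion) simp
    also have "\<dots> = of_real ((2 * pi) ^ CARD('d)) * (\<integral>x. indicator (interior \<Omega>) x *\<^sub>R seq.torus_mean F x \<partial>lborel)"
      by (rule seq.phase_space_integral(1)[OF conjunct1[OF F] K])
    finally have int: "(LINT x:?D|lebesgue. F (?f x)) = of_real ((2 * pi) ^ CARD('d)) * (\<integral>x. indicator (interior \<Omega>) x *\<^sub>R seq.torus_mean F x \<partial>lborel)" .
    have mD: "measure lebesgue ?D = seq.\<mu> * (2 * pi) ^ CARD('d)"
      unfolding measure_def Dmeas using \<mu> by simp
    \<comment> \<open>The powers of \<open>2 * pi\<close> from the definition of
      \<open>torus_mean\<close> and from the volume of the torus cancel.\<close>
    have lim_eq: "1 / complex_of_real (measure lebesgue ?D) * (LINT x:?D|lebesgue. F (?f x)) =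
      (\<integral>x. indicator (interior \<Omega>) x *\<^sub>R seq.torus_mean F x \<partial>lborel) / of_real seq.\<mu>"
      unfolding int mD by simp
    show "((\<lambda>n. 1 / of_nat (dim_row (?A n)) * (\<Sum>z\<in>#eigenvalues_mset (?A n). F z)) \<longlongrightarrow>
           1 / complex_of_real (measure lebesgue ?D) * (LINT x:?D|lebesgue. F (?f x)))
          (inf sequentially (principal I))"
      unfolding lim_eq
    proof (rule filterlim_enumerate[OF I], fold e_def)
      have d: "dim_row (?A (e k)) = card (sw_indices \<Omega> (N (e k)))" for k by (rule carrier_matD(1)[OF dim[OF eI]])
      show "(\<lambda>k. 1 / of_nat (dim_row (?A (e k))) * (\<Sum>z\<in>#eigenvalues_mset (?A (e k)). F z)) \<longlonglongrightarrow>
        (\<integral>x. indicator (interior \<Omega>) x *\<^sub>R seq.torus_mean F x \<partial>lborel) / of_real seq.\<mu>"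
        using seq.eigenvalue_average_limit[OF conjunct1[OF F] conjunct2[OF F]]
        unfolding d by (simp only: times_divide_eq_left mult_1_left)
    qed
  qed
qed

end
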